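(* Let $\mathbf{T}>0$, let $r\ge 1$ be an integer, and consider the canonical system $$-ij\frac{d}{d\tau}U(\tau,\lambda)=\lambda U(\tau,\lambda)+\begin{bmatrix}0&v(\tau)\\ v(\tau)^*&0\end{bmatrix}U(\tau,\lambda),\qquad 0\le\tau\le\mathbf{T},\qquad j=\begin{bmatrix}I_r&0\\0&-I_r\end{bmatrix},$$ and assume that its potential $v:[0,\mathbf{T}]\to\mathbb{C}^{r\times r}$ is continuous on $[0,\mathbf{T}]$. Then there is a unique $r\times r$ matrix function $k$ which is hermitian, i.e. $k(-t)=k(t)^*$, and continuous on $-\mathbf{T}\le t\le\mathbf{T}$ with possibly a jump discontinuity at the origin, such that the following holds: for each $0<\tau\le\mathbf{T}$ the convolution operator $$(T_\tau f)(t)=f(t)-\int_0^\tau k(t-s)f(s)\,ds,\qquad 0\le t\le\tau,$$ is invertible on $L^2_r(0,\tau)$, and the potential $v$ is given by $$v(\tau)=-i\,\gamma_\tau(\tau,0),\qquad 0<\tau\le\mathbf{T},$$ where $\gamma_\tau(t,s)$ is the resolvent kernel corresponding to $T_\tau$.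
   Context: $L^2_r(0,\tau)$ is the Hilbert space of square integrable $\mathbb{C}^r$-valued functions on $(0,\tau)$. "Continuous on $[-\mathbf{T},\mathbf{T}]$ with possibly a jump discontinuity at the origin" means: continuous on $[-\mathbf{T},0)$ and on $(0,\mathbf{T}]$ with finite one-sided limits at $0$; the value at $0$ plays no role, and functions differing only at $0$ are identified. The resolvent kernel $\gamma_\tau(t,s)$ corresponding to $T_\tau$ is the kernel determined by $$\gamma_\tau(t,s)-\int_0^\tau k(t-\xi)\gamma_\tau(\xi,s)\,d\xi=k(t-s),\qquad 0\le t,s\le\tau,$$ equivalently $(T_\tau^{-1}f)(t)=f(t)+\int_0^\tau\gamma_\tau(t,s)f(s)\,ds$. It is known that $\gamma_\tau(t,s)$ is continuous on each of the triangles $0\le s<t\le\tau$ and $0\le t<s\le\tau$ and extends continuously to the closure of each of them (jumps may appear on the diagonal); hence $\gamma_\tau(\tau,0)$ is well defined. *)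

theory Defs
  imports "HOL-Analysis.Analysis"
begin

text \<open>The Hilbert space of square integrable vector functions on an interval is represented by
  functions; its elements are their classes modulo equality almost everywhere, so identities
  between elements are stated with \<open>AE\<close>.  Every Lebesgue measurable function is almost everywhere
  equal to a Borel one, so using the Borel sets yields the same space.\<close>

abbreviation leb :: "real \<Rightarrow> real measure" where
  "leb \<tau> \<equiv> restrict_space lborel {0<..<\<tau>}"

definition L2 :: "real \<Rightarrow> (real \<Rightarrow> complex^'r) set" where
  "L2 \<tau> = {f \<in> borel_measurable (leb \<tau>). integrable (leb \<tau>) (\<lambda>t. (norm (f t))\<^sup>2)}"

definition L2_norm :: "real \<Rightarrow> (real \<Rightarrow> complex^'r) \<Rightarrow> real" where
  "L2_norm \<tau> f = sqrt (LINT t|leb \<tau>. (norm (f t))\<^sup>2)"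

definition L2_bounded_operator ::
    "real \<Rightarrow> ((real \<Rightarrow> complex^'r) \<Rightarrow> real \<Rightarrow> complex^'r) \<Rightarrow> bool" where
  "L2_bounded_operator \<tau> A \<longleftrightarrow>
     (\<forall>f\<in>L2 \<tau>. A f \<in> L2 \<tau>) \<and>
     (\<forall>f\<in>L2 \<tau>. \<forall>g\<in>L2 \<tau>. (AE t in leb \<tau>. f t = g t) \<longrightarrow> (AE t in leb \<tau>. A f t = A g t)) \<and>
     (\<forall>f\<in>L2 \<tau>. \<forall>g\<in>L2 \<tau>. \<forall>c::complex.
        AE t in leb \<tau>. A (\<lambda>x. c *s f x + g x) t = c *s A f t + A g t) \<and>
     (\<exists>C. \<forall>f\<in>L2 \<tau>. L2_norm \<tau> (A f) \<le> C * L2_norm \<tau> f)"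

definition L2_invertible ::
    "real \<Rightarrow> ((real \<Rightarrow> complex^'r) \<Rightarrow> real \<Rightarrow> complex^'r) \<Rightarrow> bool" where
  "L2_invertible \<tau> A \<longleftrightarrow> L2_bounded_operator \<tau> A \<and>
     (\<exists>B. L2_bounded_operator \<tau> B \<and>
        (\<forall>f\<in>L2 \<tau>. (AE t in leb \<tau>. A (B f) t = f t) \<and> (AE t in leb \<tau>. B (A f) t = f t)))"

definition conj_transpose :: "complex^'m^'n \<Rightarrow> complex^'n^'m" where
  "conj_transpose A = (\<chi> i j. cnj (A $ j $ i))"

text \<open>The value at \<open>0\<close> is left unconstrained, both here and in \<open>hermitian_kernel\<close>.\<close>

definition continuous_with_jump_at_0 :: "real \<Rightarrow> (real \<Rightarrow> complex^'r^'r) \<Rightarrow> bool" where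
  "continuous_with_jump_at_0 T k \<longleftrightarrow>
     continuous_on {-T..<0} k \<and> continuous_on {0<..T} k \<and>
     (\<exists>L. (k \<longlongrightarrow> L) (at_left 0)) \<and> (\<exists>L. (k \<longlongrightarrow> L) (at_right 0))"

definition hermitian_kernel :: "real \<Rightarrow> (real \<Rightarrow> complex^'r^'r) \<Rightarrow> bool" where
  "hermitian_kernel T k \<longleftrightarrow> (\<forall>t\<in>{-T..T} - {0}. k (- t) = conj_transpose (k t))"

definition conv_operator ::
    "(real \<Rightarrow> complex^'r^'r) \<Rightarrow> real \<Rightarrow> (real \<Rightarrow> complex^'r) \<Rightarrow> real \<Rightarrow> complex^'r" where
  "conv_operator k \<tau> f = (\<lambda>t. f t - (LINT s|leb \<tau>. k (t - s) *v f s))"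

definition extends_continuously_to_closure ::
    "(real \<times> real) set \<Rightarrow> (real \<Rightarrow> real \<Rightarrow> complex^'r^'r) \<Rightarrow> bool" where
  "extends_continuously_to_closure S \<gamma> \<longleftrightarrow>
     (\<exists>g. continuous_on (closure S) g \<and> (\<forall>(t, s)\<in>S. g (t, s) = \<gamma> t s))"

text \<open>The integral equation is not imposed on the diagonal: its right-hand side there is the
  irrelevant value \<open>k 0\<close>.  If the convolution operator is invertible, the conditions below
  determine \<open>\<gamma>\<close> at all off-diagonal points of the square, in particular at \<open>(\<tau>, 0)\<close>.\<close>

definition is_resolvent_kernel ::
    "(real \<Rightarrow> complex^'r^'r) \<Rightarrow> real \<Rightarrow> (real \<Rightarrow> real \<Rightarrow> complex^'r^'r) \<Rightarrow> bool" where
  "is_resolvent_kernel k \<tau> \<gamma> \<longleftrightarrow>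
     extends_continuously_to_closure {(t, s). 0 \<le> s \<and> s < t \<and> t \<le> \<tau>} \<gamma> \<and>
     extends_continuously_to_closure {(t, s). 0 \<le> t \<and> t < s \<and> s \<le> \<tau>} \<gamma> \<and>
     (\<forall>t\<in>{0..\<tau>}. \<forall>s\<in>{0..\<tau>}. t \<noteq> s \<longrightarrow>
        \<gamma> t s - (LINT \<xi>|leb \<tau>. k (t - \<xi>) ** \<gamma> \<xi> s) = k (t - s))"

text \<open>The canonical system
  \<open>-i j U' = \<lambda> U + V U\<close>, with \<open>V\<close> the off-diagonal block matrix built from \<open>v\<close> and \<open>v\<^sup>*\<close>,
  is determined by its potential \<open>v\<close>, and only \<open>v\<close> enters the relation below.\<close>

definition is_accelerant_of_potential ::
    "real \<Rightarrow> (real \<Rightarrow> complex^'r^'r) \<Rightarrow> (real \<Rightarrow> complex^'r^'r) \<Rightarrow> bool" where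
  "is_accelerant_of_potential T v k \<longleftrightarrow>
     hermitian_kernel T k \<and> continuous_with_jump_at_0 T k \<and>
     (\<forall>\<tau>\<in>{0<..T}.
        L2_invertible \<tau> (conv_operator k \<tau>) \<and>
        (\<exists>\<gamma>. is_resolvent_kernel k \<tau> \<gamma> \<and> v \<tau> = (\<chi> i j. - \<i> * \<gamma> \<tau> 0 $ i $ j)))"

end

theory Submission
  imports Defs
begin

text \<open>Put \<open>\<alpha> = i v\<close>.  If \<open>k\<close> is an accelerant with resolvent kernels \<open>\<gamma>\<^sub>\<tau>\<close>, Krein's formula
  \<open>\<partial>\<gamma>\<^sub>\<tau>(t, s)/\<partial>\<tau> = \<gamma>\<^sub>\<tau>(t, \<tau>) \<gamma>\<^sub>\<tau>(\<tau>, s)\<close> and the difference structure of the kernel show that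
  \<open>X(\<tau>, t) = \<gamma>\<^sub>\<tau>(t, 0)\<close> and \<open>Z(\<tau>, t) = \<gamma>\<^sub>\<tau>(\<tau> - t, \<tau>)\<close> solve the linear Goursat problem
  \<open>\<partial>X/\<partial>\<tau>(\<tau>, t) = Z(\<tau>, \<tau> - t) \<alpha>(\<tau>)\<close>, \<open>\<partial>Z/\<partial>\<tau>(\<tau>, t) = X(\<tau>, \<tau> - t) \<alpha>(\<tau>)\<^sup>*\<close>,
  \<open>X(t, t) = \<alpha>(t) = Z(t, t)\<^sup>*\<close>, while \<open>k\<close> satisfies the Volterra equation
  \<open>k(t) + \<integral>\<^sub>0\<^sup>t k(t - \<xi>) X(t, \<xi>) d\<xi> = \<alpha>(t)\<close>.
  For existence these equations are solved in the opposite direction: first \<open>X\<close> and \<open>Z\<close>, then the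
  values of \<open>k\<close> on the two half-intervals.  The residuals of the resolvent equations for \<open>X\<close> and \<open>Z\<close>
  solve a homogeneous Goursat problem, so they vanish; the operator with kernel \<open>\<gamma>\<^sub>\<tau>\<close> is recovered
  from the triangular factorization \<open>I + \<Gamma>\<^sub>\<tau> = (I + V)(I + V\<^sup>*)\<close>, where \<open>V\<close> has the kernel
  \<open>Z(s, s - t)\<close> for \<open>t < s\<close>.
  For uniqueness, a second accelerant is compared with the constructed one: their difference \<open>d\<close>
  satisfies \<open>|d(\<tau>)| \<le> C \<integral>\<^sub>0\<^sup>\<tau> |d|\<close> as long as the integral is small, and hence vanishes.\<close>

section \<open>Matrix norms\<close>

text \<open>Reversing the direction works because X and Z depend on \<alpha> alone, through a linear
  problem: it is solvable on all of [0, T] without smallness of v, and invertibility of every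
  \<open>T\<^sub>\<tau>\<close> comes out of the construction instead of being presupposed. The
  price is that symmetry is lost: the halves of k come from two separate Volterra equations, and a
  separate argument must show that they are adjoint to each other. X and Z describe the resolvent
  kernel only along edges of the square. Integrating Krein's formula in \<tau> from max(t, s)
  upwards fills the interior; the integrand, Z(\<sigma>, \<sigma> - t) times the adjoint of
  Z(\<sigma>, \<sigma> - s), is that of the product of V and its adjoint, whence the factorization.
  Kernels jump on the diagonal, so integrands are treated as bounded Borel functions, and equations
  are allowed to fail at single points. On an interval of arbitrary length smallness comes from
  weights exp(\<mu> \<tau>): integration gains a factor 1/\<mu>, and \<mu> is chosen as a multiple
  of the bounds on the coefficients.\<close>

lemma norm_mat_sq: "(norm (A::complex^'n^'m))^2 = (\<Sum>i\<in>UNIV. \<Sum>j\<in>UNIV. (norm (A $ i $ j))^2)"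
  by (simp add: norm_vec_def L2_set_def sum_nonneg)

text \<open>The norm on matrices is the Frobenius norm, so this is Cauchy-Schwarz in each
  row.\<close>

lemma norm_matrix_vector_mult_le:
  fixes A :: "complex^'n^'m" shows "norm (A *v x) \<le> norm A * norm x"
proof -
  have "norm ((A *v x) $ i) \<le> norm (A $ i) * norm x" for i
  proof -
    have "norm ((A *v x) $ i) \<le> (\<Sum>j\<in>UNIV. \<bar>norm (A $ i $ j)\<bar> * \<bar>norm (x $ j)\<bar>)"
      unfolding matrix_vector_mult_def by (simp add: sum_norm_le norm_mult)
    also have "\<dots> \<le> norm (A $ i) * norm x"
      unfolding norm_vec_def by (rule L2_set_mult_ineq)
    finally show ?thesis .
  qed
  then have "norm (A *v x) \<le> L2_set (\<lambda>i. norm (A $ i) * norm x) UNIV"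
    unfolding norm_vec_def[of "A *v x"] by (intro L2_set_mono) auto
  also have "\<dots> = norm A * norm x"
    by (simp add: norm_vec_def[of A] L2_set_right_distrib mult.commute)
  finally show ?thesis .
qed

lemma norm_conj_transpose [simp]: "norm (conj_transpose A) = norm A"
proof -
  have "(norm (conj_transpose A))^2 = (norm A)^2"
    unfolding norm_mat_sq conj_transpose_def by (simp, rule sum.swap)
  then show ?thesis by simp
qed

lemma conj_transpose_conj_transpose [simp]: "conj_transpose (conj_transpose A) = A"
  by (simp add: conj_transpose_def vec_eq_iff)

lemma conj_transpose_mult:
  "conj_transpose (A ** B) = conj_transpose B ** conj_transpose A"
  by (simp add: conj_transpose_def vec_eq_iff matrix_matrix_mult_def mult.commute)

text \<open>Each row of the product is \<open>transpose B\<close> applied to a row of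
  \<open>A\<close>, which reduces the claim to the matrix-vector estimate. The constant 1 lets all
  later bounds be plain products of bounds.\<close>

lemma norm_matrix_mult_le:
  fixes A :: "complex^'n^'m" and B :: "complex^'p^'n" shows "norm (A ** B) \<le> norm A * norm B"
proof -
  have *: "norm ((A ** B) $ i) \<le> norm (A $ i) * norm B" for i
  proof -
    have "(A ** B) $ i = transpose B *v (A $ i)"
      by (simp add: vec_eq_iff matrix_matrix_mult_def matrix_vector_mult_def transpose_def mult.commute)
    moreover have "norm (transpose B) = norm B"
    proof -
      have "(norm (transpose B))^2 = (norm B)^2"
        unfolding norm_mat_sq transpose_def by (simp add: sum.swap[of "\<lambda>i j. (norm (B $ i $ j))\<^sup>2"])
      then show ?thesis by simp
    qed
    ultimately show ?thesis using norm_matrix_vector_mult_le[of "transpose B" "A $ i"]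
      by (simp add: mult.commute)
  qed
  have "norm (A ** B) \<le> L2_set (\<lambda>i. norm (A $ i) * norm B) UNIV"
    unfolding norm_vec_def[of "A ** B"] by (intro L2_set_mono *) auto
  also have "\<dots> = norm A * norm B"
    by (simp add: norm_vec_def[of A] L2_set_right_distrib mult.commute)
  finally show ?thesis .
qed

lemma matrix_mult_scaleR:
  fixes A :: "complex^'n^'m" and B :: "complex^'p^'n"
  shows "(c *\<^sub>R A) ** B = c *\<^sub>R (A ** B)" "A ** (c *\<^sub>R B) = c *\<^sub>R (A ** B)"
  by (simp_all add: vec_eq_iff matrix_matrix_mult_def scaleR_sum_right)

lemma matrix_add_rdistrib:
  fixes A B :: "'a::semiring_1^'n^'m" and C :: "'a^'p^'n"
  shows "(A + B) ** C = A ** C + B ** C"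
  by (simp add: vec_eq_iff matrix_matrix_mult_def algebra_simps sum.distrib)

lemma bounded_bilinear_matrix_mult:
  "bounded_bilinear ((**) :: complex^'n^'m \<Rightarrow> complex^'p^'n \<Rightarrow> complex^'p^'m)"
  by (rule bounded_bilinear.intro)
    (auto simp: matrix_add_ldistrib matrix_add_rdistrib matrix_mult_scaleR
      intro!: exI[of _ 1] norm_matrix_mult_le)

lemma bounded_bilinear_matrix_vector_mult:
  "bounded_bilinear ((*v) :: complex^'n^'m \<Rightarrow> complex^'n \<Rightarrow> complex^'m)"
  by (rule bounded_bilinear.intro)
    (auto simp: matrix_vector_mult_add_rdistrib matrix_vector_right_distrib
      intro!: exI[of _ 1] norm_matrix_vector_mult_le,
     auto simp: vec_eq_iff matrix_vector_mult_def scaleR_sum_right)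

lemma bounded_linear_conj_transpose:
  "bounded_linear (conj_transpose :: complex^'n^'m \<Rightarrow> complex^'m^'n)"
  by (rule bounded_linear_intro[where K = 1])
     (auto simp: conj_transpose_def vec_eq_iff simp del: norm_conj_transpose
       intro: order_eq_refl[OF norm_conj_transpose, unfolded conj_transpose_def])

lemmas matrix_mult_diff_left = bounded_bilinear.diff_left[OF bounded_bilinear_matrix_mult]
  and matrix_mult_diff_right = bounded_bilinear.diff_right[OF bounded_bilinear_matrix_mult]
  and conj_transpose_add = linear_add[OF bounded_linear.linear[OF bounded_linear_conj_transpose]]
  and conj_transpose_diff = linear_diff[OF bounded_linear.linear[OF bounded_linear_conj_transpose]]

lemma conj_transpose_0 [simp]: "conj_transpose (0 :: complex^'n^'m) = 0"
  using conj_transpose_diff[of "0 :: complex^'n^'m" 0] by simp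

section \<open>Bounded measurable functions on an interval\<close>

lemma finite_measure_leb: "finite_measure (leb T)"
proof (rule finite_measureI)
  have "emeasure (leb T) (space (leb T)) = emeasure lborel {0<..<T}"
    by (simp add: emeasure_restrict_space space_restrict_space)
  then show "emeasure (leb T) (space (leb T)) \<noteq> \<infinity>"
    by (cases "0 \<le> T") (auto simp: emeasure_lborel_box_eq)
qed

lemma sigma_finite_leb: "sigma_finite_measure (leb T)"
  using finite_measure_leb finite_measure.axioms(1) by blast

lemma space_leb [simp]: "space (leb T) = {0<..<T}"
  by (simp add: space_restrict_space)

lemma measure_leb: "0 \<le> T \<Longrightarrow> measure (leb T) (space (leb T)) = T"
  by (simp add: measure_restrict_space)

text \<open>A class that is closed under sums, products, substitutions, cut-offs and integration
  over a parameter interval, and whose members are integrable on every bounded interval. Continuity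
  would not survive the cut-offs. The bound is required on the whole space, which is why data given
  on [0, T] are extended beyond it before use.\<close>

definition bmeas :: "('a::topological_space \<Rightarrow> 'b::{second_countable_topology,real_normed_vector}) \<Rightarrow> bool" where
  "bmeas f \<longleftrightarrow> f \<in> borel_measurable borel \<and> (\<exists>C. \<forall>x. norm (f x) \<le> C)"

lemma bmeas_bound:
  assumes "bmeas f" obtains C where "0 \<le> C" "\<And>x. norm (f x) \<le> C"
  using assms unfolding bmeas_def by (meson norm_ge_zero order_trans)

lemma bmeas_leb: "bmeas f \<Longrightarrow> f \<in> borel_measurable (leb T)"
  by (simp add: bmeas_def measurable_restrict_space1)

lemma bmeasI: "f \<in> borel_measurable borel \<Longrightarrow> (\<And>x. norm (f x) \<le> C) \<Longrightarrow> bmeas f"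
  unfolding bmeas_def by blast

lemma bmeas_const: "bmeas (\<lambda>x. c)"
  by (rule bmeasI[where C = "norm c"]) auto

lemma bmeas_add: "bmeas f \<Longrightarrow> bmeas g \<Longrightarrow> bmeas (\<lambda>x. f x + g x)"
  unfolding bmeas_def by (auto intro: norm_triangle_mono)

lemma bmeas_diff: "bmeas f \<Longrightarrow> bmeas g \<Longrightarrow> bmeas (\<lambda>x. f x - g x)"
  unfolding bmeas_def by (auto intro: order_trans[OF norm_triangle_ineq4 add_mono])

lemma bmeas_mult:
  fixes f :: "'a::topological_space \<Rightarrow> complex^'n^'m" and g :: "'a \<Rightarrow> complex^'p^'n"
  assumes "bmeas f" "bmeas g" shows "bmeas (\<lambda>x. f x ** g x)"
proof -
  obtain C D where *: "\<And>x. norm (f x) \<le> C" "\<And>x. norm (g x) \<le> D" "0 \<le> C"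
    using assms by (meson bmeas_bound)
  have [measurable]: "f \<in> borel_measurable borel" "g \<in> borel_measurable borel"
    using assms by (auto simp: bmeas_def)
  show ?thesis
  proof (rule bmeasI[where C = "C * D"])
    have "(\<lambda>x. (\<lambda>p. fst p ** snd p) (f x, g x)) \<in> borel_measurable borel"
      by (rule borel_measurable_continuous_Pair)
        (auto intro!: bounded_bilinear.continuous_on[OF bounded_bilinear_matrix_mult] continuous_intros)
    then show "(\<lambda>x. f x ** g x) \<in> borel_measurable borel" by simp
    show "norm (f x ** g x) \<le> C * D" for x
      using * by (meson norm_matrix_mult_le mult_mono norm_ge_zero order_trans)
  qed
qed

lemma bmeas_vec_mult:
  fixes f :: "'a::topological_space \<Rightarrow> complex^'n^'m"
  assumes "bmeas f" "bmeas g" shows "bmeas (\<lambda>x. f x *v g x)"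
proof -
  obtain C D where *: "\<And>x. norm (f x) \<le> C" "\<And>x. norm (g x) \<le> D" "0 \<le> C"
    using assms by (meson bmeas_bound)
  have [measurable]: "f \<in> borel_measurable borel" "g \<in> borel_measurable borel"
    using assms by (auto simp: bmeas_def)
  show ?thesis
  proof (rule bmeasI[where C = "C * D"])
    have "(\<lambda>x. (\<lambda>p. fst p *v snd p) (f x, g x)) \<in> borel_measurable borel"
      by (rule borel_measurable_continuous_Pair)
        (auto intro!: bounded_bilinear.continuous_on[OF bounded_bilinear_matrix_vector_mult] continuous_intros)
    then show "(\<lambda>x. f x *v g x) \<in> borel_measurable borel" by simp
    show "norm (f x *v g x) \<le> C * D" for x
      using * by (meson norm_matrix_vector_mult_le mult_mono norm_ge_zero order_trans)
  qed
qed

lemma bmeas_conj_transpose: "bmeas f \<Longrightarrow> bmeas (\<lambda>x. conj_transpose (f x))"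
  unfolding bmeas_def
  by (auto intro: borel_measurable_continuous_on[OF linear_continuous_on[OF bounded_linear_conj_transpose]])

lemma bmeas_If: "Measurable.pred borel P \<Longrightarrow> bmeas f \<Longrightarrow> bmeas g \<Longrightarrow> bmeas (\<lambda>x. if P x then f x else g x)"
  unfolding bmeas_def by (auto intro!: measurable_If) (metis (full_types) nle_le order_trans)

lemma bmeas_comp: "bmeas f \<Longrightarrow> g \<in> borel_measurable borel \<Longrightarrow> bmeas (\<lambda>x. f (g x))"
  unfolding bmeas_def by (auto intro: measurable_compose[where N=borel])

lemma bmeas_continuous: "continuous_on UNIV f \<Longrightarrow> bounded (range f) \<Longrightarrow> bmeas f"
  unfolding bmeas_def by (auto intro: borel_measurable_continuous_onI simp: bounded_iff)

lemma fst_borel_measurable [measurable]: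
  "fst \<in> borel_measurable (borel :: ('a::topological_space \<times> 'b::topological_space) measure)"
  by (intro borel_measurable_continuous_onI continuous_intros)

lemma snd_borel_measurable [measurable]:
  "snd \<in> borel_measurable (borel :: ('a::topological_space \<times> 'b::topological_space) measure)"
  by (intro borel_measurable_continuous_onI continuous_intros)

lemma bmeas_integrable: "bmeas (f :: real \<Rightarrow> 'b::{banach,second_countable_topology}) \<Longrightarrow> integrable (leb T) f"
  by (rule bmeas_bound, assumption, rule finite_measure.integrable_const_bound[OF finite_measure_leb])
    (auto intro: bmeas_leb)

lemma norm_LINT_le:
  fixes f :: "real \<Rightarrow> 'b::{banach,second_countable_topology}"
  assumes "0 \<le> T" "\<And>s. 0 < s \<Longrightarrow> s < T \<Longrightarrow> norm (f s) \<le> g s" "integrable (leb T) g"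
  shows "norm (LINT s|leb T. f s) \<le> (LINT s|leb T. g s)"
proof -
  have "norm (LINT s|leb T. f s) \<le> (LINT s|leb T. norm (f s))" by simp
  also have "\<dots> \<le> (LINT s|leb T. g s)"
    by (rule integral_mono'[OF assms(3)]) (use assms(2) in auto, meson norm_ge_zero order_trans assms(2))
  finally show ?thesis .
qed

lemma norm_LINT_le_const:
  fixes f :: "real \<Rightarrow> 'b::{banach,second_countable_topology}"
  assumes "0 \<le> T" "\<And>s. 0 < s \<Longrightarrow> s < T \<Longrightarrow> norm (f s) \<le> C"
  shows "norm (LINT s|leb T. f s) \<le> T * C"
  using norm_LINT_le[of T f "\<lambda>s. C"] assms measure_leb[of T]
  by (simp add: bmeas_integrable bmeas_const)

section \<open>Integrals depending on a parameter: measurability, Fubini, continuity\<close>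

lemma bmeas_LINT:
  fixes f :: "'a::second_countable_topology \<Rightarrow> real \<Rightarrow> 'b::{banach,second_countable_topology}"
  assumes "bmeas (\<lambda>p. f (fst p) (snd p))" "0 \<le> T"
  shows "bmeas (\<lambda>x. LINT s|leb T. f x s)"
proof -
  obtain C where C: "\<And>p. norm (f (fst p) (snd p)) \<le> C" using assms bmeas_bound by blast
  show ?thesis
  proof (rule bmeasI[where C = "T * C"])
    have "(\<lambda>p. f (fst p) (snd p)) \<in> borel_measurable (borel \<Otimes>\<^sub>M borel)"
      using assms(1) by (simp add: bmeas_def borel_prod)
    moreover have "sets (borel \<Otimes>\<^sub>M lborel :: ('a \<times> real) measure) = sets (borel \<Otimes>\<^sub>M borel)"
      by (intro sets_pair_measure_cong) auto
    ultimately have "(\<lambda>p. indicator {0<..<T} (snd p) *\<^sub>R f (fst p) (snd p)) \<in> borel_measurable (borel \<Otimes>\<^sub>M lborel)"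
      by (intro borel_measurable_scaleR) (auto cong: measurable_cong_sets)
    then have "(\<lambda>x. LINT s|lborel. indicator {0<..<T} s *\<^sub>R f x s) \<in> borel_measurable borel"
      by (intro sigma_finite_measure.borel_measurable_lebesgue_integral[OF lborel.sigma_finite_measure_axioms])
        (simp add: case_prod_beta')
    then show "(\<lambda>x. LINT s|leb T. f x s) \<in> borel_measurable borel"
      by (simp add: integral_restrict_space)
    show "norm (LINT s|leb T. f x s) \<le> T * C" for x
      by (rule norm_LINT_le_const) (use assms C[of "(x, _)"] in auto)
  qed
qed

text \<open>The majorant depends on \<open>y\<close> only and may be unbounded: in the composition
  of integral operators it is a multiple of the norm of a square integrable function, which is
  merely integrable.\<close>

lemma Fubini_leb:
  fixes f :: "real \<Rightarrow> real \<Rightarrow> 'b::{banach,second_countable_topology}"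
  assumes meas: "(\<lambda>p. f (fst p) (snd p)) \<in> borel_measurable (leb S \<Otimes>\<^sub>M leb T)"
    and h: "integrable (leb T) h" and le: "\<And>x y. norm (f x y) \<le> h y"
  shows "(LINT x|leb S. LINT y|leb T. f x y) = (LINT y|leb T. LINT x|leb S. f x y)"
proof -
  interpret S: finite_measure "leb S" by (rule finite_measure_leb)
  interpret T: finite_measure "leb T" by (rule finite_measure_leb)
  interpret P: pair_sigma_finite "leb S" "leb T" ..
  have "integrable (leb S \<Otimes>\<^sub>M leb T) (\<lambda>p. h (snd p))"
  proof (rule P.Fubini_integrable)
    show "(\<lambda>p. h (snd p)) \<in> borel_measurable (leb S \<Otimes>\<^sub>M leb T)"
      using h by measurable
  qed (use h in auto)
  then have "integrable (leb S \<Otimes>\<^sub>M leb T) (\<lambda>p. f (fst p) (snd p))"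
    by (rule Bochner_Integration.integrable_bound[OF _ meas])
      (use le in \<open>auto intro!: AE_I2 intro: order_trans[OF le abs_ge_self]\<close>)
  then show ?thesis
    using P.Fubini_integral[of f] by (simp add: case_prod_beta')
qed

lemma bmeas_pair_leb:
  fixes f :: "real \<times> real \<Rightarrow> 'b::{real_normed_vector,second_countable_topology}"
  assumes "bmeas f"
  shows "f \<in> borel_measurable (leb S \<Otimes>\<^sub>M leb T)"
proof -
  have f: "f \<in> borel_measurable (borel \<Otimes>\<^sub>M borel)"
    using assms by (simp add: bmeas_def borel_prod)
  have *: "(\<lambda>x. x) \<in> borel_measurable (leb S)" for S by (rule measurable_restrict_space1) simp
  have "(\<lambda>p. (fst p, snd p)) \<in> leb S \<Otimes>\<^sub>M leb T \<rightarrow>\<^sub>M borel \<Otimes>\<^sub>M borel"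
    by (intro measurable_Pair measurable_compose[OF measurable_fst *] measurable_compose[OF measurable_snd *])
  from measurable_compose[OF this f] show ?thesis by simp
qed

lemma bmeas_Fubini:
  fixes f :: "real \<Rightarrow> real \<Rightarrow> 'b::{banach,second_countable_topology}"
  assumes "bmeas (\<lambda>p. f (fst p) (snd p))"
  shows "(LINT x|leb S. LINT y|leb T. f x y) = (LINT y|leb T. LINT x|leb S. f x y)"
proof -
  obtain C where C: "\<And>p. norm (f (fst p) (snd p)) \<le> C" using assms bmeas_bound by blast
  show ?thesis
    by (rule Fubini_leb[OF bmeas_pair_leb[OF assms], where h = "\<lambda>_. C"])
      (use C[of "(_, _)"] in \<open>auto intro: bmeas_integrable bmeas_const\<close>)
qed

text \<open>Dominated convergence. The exceptional null set may depend on the point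
  \<open>x\<close>; this is what cut-offs need, since the integrand jumps exactly where the
  integration variable meets a limit of integration that moves with \<open>x\<close>.\<close>

lemma continuous_LINT:
  fixes f :: "'a::{metric_space,second_countable_topology} \<Rightarrow> real \<Rightarrow> 'b::{banach,second_countable_topology}"
  assumes bm: "bmeas (\<lambda>p. f (fst p) (snd p))"
    and cont: "\<And>x. AE s in lborel. isCont (\<lambda>x. f x s) x"
  shows "continuous_on UNIV (\<lambda>x. LINT s|leb T. f x s)"
proof -
  obtain C where C: "\<And>p. norm (f (fst p) (snd p)) \<le> C" using bm bmeas_bound by blast
  have meas: "f x \<in> borel_measurable (leb T)" for x
  proof -
    have "bmeas (\<lambda>s. (\<lambda>p. f (fst p) (snd p)) (x, s))" by (rule bmeas_comp[OF bm]) measurable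
    then show ?thesis by (intro bmeas_leb) simp
  qed
  have "isCont (\<lambda>x. LINT s|leb T. f x s) x" for x
    unfolding continuous_at_sequentially o_def
  proof (intro allI impI)
    fix u :: "nat \<Rightarrow> 'a" assume u: "u \<longlonglongrightarrow> x"
    show "(\<lambda>n. LINT s|leb T. f (u n) s) \<longlonglongrightarrow> (LINT s|leb T. f x s)"
    proof (rule integral_dominated_convergence[where w = "\<lambda>_. C"])
      show "AE s in leb T. (\<lambda>n. f (u n) s) \<longlonglongrightarrow> f x s"
      proof -
        have "AE s in lborel. (\<lambda>n. f (u n) s) \<longlonglongrightarrow> f x s"
          using cont[of x] by eventually_elim (rule isCont_tendsto_compose[OF _ u])
        then show ?thesis by (subst AE_restrict_space_iff) auto
      qed
      show "AE s in leb T. norm (f (u n) s) \<le> C" for n using C[of "(u n, _)"] by auto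
    qed (auto intro: meas bmeas_integrable bmeas_const)
  qed
  then show ?thesis by (simp add: continuous_on_eq_continuous_at)
qed

lemma isCont_If_less:
  fixes a b :: "'a::t2_space \<Rightarrow> real"
  assumes "isCont f x" "isCont g x" "isCont a x" "isCont b x" "a x \<noteq> b x"
  shows "isCont (\<lambda>y. if a y < b y then f y else g y) x"
proof (cases "a x < b x")
  case True
  then have "0 < b x - a x" by simp
  have "((\<lambda>y. b y - a y) \<longlongrightarrow> b x - a x) (at x)"
    using assms by (auto simp: isCont_def intro!: tendsto_intros)
  then have "eventually (\<lambda>y. 0 < b y - a y) (at x)" using \<open>0 < b x - a x\<close> by (rule order_tendstoD)
  then have "eventually (\<lambda>y. f y = (if a y < b y then f y else g y)) (at x)" by eventually_elim auto
  with assms(1) True show ?thesis unfolding isCont_def by (auto elim: Lim_transform_eventually)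
next
  case False
  then have "0 < a x - b x" using assms by simp
  have "((\<lambda>y. a y - b y) \<longlongrightarrow> a x - b x) (at x)"
    using assms by (auto simp: isCont_def intro!: tendsto_intros)
  then have "eventually (\<lambda>y. 0 < a y - b y) (at x)" using \<open>0 < a x - b x\<close> by (rule order_tendstoD)
  then have "eventually (\<lambda>y. g y = (if a y < b y then f y else g y)) (at x)" by eventually_elim auto
  with assms(2) False show ?thesis unfolding isCont_def by (auto elim: Lim_transform_eventually)
qed

section \<open>Cut-offs, reflection of the interval and exponential weights\<close>

lemma LINT_leb_If:
  fixes f :: "real \<Rightarrow> 'b::{banach,second_countable_topology}"
  assumes "\<tau> \<le> T"
  shows "(LINT s|leb T. (if s < \<tau> then f s else 0)) = (LINT s|leb \<tau>. f s)"
  using assms by (auto simp: integral_restrict_space indicator_def intro!: Bochner_Integration.integral_cong)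

lemma LINT_leb_reflect:
  fixes f :: "real \<Rightarrow> 'b::{banach,second_countable_topology}"
  shows "(LINT s|leb \<tau>. f (\<tau> - s)) = (LINT s|leb \<tau>. f s)"
proof -
  have "(LINT s|leb \<tau>. f s) = (LINT s|lborel. indicator {0<..<\<tau>} s *\<^sub>R f s)"
    by (simp add: integral_restrict_space)
  also have "\<dots> = (LINT s|lborel. indicator {0<..<\<tau>} (\<tau> - s) *\<^sub>R f (\<tau> - s))"
    using lborel_integral_real_affine[of "-1" "\<lambda>s. indicator {0<..<\<tau>} s *\<^sub>R f s" \<tau>] by simp
  also have "\<dots> = (LINT s|lborel. indicator {0<..<\<tau>} s *\<^sub>R f (\<tau> - s))"
    by (rule Bochner_Integration.integral_cong) (auto simp: indicator_def)
  also have "\<dots> = (LINT s|leb \<tau>. f (\<tau> - s))"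
    by (simp add: integral_restrict_space)
  finally show ?thesis by simp
qed

lemma LINT_exp_le:
  assumes "0 < \<mu>"
  shows "(LINT s|leb \<tau>. exp (\<mu> * s)) \<le> exp (\<mu> * \<tau>) / \<mu>"
proof (cases "0 \<le> \<tau>")
  case True
  have *: "has_bochner_integral lborel (\<lambda>s. exp (\<mu> * s) * indicator {0..\<tau>} s) (exp (\<mu> * \<tau>) / \<mu> - exp (\<mu> * 0) / \<mu>)"
    by (rule has_bochner_integral_FTC_Icc_nonneg)
      (use assms True in \<open>auto intro!: derivative_eq_intros\<close>)
  have "(LINT s|leb \<tau>. exp (\<mu> * s)) \<le> (LINT s|lborel. exp (\<mu> * s) * indicator {0..\<tau>} s)"
    unfolding integral_restrict_space[of "{0<..<\<tau>}" lborel, simplified]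
    using * by (intro integral_mono') (auto simp: indicator_def has_bochner_integral_iff)
  also have "\<dots> \<le> exp (\<mu> * \<tau>) / \<mu>"
    using * assms by (simp add: has_bochner_integral_iff)
  finally show ?thesis .
next
  case False
  then have "(LINT s|leb \<tau>. exp (\<mu> * s)) = 0"
    by (simp add: integral_restrict_space indicator_def)
  then show ?thesis using assms by simp
qed

lemma borel_measurable_fst_comp:
  fixes f :: "'a::topological_space \<Rightarrow> 'b::topological_space \<times> 'c::topological_space"
  assumes "f \<in> borel_measurable borel" shows "(\<lambda>x. fst (f x)) \<in> borel_measurable borel"
  using measurable_compose[OF assms fst_borel_measurable] .

lemma borel_measurable_snd_comp:
  fixes f :: "'a::topological_space \<Rightarrow> 'b::topological_space \<times> 'c::topological_space"
  assumes "f \<in> borel_measurable borel" shows "(\<lambda>x. snd (f x)) \<in> borel_measurable borel"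
  using measurable_compose[OF assms snd_borel_measurable] .

lemma pred_borel_less:
  fixes f g :: "'a::topological_space \<Rightarrow> real"
  assumes "f \<in> borel_measurable borel" "g \<in> borel_measurable borel"
  shows "Measurable.pred borel (\<lambda>x. f x < g x)" "Measurable.pred borel (\<lambda>x. f x \<le> g x)"
  using assms by measurable

lemma pred_borel_conj:
  assumes "Measurable.pred borel P" "Measurable.pred borel Q"
  shows "Measurable.pred borel (\<lambda>x. P x \<and> Q x)"
  using assms by measurable

lemmas bmeas_intros = bmeas_If bmeas_mult bmeas_add bmeas_diff bmeas_const
  bmeas_conj_transpose bmeas_LINT bmeas_vec_mult pred_borel_conj pred_borel_less
  borel_measurable_fst_comp borel_measurable_snd_comp borel_measurable_Pair
  borel_measurable_diff borel_measurable_const measurable_ident_sets[OF refl]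

text \<open>Against the weight exp(\<mu> s), integration up to \<tau> costs a factor 1/\<mu> instead
  of the length \<tau>. For large \<mu> a Volterra operator thus becomes a contraction on the whole
  interval.\<close>

lemma norm_LINT_exp_le:
  fixes f :: "real \<Rightarrow> 'b::{banach,second_countable_topology}"
  assumes "0 < \<mu>" "0 \<le> c" "0 \<le> T"
    and f: "\<And>s. 0 < s \<Longrightarrow> s < T \<Longrightarrow> norm (f s) \<le> (if s < \<tau> then c * exp (\<mu> * s) else 0)"
  shows "norm (LINT s|leb T. f s) \<le> c * exp (\<mu> * \<tau>) / \<mu>"
proof -
  \<comment> \<open>The cut-off point may lie beyond \<open>T\<close>, where the integral over (0,
    T) stops earlier.\<close>
  define \<tau>' where "\<tau>' = min \<tau> T"
  have int: "integrable (leb T) (\<lambda>s. if s < \<tau>' then c * exp (\<mu> * s) else 0)"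
    by (rule finite_measure.integrable_const_bound[OF finite_measure_leb, where B = "c * exp (\<mu> * T)"])
      (use assms in \<open>auto intro!: AE_I2 mult_left_mono measurable_restrict_space1\<close>)
  have "norm (LINT s|leb T. f s) \<le> (LINT s|leb T. (if s < \<tau>' then c * exp (\<mu> * s) else 0))"
    by (rule norm_LINT_le[OF assms(3) _ int]) (use f in \<open>auto simp: \<tau>'_def\<close>)
  also have "\<dots> = c * (LINT s|leb \<tau>'. exp (\<mu> * s))"
    by (subst LINT_leb_If) (auto simp: \<tau>'_def)
  also have "\<dots> \<le> c * (exp (\<mu> * \<tau>') / \<mu>)"
    by (intro mult_left_mono LINT_exp_le assms)
  also have "\<dots> \<le> c * (exp (\<mu> * \<tau>) / \<mu>)"
    using assms by (intro mult_left_mono divide_right_mono) (auto simp: \<tau>'_def)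
  finally show ?thesis by simp
qed

text \<open>The same gain for convolutions, in which the unknown is evaluated at \<tau> - s.\<close>

lemma norm_LINT_exp_rev_le:
  fixes f :: "real \<Rightarrow> 'b::{banach,second_countable_topology}"
  assumes "0 < \<mu>" "0 \<le> c" "0 \<le> T" "\<tau> \<le> T"
    and f: "\<And>s. 0 < s \<Longrightarrow> s < T \<Longrightarrow> norm (f s) \<le> (if s < \<tau> then c * exp (\<mu> * (\<tau> - s)) else 0)"
  shows "norm (LINT s|leb T. f s) \<le> c * exp (\<mu> * \<tau>) / \<mu>"
proof -
  have int: "integrable (leb T) (\<lambda>s. if s < \<tau> then c * exp (\<mu> * (\<tau> - s)) else 0)"
    by (rule finite_measure.integrable_const_bound[OF finite_measure_leb, where B = "c * exp (\<mu> * \<tau>)"])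
      (use assms in \<open>auto intro!: AE_I2 mult_left_mono measurable_restrict_space1\<close>)
  have "norm (LINT s|leb T. f s) \<le> (LINT s|leb T. (if s < \<tau> then c * exp (\<mu> * (\<tau> - s)) else 0))"
    by (rule norm_LINT_le[OF assms(3) _ int]) (use f in auto)
  also have "\<dots> = c * (LINT s|leb \<tau>. exp (\<mu> * s))"
    using assms(4) LINT_leb_reflect[of \<tau> "\<lambda>s. exp (\<mu> * s)"] by (subst LINT_leb_If) auto
  also have "\<dots> \<le> c * (exp (\<mu> * \<tau>) / \<mu>)"
    by (intro mult_left_mono LINT_exp_le assms)
  finally show ?thesis by simp
qed

section \<open>Volterra equations\<close>

text \<open>A substitute for Gronwall's lemma that does not require the function \<open>e\<close> to be measurable.\<close>

lemma zero_by_halving: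
  fixes e :: "'p \<Rightarrow> real"
  assumes "\<And>p. p \<in> D \<Longrightarrow> e p \<le> C * w p" "0 \<le> C"
    and half: "\<And>c. 0 \<le> c \<Longrightarrow> (\<And>p. p \<in> D \<Longrightarrow> e p \<le> c * w p) \<Longrightarrow> (\<And>p. p \<in> D \<Longrightarrow> e p \<le> c / 2 * w p)"
    and p: "p \<in> D"
  shows "e p \<le> 0"
proof -
  have "\<forall>p\<in>D. e p \<le> C / 2 ^ n * w p" for n
  proof (induction n)
    case (Suc n)
    have "0 \<le> C / 2 ^ n" using assms(2) by simp
    from half[OF this] Suc show ?case by (auto simp: field_simps)
  qed (use assms in auto)
  then have "\<And>n. e p \<le> C * w p * (1 / 2) ^ n" using p by (simp add: field_simps power_one_over)
  moreover have "(\<lambda>n. C * w p * (1 / 2) ^ n) \<longlonglongrightarrow> C * w p * 0"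
    by (intro tendsto_intros LIMSEQ_realpow_zero) auto
  ultimately show ?thesis by (metis LIMSEQ_le_const mult_zero_right)
qed

text \<open>Picard iteration in the norm sup |f| / w, which is equivalent to the supremum norm
  because w lies between 1 and W; so the limit is uniform and stays continuous and bounded. Stating
  the contraction through pointwise majorants \<open>c * w\<close> avoids suprema and asks for the
  same kind of estimate as \<open>zero_by_halving\<close>.\<close>

lemma weighted_fixpoint:
  fixes \<Phi> :: "('p::topological_space \<Rightarrow> 'b::banach) \<Rightarrow> 'p \<Rightarrow> 'b"
  assumes w: "\<And>p. 1 \<le> w p" "\<And>p. w p \<le> W"
    and maps: "\<And>f. continuous_on UNIV f \<Longrightarrow> bounded (range f) \<Longrightarrow>
      continuous_on UNIV (\<Phi> f) \<and> bounded (range (\<Phi> f))"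
    and contr: "\<And>f g c p. \<lbrakk>continuous_on UNIV f; bounded (range f); continuous_on UNIV g;
      bounded (range g); 0 \<le> c; \<And>q. norm (f q - g q) \<le> c * w q\<rbrakk> \<Longrightarrow>
      norm (\<Phi> f p - \<Phi> g p) \<le> c / 2 * w p"
  obtains f where "continuous_on UNIV f" "bounded (range f)" "\<Phi> f = f"
proof -
  define f where "f n = (\<Phi> ^^ n) (\<lambda>_. 0)" for n
  have f_Suc: "f (Suc n) = \<Phi> (f n)" for n by (simp add: f_def)
  have cb: "continuous_on UNIV (f n) \<and> bounded (range (f n))" for n
  proof (induction n)
    case 0 then show ?case by (simp add: f_def image_constant_conv)
  next
    case (Suc n) then show ?case unfolding f_Suc by (intro maps) auto
  qed
  obtain C where C: "0 \<le> C" "\<And>q. norm (f 1 q) \<le> C"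
    using cb[of 1] unfolding bounded_iff by (meson rangeI norm_ge_zero order_trans)
  have step: "norm (f (Suc n) q - f n q) \<le> C / 2 ^ n * w q" for n q
  proof (induction n arbitrary: q)
    case 0
    have "C * 1 \<le> C * w q" using C w by (intro mult_left_mono) auto
    then show ?case using C(2)[of q] by (simp add: f_def)
  next
    case (Suc n)
    have "norm (\<Phi> (f (Suc n)) q - \<Phi> (f n) q) \<le> C / 2 ^ n / 2 * w q"
      by (rule contr[OF _ _ _ _ _ Suc]) (use C cb in auto)
    then show ?case by (simp add: f_Suc field_simps)
  qed
  have ul: "uniform_limit UNIV (\<lambda>n x. \<Sum>i<n. f (Suc i) x - f i x) (\<lambda>x. \<Sum>i. f (Suc i) x - f i x) sequentially"
  proof (rule Weierstrass_m_test)
    show "norm (f (Suc n) x - f n x) \<le> C * W * (1 / 2) ^ n" for n x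
    proof -
      have "C / 2 ^ n * w x \<le> C / 2 ^ n * W" using C w by (intro mult_left_mono) auto
      with step[of n x] show ?thesis by (simp add: power_one_over field_simps)
    qed
    show "summable (\<lambda>n. C * W * (1 / 2) ^ n)" by (intro summable_mult summable_geometric) auto
  qed
  define g where "g = (\<lambda>x. \<Sum>i. f (Suc i) x - f i x)"
  have telescope: "(\<Sum>i<n. f (Suc i) x - f i x) = f n x" for n x
    by (subst sum_lessThan_telescope[of "\<lambda>i. f i x" n]) (simp add: f_def)
  have lim: "uniform_limit UNIV f g sequentially"
    using ul unfolding telescope g_def[symmetric] .
  have cont: "continuous_on UNIV g"
    by (rule uniform_limit_theorem[OF _ lim]) (use cb in auto)
  have near: "eventually (\<lambda>n. \<forall>x. norm (g x - f n x) < e) sequentially" if "0 < e" for e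
    using uniform_limitD[OF lim that] by (simp add: dist_norm norm_minus_commute)
  have bdd: "bounded (range g)"
  proof -
    obtain n where n: "\<And>x. norm (g x - f n x) < 1" using near[of 1] by (auto simp: eventually_sequentially)
    obtain B where B: "\<And>x. norm (f n x) \<le> B" using cb[of n] by (auto simp: bounded_iff)
    have "norm (g x) \<le> 1 + B" for x
      using n[of x] B[of x] norm_triangle_sub[of "g x" "f n x"] by linarith
    then show ?thesis unfolding bounded_iff by auto
  qed
  have "\<Phi> g x = g x" for x
  proof (rule LIMSEQ_unique)
    show "(\<lambda>n. f (Suc n) x) \<longlonglongrightarrow> g x"
      using tendsto_uniform_limitI[OF lim, of x] by (subst filterlim_sequentially_Suc) simp
    show "(\<lambda>n. f (Suc n) x) \<longlonglongrightarrow> \<Phi> g x"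
    proof (rule metric_LIMSEQ_I)
      fix r :: real assume r: "0 < r"
      have "0 < w x" using w(1)[of x] by linarith
      \<comment> \<open>Chosen so that the contraction bound \<open>e / 2 * w x\<close> at this one
        point stays below \<open>r\<close>; the iterates are uniformly within \<open>e\<close>,
        hence within \<open>e * w\<close>, as w is at least 1.\<close>
      define e where "e = r / w x"
      have e: "0 < e" using r \<open>0 < w x\<close> by (simp add: e_def)
      obtain N where N: "\<And>n x. n \<ge> N \<Longrightarrow> norm (g x - f n x) < e"
        using near[OF e] by (auto simp: eventually_sequentially)
      have "dist (f (Suc n) x) (\<Phi> g x) < r" if "n \<ge> N" for n
      proof -
        have "norm (f n q - g q) \<le> e * w q" for q
        proof -
          have "e * 1 \<le> e * w q" using e w by (intro mult_left_mono) auto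
          then show ?thesis using N[OF that, of q] by (simp add: norm_minus_commute)
        qed
        then have "norm (\<Phi> (f n) x - \<Phi> g x) \<le> e / 2 * w x"
          using cb[of n] cont bdd e by (intro contr) auto
        also have "\<dots> < r" using r \<open>0 < w x\<close> by (simp add: e_def)
        finally show ?thesis by (simp add: f_Suc dist_norm)
      qed
      then show "\<exists>N. \<forall>n\<ge>N. dist (f (Suc n) x) (\<Phi> g x) < r" by blast
    qed
  qed
  then show ?thesis using that[OF cont bdd] by auto
qed

lemma bounded_range_bmeas: "bmeas f \<Longrightarrow> bounded (range f)"
  by (auto simp: bmeas_def bounded_iff)

section \<open>Algebra of matrix-valued integrals\<close>

lemma LINT_mult_left:
  fixes A :: "complex^'n^'m" and f :: "real \<Rightarrow> complex^'p^'n"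
  assumes "bmeas f" shows "(LINT s|leb T. A ** f s) = A ** (LINT s|leb T. f s)"
  by (rule integral_bounded_linear[OF bounded_bilinear.bounded_linear_right[OF bounded_bilinear_matrix_mult]])
    (rule bmeas_integrable[OF assms])

lemma LINT_mult_right:
  fixes A :: "complex^'p^'n" and f :: "real \<Rightarrow> complex^'n^'m"
  assumes "bmeas f" shows "(LINT s|leb T. f s ** A) = (LINT s|leb T. f s) ** A"
  by (rule integral_bounded_linear[OF bounded_bilinear.bounded_linear_left[OF bounded_bilinear_matrix_mult]])
    (rule bmeas_integrable[OF assms])

lemma LINT_conj_transpose:
  fixes f :: "real \<Rightarrow> complex^'n^'m"
  assumes "bmeas f" shows "(LINT s|leb T. conj_transpose (f s)) = conj_transpose (LINT s|leb T. f s)"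
  by (rule integral_bounded_linear[OF bounded_linear_conj_transpose]) (rule bmeas_integrable[OF assms])

lemma LINT_add:
  fixes f :: "real \<Rightarrow> 'b::{banach,second_countable_topology}"
  assumes "bmeas f" "bmeas g"
  shows "(LINT s|leb T. f s + g s) = (LINT s|leb T. f s) + (LINT s|leb T. g s)"
  using assms by (intro Bochner_Integration.integral_add bmeas_integrable)

lemma LINT_diff:
  fixes f :: "real \<Rightarrow> 'b::{banach,second_countable_topology}"
  assumes "bmeas f" "bmeas g"
  shows "(LINT s|leb T. f s - g s) = (LINT s|leb T. f s) - (LINT s|leb T. g s)"
  using assms by (intro Bochner_Integration.integral_diff bmeas_integrable)

lemma LINT_cong:
  assumes "\<And>s. 0 < s \<Longrightarrow> s < T \<Longrightarrow> f s = g s"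
  shows "(LINT s|leb T. f s) = (LINT s|leb T. g s)"
  using assms by (intro Bochner_Integration.integral_cong) auto

text \<open>A single point is a null set. This absorbs strict against nonstrict inequalities in
  cut-offs, and kernel values on the diagonal.\<close>

lemma LINT_cong_except:
  fixes f :: "real \<Rightarrow> 'b::{banach,second_countable_topology}"
  assumes "bmeas f" "bmeas g" "\<And>s. 0 < s \<Longrightarrow> s < T \<Longrightarrow> s \<noteq> r \<Longrightarrow> f s = g s"
  shows "(LINT s|leb T. f s) = (LINT s|leb T. g s)"
proof (rule integral_cong_AE)
  have "AE s in lborel. s \<noteq> r" by (rule AE_lborel_singleton)
  then have "AE s in leb T. s \<noteq> r" by (subst AE_restrict_space_iff) auto
  then show "AE s in leb T. f s = g s" using AE_space by eventually_elim (use assms(3) in auto)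
qed (use assms bmeas_leb in auto)

text \<open>Here and below, integrals with variable limits are integrals over the fixed interval
  \<open>(0, T)\<close> with a cut-off in the integrand, so that the measure does not depend on parameters.\<close>

definition goursat_integral :: "real \<Rightarrow> (real \<times> real \<Rightarrow> complex^'r^'r) \<Rightarrow> (real \<Rightarrow> complex^'r^'r) \<Rightarrow> real \<Rightarrow> real \<Rightarrow> complex^'r^'r" where
  "goursat_integral T V a \<tau> t =
     (LINT \<sigma>|leb T. (if t < \<sigma> \<and> \<sigma> < \<tau> then V (\<sigma>, \<sigma> - t) ** a \<sigma> else 0))"

section \<open>The Goursat problem and the half-interval Volterra equations\<close>

lemma goursat_integral_cont_bounded:
  fixes V :: "real \<times> real \<Rightarrow> complex^'r^'r"
  assumes T: "0 \<le> T" and V: "continuous_on UNIV V" "bounded (range V)"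
    and a: "continuous_on UNIV a" "bounded (range a)"
  shows "continuous_on UNIV (\<lambda>p. goursat_integral T V a (fst p) (snd p)) \<and>
         bounded (range (\<lambda>p. goursat_integral T V a (fst p) (snd p)))"
proof -
  note bV = bmeas_continuous[OF V] and ba = bmeas_continuous[OF a]
  have bm: "bmeas (\<lambda>q. if snd (fst q) < snd q \<and> snd q < fst (fst q)
      then V (snd q, snd q - snd (fst q)) ** a (snd q) else 0)"
    by (intro bmeas_intros bmeas_comp[OF bV] bmeas_comp[OF ba]) measurable
  have conj_if: "(if P \<and> Q then x else y) = (if P then if Q then x else y else y)" for P Q and x y :: "complex^'r^'r"
    by simp
  have "continuous_on UNIV (\<lambda>p. goursat_integral T V a (fst p) (snd p))"
    unfolding goursat_integral_def
  proof (rule continuous_LINT)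
    fix p :: "real \<times> real"
    \<comment> \<open>The integrand jumps only where the integration variable meets one of its two
      limits.\<close>
    have "AE s in lborel. s \<noteq> fst p" "AE s in lborel. s \<noteq> snd p" by (rule AE_lborel_singleton)+
    then show "AE s in lborel. isCont (\<lambda>x. if snd x < s \<and> s < fst x then V (s, s - snd x) ** a s else 0) p"
    proof eventually_elim
      case (elim s)
      have "continuous_on UNIV (\<lambda>x::real \<times> real. V (s, s - snd x) ** a s)"
        by (intro bounded_bilinear.continuous_on[OF bounded_bilinear_matrix_mult]
            continuous_on_compose2[OF V(1)] continuous_intros) auto
      then have "isCont (\<lambda>x. V (s, s - snd x) ** a s) p"
        using continuous_on_eq_continuous_at[OF open_UNIV] by blast
      then show ?case unfolding conj_if
        using elim by (intro isCont_If_less continuous_intros) auto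
    qed
  qed (rule bm)
  moreover have "bmeas (\<lambda>p. goursat_integral T V a (fst p) (snd p))"
    unfolding goursat_integral_def by (rule bmeas_LINT[OF bm T])
  ultimately show ?thesis by (simp add: bounded_range_bmeas)
qed

lemma goursat_integral_diff:
  assumes "bmeas V" "bmeas V'" "bmeas a"
  shows "goursat_integral T V a \<tau> t - goursat_integral T V' a \<tau> t = goursat_integral T (\<lambda>p. V p - V' p) a \<tau> t"
  unfolding goursat_integral_def
  by (subst LINT_diff[symmetric], (intro bmeas_intros bmeas_comp[OF assms(1)] bmeas_comp[OF assms(2)] bmeas_comp[OF assms(3)], measurable)+)
     (auto intro!: LINT_cong simp: matrix_mult_diff_left)

text \<open>The weight depends on the first variable only, so the reflection
  \<open>\<sigma> - t\<close> in the second one costs nothing. The bound on \<open>V\<close> is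
  required only at points that the integral sees; hence the estimate serves both on the whole plane
  and on the triangle of the residuals.\<close>

lemma norm_goursat_integral_le:
  assumes "0 < \<mu>" "0 \<le> c" "0 \<le> T" and a: "\<And>s. norm (a s) \<le> A"
    and V: "\<And>\<sigma>. t < \<sigma> \<Longrightarrow> \<sigma> < \<tau> \<Longrightarrow> 0 < \<sigma> \<Longrightarrow> \<sigma> < T \<Longrightarrow> norm (V (\<sigma>, \<sigma> - t)) \<le> c * exp (\<mu> * \<sigma>)"
  shows "norm (goursat_integral T V a \<tau> t) \<le> A * c * exp (\<mu> * \<tau>) / \<mu>"
  unfolding goursat_integral_def
proof (rule norm_LINT_exp_le[OF assms(1) _ assms(3)])
  have A: "0 \<le> A" using a[of 0] norm_ge_zero order_trans by blast
  then show "0 \<le> A * c" using assms by simp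
  show "norm (if t < s \<and> s < \<tau> then V (s, s - t) ** a s else 0) \<le> (if s < \<tau> then A * c * exp (\<mu> * s) else 0)"
    if "0 < s" "s < T" for s
  proof (cases "t < s \<and> s < \<tau>")
    case True
    have "norm (V (s, s - t) ** a s) \<le> norm (V (s, s - t)) * norm (a s)" by (rule norm_matrix_mult_le)
    also have "\<dots> \<le> (c * exp (\<mu> * s)) * A" using True that a V assms by (intro mult_mono) auto
    finally show ?thesis using True by (simp add: mult_ac)
  qed (use A assms in auto)
qed

lemma goursat_solution:
  fixes a b :: "real \<Rightarrow> complex^'r^'r"
  assumes T: "0 \<le> T" and a: "continuous_on UNIV a" "bounded (range a)"
    and b: "continuous_on UNIV b" "bounded (range b)"
  obtains X Z where "continuous_on UNIV X" "bounded (range X)" "continuous_on UNIV Z" "bounded (range Z)"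
    "\<And>\<tau> t. X (\<tau>, t) = a t + goursat_integral T Z a \<tau> t"
    "\<And>\<tau> t. Z (\<tau>, t) = b t + goursat_integral T X b \<tau> t"
proof -
  obtain A where A: "\<And>s. norm (a s) \<le> A" "\<And>s. norm (b s) \<le> A"
    using a(2) b(2) unfolding bounded_iff by (metis max.coboundedI1 max.coboundedI2 rangeI)
  have A0: "0 \<le> A" using A(1)[of 0] norm_ge_zero order_trans by blast
  \<comment> \<open>Each component has to contract by 1/4, because the norm of a pair is estimated
    by the sum of the norms; the summand 1 keeps \<mu> positive when A = 0.\<close>
  define \<mu> where "\<mu> = 4 * (A + 1)"
  have \<mu>: "0 < \<mu>" using A0 by (simp add: \<mu>_def)
  \<comment> \<open>Clamping keeps the weight bounded. It is harmless because the integral depends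
    on \<tau> only through its projection to [0, T], as \<open>clamp\<close> shows.\<close>
  define w :: "real \<times> real \<Rightarrow> real" where "w p = exp (\<mu> * max 0 (min T (fst p)))" for p
  define \<Phi> :: "(real \<times> real \<Rightarrow> (complex^'r^'r) \<times> (complex^'r^'r)) \<Rightarrow> real \<times> real \<Rightarrow> (complex^'r^'r) \<times> (complex^'r^'r)"
    where "\<Phi> W p = (a (snd p) + goursat_integral T (\<lambda>p. snd (W p)) a (fst p) (snd p),
                     b (snd p) + goursat_integral T (\<lambda>p. fst (W p)) b (fst p) (snd p))" for W p
  have bfst: "bounded (range (\<lambda>p. fst (f p)))" and bsnd: "bounded (range (\<lambda>p. snd (f p)))"
    if "bounded (range f)" for f :: "real \<times> real \<Rightarrow> (complex^'r^'r) \<times> (complex^'r^'r)"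
    using that bounded_fst[OF that] bounded_snd[OF that] by (simp_all add: image_image)
  have clamp: "goursat_integral T V a \<tau> t = goursat_integral T V a (max 0 (min T \<tau>)) t" for V a \<tau> t
    unfolding goursat_integral_def by (rule LINT_cong) auto
  have half: "norm (goursat_integral T V e (fst p) (snd p) - goursat_integral T V' e (fst p) (snd p)) \<le> c / 4 * w p"
    if V: "bmeas V" "bmeas V'" and e: "bmeas e" "\<And>s. norm (e s) \<le> A" and c: "0 \<le> c"
      and le: "\<And>p. norm (V p - V' p) \<le> c * w p" for V V' e c p
  proof -
    have "norm (goursat_integral T V e (fst p) (snd p) - goursat_integral T V' e (fst p) (snd p)) =
          norm (goursat_integral T (\<lambda>p. V p - V' p) e (max 0 (min T (fst p))) (snd p))"
      using V e by (simp add: goursat_integral_diff flip: clamp)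
    also have "\<dots> \<le> A * c * exp (\<mu> * max 0 (min T (fst p))) / \<mu>"
    proof (rule norm_goursat_integral_le[OF \<mu> c T e(2)])
      fix \<sigma> assume "0 < \<sigma>" "\<sigma> < T"
      then show "norm (V (\<sigma>, \<sigma> - snd p) - V' (\<sigma>, \<sigma> - snd p)) \<le> c * exp (\<mu> * \<sigma>)"
        using le[of "(\<sigma>, \<sigma> - snd p)"] by (simp add: w_def)
    qed
    also have "\<dots> = A / \<mu> * c * w p" by (simp add: w_def)
    also have "\<dots> \<le> 1 / 4 * c * w p"
      using A0 c by (intro mult_right_mono) (auto simp: \<mu>_def w_def field_simps)
    finally show ?thesis by simp
  qed
  obtain W where W: "continuous_on UNIV W" "bounded (range W)" "\<Phi> W = W"
  proof (rule weighted_fixpoint[of w "exp (\<mu> * T)" \<Phi>])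
    show "1 \<le> w p" "w p \<le> exp (\<mu> * T)" for p
      using T \<mu> by (auto simp: w_def)
    show "continuous_on UNIV (\<Phi> f) \<and> bounded (range (\<Phi> f))"
      if f: "continuous_on UNIV f" "bounded (range f)" for f
    proof -
      note * = goursat_integral_cont_bounded[OF T continuous_on_snd[OF f(1)] bsnd[OF f(2)] a]
        goursat_integral_cont_bounded[OF T continuous_on_fst[OF f(1)] bfst[OF f(2)] b]
      have "continuous_on UNIV (\<Phi> f)"
        unfolding \<Phi>_def by (intro continuous_intros continuous_on_compose2[OF a(1)] continuous_on_compose2[OF b(1)])
          (use * in auto)
      moreover have "bounded (range (\<Phi> f))"
      proof -
        have "bounded (range (\<lambda>p. a (snd p)))" "bounded (range (\<lambda>p. b (snd p)))" for p :: "real\<times>real"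
          using A by (auto simp: bounded_iff)
        then have "bounded (range (\<lambda>p. a (snd p) + goursat_integral T (\<lambda>p. snd (f p)) a (fst p) (snd p)))"
          "bounded (range (\<lambda>p. b (snd p) + goursat_integral T (\<lambda>p. fst (f p)) b (fst p) (snd p)))"
          using * by (auto intro!: bounded_plus_comp)
        from bounded_Times[OF this] show ?thesis
          by (rule bounded_subset) (auto simp: \<Phi>_def)
      qed
      ultimately show ?thesis ..
    qed
    show "norm (\<Phi> f p - \<Phi> g p) \<le> c / 2 * w p"
      if f: "continuous_on UNIV f" "bounded (range f)" and g: "continuous_on UNIV g" "bounded (range g)"
        and c: "0 \<le> c" and le: "\<And>q. norm (f q - g q) \<le> c * w q" for f g c p
    proof -
      have le': "norm (fst (f q) - fst (g q)) \<le> c * w q" "norm (snd (f q) - snd (g q)) \<le> c * w q" for q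
        using le[of q] by (metis fst_diff norm_fst_le order_trans prod.collapse,
          metis snd_diff norm_snd_le order_trans prod.collapse)
      have bm: "bmeas (\<lambda>p. fst (f p))" "bmeas (\<lambda>p. fst (g p))" "bmeas (\<lambda>p. snd (f p))" "bmeas (\<lambda>p. snd (g p))"
        by (intro bmeas_continuous continuous_intros bfst bsnd f g)+
      note ba = bmeas_continuous[OF a] and bb = bmeas_continuous[OF b]
      have "norm (\<Phi> f p - \<Phi> g p) \<le> c / 4 * w p + c / 4 * w p"
        unfolding \<Phi>_def diff_Pair add_diff_cancel_left
        by (rule order_trans[OF norm_Pair_le add_mono[OF half[OF bm(3,4) ba A(1) c le'(2)] half[OF bm(1,2) bb A(2) c le'(1)]]])
      then show ?thesis by simp
    qed
  qed blast
  show ?thesis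
  proof (rule that[of "\<lambda>p. fst (W p)" "\<lambda>p. snd (W p)"])
    show "fst (W (\<tau>, t)) = a t + goursat_integral T (\<lambda>p. snd (W p)) a \<tau> t"
      "snd (W (\<tau>, t)) = b t + goursat_integral T (\<lambda>p. fst (W p)) b \<tau> t" for \<tau> t
      using fun_cong[OF W(3), of "(\<tau>, t)"] by (auto simp: \<Phi>_def dest: sym)
  qed (auto intro!: continuous_intros W bfst bsnd)
qed

lemma volterra_solution:
  fixes a :: "real \<Rightarrow> complex^'r^'r"
  assumes T: "0 \<le> T" and a: "continuous_on UNIV a" "bounded (range a)"
    and X: "continuous_on UNIV X" "bounded (range X)"
  obtains q where "continuous_on UNIV q" "bounded (range q)"
    "\<And>t. 0 \<le> t \<Longrightarrow> t \<le> T \<Longrightarrow>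
       q t = a t - (LINT u|leb T. (if u < t then q (t - u) ** X (t, u) else 0))"
proof -
  \<comment> \<open>The equation is solved with t replaced by its projection to [0, T]. The solution
    is then a bounded continuous function on the whole line, and inside the interval the equation is
    the desired one.\<close>
  define cl where "cl t = max 0 (min T t)" for t
  have cl: "0 \<le> cl t" "cl t \<le> T" for t using T by (auto simp: cl_def)
  have ccl: "continuous_on UNIV cl" unfolding cl_def by (intro continuous_intros)
  then have [measurable]: "cl \<in> borel_measurable borel" by (rule borel_measurable_continuous_onI)
  note ba = bmeas_continuous[OF a] and bX = bmeas_continuous[OF X]
  obtain B where B: "\<And>p. norm (X p) \<le> B" "0 \<le> B" using bX bmeas_bound by blast
  \<comment> \<open>Makes \<open>B / \<mu>\<close> at most 1/2, the contraction factor produced by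
    the reversed weight estimate.\<close>
  define \<mu> where "\<mu> = 2 * (B + 1)"
  have \<mu>: "0 < \<mu>" using B by (simp add: \<mu>_def)
  define w where "w t = exp (\<mu> * cl t)" for t
  define \<Psi> where "\<Psi> q t = (LINT u|leb T. (if u < cl t then q (cl t - u) ** X (cl t, u) else 0))"
    for q :: "real \<Rightarrow> complex^'r^'r" and t
  have bm: "bmeas (\<lambda>p. if snd p < cl (fst p) then q (cl (fst p) - snd p) ** X (cl (fst p), snd p) else 0)"
    if "bmeas q" for q
    by (intro bmeas_intros bmeas_comp[OF that] bmeas_comp[OF bX]) measurable
  have bm1: "bmeas (\<lambda>u. if u < cl t then q (cl t - u) ** X (cl t, u) else 0)" if "bmeas q" for q t
    by (intro bmeas_intros bmeas_comp[OF that] bmeas_comp[OF bX]) measurable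
  obtain q where q: "continuous_on UNIV q" "bounded (range q)" "(\<lambda>t. a (cl t) - \<Psi> q t) = q"
  proof (rule weighted_fixpoint[of w "exp (\<mu> * T)" "\<lambda>q t. a (cl t) - \<Psi> q t"])
    show "1 \<le> w p" "w p \<le> exp (\<mu> * T)" for p
      using T \<mu> cl by (auto simp: w_def)
    show "continuous_on UNIV (\<lambda>t. a (cl t) - \<Psi> f t) \<and> bounded (range (\<lambda>t. a (cl t) - \<Psi> f t))"
      if f: "continuous_on UNIV f" "bounded (range f)" for f
    proof -
      note bf = bmeas_continuous[OF f]
      have "continuous_on UNIV (\<Psi> f)"
        unfolding \<Psi>_def
      proof (rule continuous_LINT[OF bm[OF bf]])
        fix t
        have "AE s in lborel. s \<noteq> cl t" by (rule AE_lborel_singleton)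
        then show "AE s in lborel. isCont (\<lambda>t. if s < cl t then f (cl t - s) ** X (cl t, s) else 0) t"
        proof eventually_elim
          case (elim s)
          have "continuous_on UNIV (\<lambda>t. f (cl t - s) ** X (cl t, s))"
            by (intro bounded_bilinear.continuous_on[OF bounded_bilinear_matrix_mult]
                continuous_on_compose2[OF f(1)] continuous_on_compose2[OF X(1)] continuous_intros ccl) auto
          then have "isCont (\<lambda>t. f (cl t - s) ** X (cl t, s)) t" "isCont cl t"
            using ccl by (simp_all add: continuous_on_eq_continuous_at)
          then show ?case using elim by (intro isCont_If_less continuous_intros) auto
        qed
      qed
      then have "continuous_on UNIV (\<lambda>t. a (cl t) - \<Psi> f t)"
        by (intro continuous_intros continuous_on_compose2[OF a(1)] ccl) auto
      moreover have "bmeas (\<lambda>t. a (cl t) - \<Psi> f t)"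
        unfolding \<Psi>_def by (intro bmeas_intros bmeas_comp[OF ba] bmeas_LINT[OF bm[OF bf]] T) measurable
      ultimately show ?thesis by (simp add: bounded_range_bmeas)
    qed
    show "norm ((a (cl t) - \<Psi> f t) - (a (cl t) - \<Psi> g t)) \<le> c / 2 * w t"
      if f: "continuous_on UNIV f" "bounded (range f)" and g: "continuous_on UNIV g" "bounded (range g)"
        and c: "0 \<le> c" and le: "\<And>q. norm (f q - g q) \<le> c * w q" for f g c t
    proof -
      note bf = bmeas_continuous[OF f] and bg = bmeas_continuous[OF g]
      have "norm ((a (cl t) - \<Psi> f t) - (a (cl t) - \<Psi> g t)) = norm (\<Psi> f t - \<Psi> g t)"
        by (simp add: norm_minus_commute)
      also have "\<Psi> f t - \<Psi> g t = (LINT u|leb T. (if u < cl t then f (cl t - u) ** X (cl t, u) else 0) -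
          (if u < cl t then g (cl t - u) ** X (cl t, u) else 0))"
        unfolding \<Psi>_def by (rule LINT_diff[symmetric]) (intro bm1 bf bg)+
      also have "norm \<dots> \<le> c * B * exp (\<mu> * cl t) / \<mu>"
      proof (rule norm_LINT_exp_rev_le[OF \<mu> _ T cl(2)])
        show "norm ((if s < cl t then f (cl t - s) ** X (cl t, s) else 0) -
            (if s < cl t then g (cl t - s) ** X (cl t, s) else 0))
          \<le> (if s < cl t then c * B * exp (\<mu> * (cl t - s)) else 0)" if s: "0 < s" "s < T" for s
        proof (cases "s < cl t")
          case True
          then have "cl (cl t - s) = cl t - s" using s cl(2)[of t] by (auto simp: cl_def)
          then have *: "norm (f (cl t - s) - g (cl t - s)) \<le> c * exp (\<mu> * (cl t - s))"
            using le[of "cl t - s"] by (simp add: w_def)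
          have "norm ((f (cl t - s) - g (cl t - s)) ** X (cl t, s)) \<le> (c * exp (\<mu> * (cl t - s))) * B"
            using * B c by (intro order_trans[OF norm_matrix_mult_le] mult_mono) auto
          then show ?thesis using True by (simp add: matrix_mult_diff_left mult_ac)
        qed auto
      qed (use B c in auto)
      also have "\<dots> = B / \<mu> * c * w t" by (simp add: w_def)
      also have "\<dots> \<le> 1 / 2 * c * w t"
        using B c by (intro mult_right_mono) (auto simp: \<mu>_def w_def field_simps)
      finally show ?thesis by simp
    qed
  qed blast
  show ?thesis
  proof (rule that[OF q(1,2)])
    fix t assume "0 \<le> t" "t \<le> T"
    then have "cl t = t" by (simp add: cl_def)
    then show "q t = a t - (LINT u|leb T. (if u < t then q (t - u) ** X (t, u) else 0))"
      using fun_cong[OF q(3), of t] unfolding \<Psi>_def \<open>cl t = t\<close> by simp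
  qed
qed

section \<open>Krein's formula\<close>

text \<open>The operator \<open>T\<^sub>\<tau>\<close> acting on matrix-valued columns. The column
  \<open>u\<close> may itself vary with \<tau>, so that a change of \<tau> acts both on the length
  of the interval and on the column; Krein's formula accounts for the two together.\<close>

definition trunc_conv :: "real \<Rightarrow> (real \<Rightarrow> complex^'r^'r) \<Rightarrow> real \<Rightarrow> (real \<Rightarrow> complex^'r^'r) \<Rightarrow> real \<Rightarrow> complex^'r^'r" where
  "trunc_conv T k \<tau> u t = u t - (LINT \<xi>|leb T. (if \<xi> < \<tau> then k (t - \<xi>) ** u \<xi> else 0))"

text \<open>The hypothesis on \<open>u = U(\<tau>, \<cdot>)\<close> and \<open>u0 = U(\<rho>, \<cdot>)\<close> is the integrated form of
  \<open>\<partial>U/\<partial>\<tau>(\<tau>, \<xi>) = Y(\<tau>, \<xi>) b(\<tau>)\<close>, \<open>U(\<xi>, \<xi>) = b(\<xi>)\<close>.\<close>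

lemma krein_formula:
  fixes k :: "real \<Rightarrow> complex^'r^'r"
  assumes T: "0 \<le> T" and \<rho>: "\<rho> \<le> \<tau>" "t \<le> \<rho>"
    and bm: "bmeas k" "bmeas Y" "bmeas b" "bmeas u0"
    and u: "\<And>\<xi>. \<xi> \<le> \<rho> \<or> 0 < \<xi> \<and> \<xi> < \<tau> \<Longrightarrow> u \<xi> = (if \<xi> \<le> \<rho> then u0 \<xi> else b \<xi>) +
      (LINT \<sigma>|leb T. (if \<rho> < \<sigma> \<and> \<xi> < \<sigma> \<and> \<sigma> < \<tau> then Y (\<sigma>, \<xi>) ** b \<sigma> else 0))"
  shows "trunc_conv T k \<tau> u t - trunc_conv T k \<rho> u0 t =
    (LINT \<sigma>|leb T. (if \<rho> < \<sigma> \<and> \<sigma> < \<tau>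
       then (trunc_conv T k \<sigma> (\<lambda>\<xi>. Y (\<sigma>, \<xi>)) t - k (t - \<sigma>)) ** b \<sigma> else 0))"
proof -
  note bi = bmeas_intros bmeas_comp[OF bm(1)] bmeas_comp[OF bm(2)] bmeas_comp[OF bm(3)] bmeas_comp[OF bm(4)]
  define V where "V \<xi> = (LINT \<sigma>|leb T. (if \<rho> < \<sigma> \<and> \<xi> < \<sigma> \<and> \<sigma> < \<tau> then Y (\<sigma>, \<xi>) ** b \<sigma> else 0))" for \<xi>
  have bV: "bmeas V"
    unfolding V_def by (intro bi T) measurable
  note bi = bi bmeas_comp[OF bV]
  define K where "K \<sigma> = (LINT \<xi>|leb T. (if \<xi> < \<sigma> then k (t - \<xi>) ** Y (\<sigma>, \<xi>) else 0))" for \<sigma>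
  have bK: "bmeas K"
    unfolding K_def by (intro bi T) measurable
  note bi = bi bmeas_comp[OF bK]
  \<comment> \<open>The column is split at \<rho>. The middle term comes from the boundary values
    \<open>b\<close> of the column beyond \<rho>; it becomes the inhomogeneity
    \<open>k (t - \<sigma>)\<close> of the conclusion.\<close>
  have 1: "(LINT \<xi>|leb T. (if \<xi> < \<tau> then k (t - \<xi>) ** u \<xi> else 0)) =
     (LINT \<xi>|leb T. (if \<xi> \<le> \<rho> then k (t - \<xi>) ** u0 \<xi> else 0)) +
     (LINT \<xi>|leb T. (if \<rho> < \<xi> \<and> \<xi> < \<tau> then k (t - \<xi>) ** b \<xi> else 0)) +
     (LINT \<xi>|leb T. (if \<xi> < \<tau> then k (t - \<xi>) ** V \<xi> else 0))"
  proof -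
    have "(LINT \<xi>|leb T. (if \<xi> < \<tau> then k (t - \<xi>) ** u \<xi> else 0)) =
     (LINT \<xi>|leb T. (if \<xi> < \<tau> then k (t - \<xi>) ** ((if \<xi> \<le> \<rho> then u0 \<xi> else b \<xi>) + V \<xi>) else 0))"
      by (rule LINT_cong) (auto simp: u V_def)
    also have "\<dots> = (LINT \<xi>|leb T. ((if \<xi> \<le> \<rho> then k (t - \<xi>) ** u0 \<xi> else 0) +
     (if \<rho> < \<xi> \<and> \<xi> < \<tau> then k (t - \<xi>) ** b \<xi> else 0)) +
     (if \<xi> < \<tau> then k (t - \<xi>) ** V \<xi> else 0))"
      \<comment> \<open>The point \<tau> has to be exempted for the case \<rho> = \<tau>, where it
        satisfies \<xi> \<le> \<rho> but not \<xi> < \<tau>.\<close>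
      by (rule LINT_cong_except[where r = \<tau>]) (((intro bi; measurable)+)[2], use \<rho> in \<open>auto simp: matrix_add_ldistrib\<close>)
    also have "\<dots> = (LINT \<xi>|leb T. (if \<xi> \<le> \<rho> then k (t - \<xi>) ** u0 \<xi> else 0)) +
     (LINT \<xi>|leb T. (if \<rho> < \<xi> \<and> \<xi> < \<tau> then k (t - \<xi>) ** b \<xi> else 0)) +
     (LINT \<xi>|leb T. (if \<xi> < \<tau> then k (t - \<xi>) ** V \<xi> else 0))"
      by (subst LINT_add, (intro bi; measurable), (intro bi; measurable), subst LINT_add) (intro bi refl; measurable)+
    finally show ?thesis .
  qed
  have 2: "(LINT \<xi>|leb T. (if \<xi> \<le> \<rho> then k (t - \<xi>) ** u0 \<xi> else 0)) =
     (LINT \<xi>|leb T. (if \<xi> < \<rho> then k (t - \<xi>) ** u0 \<xi> else 0))"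
    by (rule LINT_cong_except[where r = \<rho>]) (((intro bi; measurable)+)[2], auto)
  \<comment> \<open>Exchanging the integrations over \<xi> < \<sigma> < \<tau> turns the inner
    integral into the convolution of k with the column \<open>Y (\<sigma>, \<cdot>)\<close>, cut off
    at \<sigma>.\<close>
  have 3: "(LINT \<xi>|leb T. (if \<xi> < \<tau> then k (t - \<xi>) ** V \<xi> else 0)) =
     (LINT \<sigma>|leb T. (if \<rho> < \<sigma> \<and> \<sigma> < \<tau> then K \<sigma> ** b \<sigma> else 0))"
  proof -
    have "(LINT \<xi>|leb T. (if \<xi> < \<tau> then k (t - \<xi>) ** V \<xi> else 0)) =
      (LINT \<xi>|leb T. LINT \<sigma>|leb T. (if \<rho> < \<sigma> \<and> \<xi> < \<sigma> \<and> \<sigma> < \<tau> then k (t - \<xi>) ** (Y (\<sigma>, \<xi>) ** b \<sigma>) else 0))"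
    proof (rule LINT_cong)
      fix \<xi>
      show "(if \<xi> < \<tau> then k (t - \<xi>) ** V \<xi> else 0) =
        (LINT \<sigma>|leb T. (if \<rho> < \<sigma> \<and> \<xi> < \<sigma> \<and> \<sigma> < \<tau> then k (t - \<xi>) ** (Y (\<sigma>, \<xi>) ** b \<sigma>) else 0))"
      proof (cases "\<xi> < \<tau>")
        case True
        then have "k (t - \<xi>) ** V \<xi> = (LINT \<sigma>|leb T. k (t - \<xi>) ** (if \<rho> < \<sigma> \<and> \<xi> < \<sigma> \<and> \<sigma> < \<tau> then Y (\<sigma>, \<xi>) ** b \<sigma> else 0))"
          unfolding V_def by (subst LINT_mult_left) (intro bi refl; measurable)+
        also have "\<dots> = (LINT \<sigma>|leb T. (if \<rho> < \<sigma> \<and> \<xi> < \<sigma> \<and> \<sigma> < \<tau> then k (t - \<xi>) ** (Y (\<sigma>, \<xi>) ** b \<sigma>) else 0))"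
          by (rule LINT_cong) auto
        finally show ?thesis using True by simp
      next
        case False
        then have "(LINT \<sigma>|leb T. (if \<rho> < \<sigma> \<and> \<xi> < \<sigma> \<and> \<sigma> < \<tau> then k (t - \<xi>) ** (Y (\<sigma>, \<xi>) ** b \<sigma>) else 0)) = (LINT \<sigma>|leb T. 0)"
          by (intro LINT_cong) auto
        then show ?thesis using False by simp
      qed
    qed
    also have "\<dots> = (LINT \<sigma>|leb T. LINT \<xi>|leb T. (if \<rho> < \<sigma> \<and> \<xi> < \<sigma> \<and> \<sigma> < \<tau> then k (t - \<xi>) ** (Y (\<sigma>, \<xi>) ** b \<sigma>) else 0))"
      by (rule bmeas_Fubini) (intro bi; measurable)
    also have "\<dots> = (LINT \<sigma>|leb T. (if \<rho> < \<sigma> \<and> \<sigma> < \<tau> then K \<sigma> ** b \<sigma> else 0))"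
    proof (rule LINT_cong)
      fix \<sigma>
      show "(LINT \<xi>|leb T. (if \<rho> < \<sigma> \<and> \<xi> < \<sigma> \<and> \<sigma> < \<tau> then k (t - \<xi>) ** (Y (\<sigma>, \<xi>) ** b \<sigma>) else 0)) =
        (if \<rho> < \<sigma> \<and> \<sigma> < \<tau> then K \<sigma> ** b \<sigma> else 0)"
      proof (cases "\<rho> < \<sigma> \<and> \<sigma> < \<tau>")
        case True
        then have "(LINT \<xi>|leb T. (if \<rho> < \<sigma> \<and> \<xi> < \<sigma> \<and> \<sigma> < \<tau> then k (t - \<xi>) ** (Y (\<sigma>, \<xi>) ** b \<sigma>) else 0)) =
          (LINT \<xi>|leb T. (if \<xi> < \<sigma> then k (t - \<xi>) ** Y (\<sigma>, \<xi>) else 0) ** b \<sigma>)"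
          by (intro LINT_cong) (auto simp: matrix_mul_assoc)
        also have "\<dots> = K \<sigma> ** b \<sigma>"
          unfolding K_def by (rule LINT_mult_right) (intro bi; measurable)
        finally show ?thesis using True by simp
      qed auto
    qed
    finally show ?thesis .
  qed
  have ut: "u t = u0 t + (LINT \<sigma>|leb T. (if \<rho> < \<sigma> \<and> \<sigma> < \<tau> then Y (\<sigma>, t) ** b \<sigma> else 0))"
  proof -
    have "u t = u0 t + (LINT \<sigma>|leb T. (if \<rho> < \<sigma> \<and> t < \<sigma> \<and> \<sigma> < \<tau> then Y (\<sigma>, t) ** b \<sigma> else 0))"
      using u[of t] \<rho> by simp
    also have "(LINT \<sigma>|leb T. (if \<rho> < \<sigma> \<and> t < \<sigma> \<and> \<sigma> < \<tau> then Y (\<sigma>, t) ** b \<sigma> else 0)) =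
      (LINT \<sigma>|leb T. (if \<rho> < \<sigma> \<and> \<sigma> < \<tau> then Y (\<sigma>, t) ** b \<sigma> else 0))"
      using \<rho> by (intro LINT_cong) auto
    finally show ?thesis .
  qed
  have "(LINT \<sigma>|leb T. (if \<rho> < \<sigma> \<and> \<sigma> < \<tau>
       then (trunc_conv T k \<sigma> (\<lambda>\<xi>. Y (\<sigma>, \<xi>)) t - k (t - \<sigma>)) ** b \<sigma> else 0)) =
    (LINT \<sigma>|leb T. ((if \<rho> < \<sigma> \<and> \<sigma> < \<tau> then Y (\<sigma>, t) ** b \<sigma> else 0) -
      (if \<rho> < \<sigma> \<and> \<sigma> < \<tau> then K \<sigma> ** b \<sigma> else 0)) -
      (if \<rho> < \<sigma> \<and> \<sigma> < \<tau> then k (t - \<sigma>) ** b \<sigma> else 0))"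
    by (rule LINT_cong) (auto simp: trunc_conv_def K_def matrix_mult_diff_left)
  also have "\<dots> = (LINT \<sigma>|leb T. (if \<rho> < \<sigma> \<and> \<sigma> < \<tau> then Y (\<sigma>, t) ** b \<sigma> else 0)) -
      (LINT \<sigma>|leb T. (if \<rho> < \<sigma> \<and> \<sigma> < \<tau> then K \<sigma> ** b \<sigma> else 0)) -
      (LINT \<sigma>|leb T. (if \<rho> < \<sigma> \<and> \<sigma> < \<tau> then k (t - \<sigma>) ** b \<sigma> else 0))"
    by (subst LINT_diff, (intro bi; measurable), (intro bi; measurable), subst LINT_diff) (intro bi refl; measurable)+
  finally have 4: "(LINT \<sigma>|leb T. (if \<rho> < \<sigma> \<and> \<sigma> < \<tau>
       then (trunc_conv T k \<sigma> (\<lambda>\<xi>. Y (\<sigma>, \<xi>)) t - k (t - \<sigma>)) ** b \<sigma> else 0)) = \<dots>" .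
  have gen: "(x + A) - (B + C + D) - (x - B) = A - D - C" for x A B C D :: "complex^'r^'r"
    by simp
  have 5: "trunc_conv T k \<tau> u t = u t - (LINT \<xi>|leb T. (if \<xi> < \<tau> then k (t - \<xi>) ** u \<xi> else 0))"
    "trunc_conv T k \<rho> u0 t = u0 t - (LINT \<xi>|leb T. (if \<xi> < \<rho> then k (t - \<xi>) ** u0 \<xi> else 0))"
    by (rule trunc_conv_def)+
  show ?thesis
    by (subst 5(1), subst 5(2), subst 1, subst 2, subst 3, subst 4, subst ut, rule gen)
qed

lemma trunc_conv_leb:
  "\<tau> \<le> T \<Longrightarrow> trunc_conv T k \<tau> u t = u t - (LINT \<xi>|leb \<tau>. k (t - \<xi>) ** u \<xi>)"
  by (simp add: trunc_conv_def LINT_leb_If)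

text \<open>The difference structure at work: reversing the interval replaces k(x) by k(-x). For
  \<open>jump f g\<close> this exchanges f and g, and so couples the column X with the reversed
  column Z.\<close>

lemma trunc_conv_reflect:
  assumes "\<sigma> \<le> T"
  shows "trunc_conv T k \<sigma> (\<lambda>\<xi>. u (\<sigma> - \<xi>)) t = trunc_conv T (\<lambda>x. k (- x)) \<sigma> u (\<sigma> - t)"
  using assms LINT_leb_reflect[of \<sigma> "\<lambda>\<xi>. k (t - (\<sigma> - \<xi>)) ** u \<xi>"]
  by (simp add: trunc_conv_leb algebra_simps)

text \<open>A kernel is assembled from two functions on the half-line because its one-sided limits
  at 0 differ in general. The second one is the reflected negative half, so hermitian symmetry of
  the kernel means that g is the adjoint of f. The value at 0 is chosen as 0.\<close>

definition jump :: "(real \<Rightarrow> 'b) \<Rightarrow> (real \<Rightarrow> 'b) \<Rightarrow> real \<Rightarrow> 'b::zero" where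
  "jump f g u = (if 0 < u then f u else if u < 0 then g (- u) else 0)"

lemma jump_minus: "jump f g (- u) = jump g f u"
  by (auto simp: jump_def)

lemma bmeas_jump:
  assumes "bmeas f" "bmeas g" shows "bmeas (jump f g)"
  unfolding jump_def[abs_def] by (intro bmeas_If bmeas_const bmeas_comp[OF assms(2)] assms(1)) measurable

text \<open>Krein's formula turns the residual of \<open>X\<close> into an integral of the residual of \<open>Z\<close>, whose
  kernel is the reflected one.\<close>

lemma goursat_residual:
  fixes X Z :: "real \<times> real \<Rightarrow> complex^'r^'r"
  assumes T: "0 \<le> T" and t: "0 \<le> t" "t \<le> \<tau>" "\<tau> \<le> T"
    and bm: "bmeas X" "bmeas Z" "bmeas f" "bmeas g" "bmeas a"
    and X: "\<And>\<tau> t. X (\<tau>, t) = a t + goursat_integral T Z a \<tau> t"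
    and f: "f t = a t - (LINT u|leb T. (if u < t then f (t - u) ** X (t, u) else 0))"
  shows "trunc_conv T (jump f g) \<tau> (\<lambda>\<xi>. X (\<tau>, \<xi>)) t - f t =
    goursat_integral T (\<lambda>p. trunc_conv T (jump g f) (fst p) (\<lambda>\<xi>. Z (fst p, \<xi>)) (snd p) - g (snd p)) a \<tau> t"
proof -
  note bi = bmeas_intros bmeas_comp[OF bm(1)] bmeas_comp[OF bm(2)] bmeas_comp[OF bm(3)] bmeas_comp[OF bm(4)] bmeas_comp[OF bm(5)]
  have bY: "bmeas (\<lambda>p. Z (fst p, fst p - snd p))" by (intro bi) measurable
  have bX: "bmeas (\<lambda>\<xi>. X (t, \<xi>))" by (intro bi) measurable
  \<comment> \<open>At \<tau> = t the convolution only sees positive arguments of the kernel, that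
    is, the half \<open>f\<close>; the claim becomes the Volterra equation for
    \<open>f\<close>.\<close>
  have diag: "trunc_conv T (jump f g) t (\<lambda>\<xi>. X (t, \<xi>)) t = f t"
  proof -
    have "X (t, t) = a t + (LINT \<sigma>|leb T. 0)"
      unfolding X goursat_integral_def by (intro arg_cong2[where f = "(+)"] refl LINT_cong) auto
    moreover have "(LINT \<xi>|leb T. (if \<xi> < t then jump f g (t - \<xi>) ** X (t, \<xi>) else 0)) =
        (LINT u|leb T. (if u < t then f (t - u) ** X (t, u) else 0))"
      by (rule LINT_cong) (auto simp: jump_def)
    ultimately show ?thesis unfolding trunc_conv_def by (subst f) simp
  qed
  \<comment> \<open>Brings the Goursat equation for \<open>X\<close> into the form required by
    Krein's formula with \<rho> = t.\<close>
  have split: "X (\<tau>, \<xi>) = (if \<xi> \<le> t then X (t, \<xi>) else a \<xi>) +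
      (LINT \<sigma>|leb T. (if t < \<sigma> \<and> \<xi> < \<sigma> \<and> \<sigma> < \<tau> then Z (\<sigma>, \<sigma> - \<xi>) ** a \<sigma> else 0))" for \<xi>
  proof (cases "\<xi> \<le> t")
    case True
    have "goursat_integral T Z a \<tau> \<xi> = (LINT \<sigma>|leb T. (if \<xi> < \<sigma> \<and> \<sigma> < t then Z (\<sigma>, \<sigma> - \<xi>) ** a \<sigma> else 0) +
       (if t < \<sigma> \<and> \<xi> < \<sigma> \<and> \<sigma> < \<tau> then Z (\<sigma>, \<sigma> - \<xi>) ** a \<sigma> else 0))"
      unfolding goursat_integral_def
      by (rule LINT_cong_except[where r = t]) (((intro bi; measurable)+)[2], use t True in auto)
    also have "\<dots> = goursat_integral T Z a t \<xi> +
       (LINT \<sigma>|leb T. (if t < \<sigma> \<and> \<xi> < \<sigma> \<and> \<sigma> < \<tau> then Z (\<sigma>, \<sigma> - \<xi>) ** a \<sigma> else 0))"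
      unfolding goursat_integral_def by (rule LINT_add) (intro bi; measurable)+
    finally show ?thesis using True by (simp add: X)
  next
    case False
    have "goursat_integral T Z a \<tau> \<xi> = (LINT \<sigma>|leb T. (if t < \<sigma> \<and> \<xi> < \<sigma> \<and> \<sigma> < \<tau> then Z (\<sigma>, \<sigma> - \<xi>) ** a \<sigma> else 0))"
      unfolding goursat_integral_def by (rule LINT_cong) (use False in auto)
    then show ?thesis using False by (simp add: X)
  qed
  have reflected: "trunc_conv T (jump f g) \<sigma> (\<lambda>\<xi>. Z (\<sigma>, \<sigma> - \<xi>)) t - jump f g (t - \<sigma>) =
    trunc_conv T (jump g f) \<sigma> (\<lambda>\<xi>. Z (\<sigma>, \<xi>)) (\<sigma> - t) - g (\<sigma> - t)" if "t < \<sigma>" "\<sigma> < T" for \<sigma>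
    using that trunc_conv_reflect[of \<sigma> T "jump f g" "\<lambda>\<xi>. Z (\<sigma>, \<xi>)" t]
    by (simp add: jump_minus jump_def[of f g "t - \<sigma>"])
  have "trunc_conv T (jump f g) \<tau> (\<lambda>\<xi>. X (\<tau>, \<xi>)) t - trunc_conv T (jump f g) t (\<lambda>\<xi>. X (t, \<xi>)) t =
    (LINT \<sigma>|leb T. (if t < \<sigma> \<and> \<sigma> < \<tau>
       then (trunc_conv T (jump f g) \<sigma> (\<lambda>\<xi>. (\<lambda>p. Z (fst p, fst p - snd p)) (\<sigma>, \<xi>)) t - jump f g (t - \<sigma>)) ** a \<sigma> else 0))"
    by (rule krein_formula[OF T t(2) order_refl bmeas_jump[OF bm(3,4)] bY bm(5) bX])
      (unfold fst_conv snd_conv, rule split)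
  then have "trunc_conv T (jump f g) \<tau> (\<lambda>\<xi>. X (\<tau>, \<xi>)) t - f t =
    (LINT \<sigma>|leb T. (if t < \<sigma> \<and> \<sigma> < \<tau>
       then (trunc_conv T (jump f g) \<sigma> (\<lambda>\<xi>. Z (\<sigma>, \<sigma> - \<xi>)) t - jump f g (t - \<sigma>)) ** a \<sigma> else 0))"
    unfolding diag fst_conv snd_conv .
  also have "\<dots> = goursat_integral T (\<lambda>p. trunc_conv T (jump g f) (fst p) (\<lambda>\<xi>. Z (fst p, \<xi>)) (snd p) - g (snd p)) a \<tau> t"
    unfolding goursat_integral_def fst_conv snd_conv
    by (rule LINT_cong, rule if_cong[OF refl _ refl], subst reflected) (use t in auto)
  finally show ?thesis .
qed

lemma norm_trunc_conv_le:
  assumes "0 \<le> T" "\<And>u. norm (k u) \<le> K" "\<And>\<xi>. norm (u \<xi>) \<le> U"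
  shows "norm (trunc_conv T k \<tau> u t) \<le> U + T * (K * U)"
proof -
  have "0 \<le> K" "0 \<le> U" using assms(2)[of 0] assms(3)[of 0] norm_ge_zero order_trans by blast+
  then have "norm (LINT \<xi>|leb T. (if \<xi> < \<tau> then k (t - \<xi>) ** u \<xi> else 0)) \<le> T * (K * U)"
    using assms by (intro norm_LINT_le_const) (auto intro!: order_trans[OF norm_matrix_mult_le] mult_mono)
  then show ?thesis
    unfolding trunc_conv_def using assms(3)[of t] by (intro order_trans[OF norm_triangle_ineq4]) linarith
qed

text \<open>On the triangle \<open>D\<close> each residual is the Goursat integral of the other, and
  \<open>D\<close> is stable under passing from (\<tau>, t) to (\<sigma>, \<sigma> - t) with t <
  \<sigma> < \<tau>. So a bound valid on \<open>D\<close> reproduces itself there with half the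
  constant.\<close>

lemma goursat_residuals_zero:
  fixes X Z :: "real \<times> real \<Rightarrow> complex^'r^'r"
  assumes T: "0 \<le> T"
    and bm: "bmeas X" "bmeas Z" "bmeas f" "bmeas g" "bmeas a" "bmeas b"
    and X: "\<And>\<tau> t. X (\<tau>, t) = a t + goursat_integral T Z a \<tau> t"
    and Z: "\<And>\<tau> t. Z (\<tau>, t) = b t + goursat_integral T X b \<tau> t"
    and f: "\<And>t. 0 \<le> t \<Longrightarrow> t \<le> T \<Longrightarrow> f t = a t - (LINT u|leb T. (if u < t then f (t - u) ** X (t, u) else 0))"
    and g: "\<And>t. 0 \<le> t \<Longrightarrow> t \<le> T \<Longrightarrow> g t = b t - (LINT u|leb T. (if u < t then g (t - u) ** Z (t, u) else 0))"
    and t: "0 \<le> t" "t \<le> \<tau>" "\<tau> \<le> T"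
  shows "trunc_conv T (jump f g) \<tau> (\<lambda>\<xi>. X (\<tau>, \<xi>)) t = f t"
    and "trunc_conv T (jump g f) \<tau> (\<lambda>\<xi>. Z (\<tau>, \<xi>)) t = g t"
proof -
  define R where "R p = trunc_conv T (jump f g) (fst p) (\<lambda>\<xi>. X (fst p, \<xi>)) (snd p) - f (snd p)" for p
  define S where "S p = trunc_conv T (jump g f) (fst p) (\<lambda>\<xi>. Z (fst p, \<xi>)) (snd p) - g (snd p)" for p
  define D where "D = {p. 0 \<le> snd p \<and> snd p \<le> fst p \<and> fst p \<le> T}"
  have RS: "R p = goursat_integral T S a (fst p) (snd p)" "S p = goursat_integral T R b (fst p) (snd p)"
    if "p \<in> D" for p
    using that goursat_residual[OF T _ _ _ bm(1,2,3,4,5) X f] goursat_residual[OF T _ _ _ bm(2,1,4,3,6) Z g]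
    by (auto simp: D_def R_def[abs_def] S_def[abs_def])
  obtain C where C: "\<And>p. norm (X p) \<le> C" "\<And>p. norm (Z p) \<le> C" "\<And>s. norm (f s) \<le> C" "\<And>s. norm (g s) \<le> C"
      "\<And>s. norm (a s) \<le> C" "\<And>s. norm (b s) \<le> C" "0 \<le> C"
  proof -
    obtain C1 C2 C3 C4 C5 C6 where *: "\<And>p. norm (X p) \<le> C1" "\<And>p. norm (Z p) \<le> C2" "\<And>s. norm (f s) \<le> C3" "\<And>s. norm (g s) \<le> C4"
      "\<And>s. norm (a s) \<le> C5" "\<And>s. norm (b s) \<le> C6"
      using bm unfolding bmeas_def by metis
    define C where "C = Max {C1, C2, C3, C4, C5, C6}"
    have "C1 \<le> C" "C2 \<le> C" "C3 \<le> C" "C4 \<le> C" "C5 \<le> C" "C6 \<le> C" by (auto simp: C_def)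
    moreover have "0 \<le> C1" using *(1) norm_ge_zero order_trans by blast
    ultimately show ?thesis
      by (intro that[of C]; fastforce intro: order_trans[OF *(1)] order_trans[OF *(2)] order_trans[OF *(3)]
          order_trans[OF *(4)] order_trans[OF *(5)] order_trans[OF *(6)])
  qed
  have jb: "norm (jump f g u) \<le> C" "norm (jump g f u) \<le> C" for u
    using C by (auto simp: jump_def)
  define B where "B = C + T * (C * C) + C"
  have B: "norm (R p) \<le> B" "norm (S p) \<le> B" for p
    unfolding R_def S_def B_def
    by (rule order_trans[OF norm_triangle_ineq4], intro add_mono norm_trunc_conv_le T jb C)+
  have B0: "0 \<le> B" using B(1) norm_ge_zero order_trans by blast
  define \<mu> where "\<mu> = 2 * (C + 1)"
  have \<mu>: "0 < \<mu>" using C by (simp add: \<mu>_def)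
  have zero: "max (norm (R p)) (norm (S p)) \<le> 0" if "p \<in> D" for p
  proof (rule zero_by_halving[where D = D and w = "\<lambda>p. exp (\<mu> * fst p)" and e = "\<lambda>p. max (norm (R p)) (norm (S p))", OF _ B0 _ that])
    fix p assume "p \<in> D"
    then have "1 \<le> exp (\<mu> * fst p)" using \<mu> by (auto simp: D_def)
    then have "B * 1 \<le> B * exp (\<mu> * fst p)" using B0 by (intro mult_left_mono)
    then show "max (norm (R p)) (norm (S p)) \<le> B * exp (\<mu> * fst p)" using B[of p] by auto
  next
    fix c p assume c: "0 \<le> c" and le: "\<And>p. p \<in> D \<Longrightarrow> max (norm (R p)) (norm (S p)) \<le> c * exp (\<mu> * fst p)"
      and p: "p \<in> D"
    have half: "norm (goursat_integral T V e (fst p) (snd p)) \<le> c / 2 * exp (\<mu> * fst p)"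
      if e: "\<And>s. norm (e s) \<le> C" and V: "\<And>p. p \<in> D \<Longrightarrow> norm (V p) \<le> c * exp (\<mu> * fst p)" for V e
    proof -
      have "norm (goursat_integral T V e (fst p) (snd p)) \<le> C * c * exp (\<mu> * fst p) / \<mu>"
        using p V[of "(_, _ - snd p)"] by (intro norm_goursat_integral_le[OF \<mu> c T e]) (auto simp: D_def)
      also have "\<dots> = C / \<mu> * c * exp (\<mu> * fst p)" by simp
      also have "\<dots> \<le> 1 / 2 * c * exp (\<mu> * fst p)"
        using C c by (intro mult_right_mono) (auto simp: \<mu>_def field_simps)
      finally show ?thesis by simp
    qed
    show "max (norm (R p)) (norm (S p)) \<le> c / 2 * exp (\<mu> * fst p)"
      unfolding RS[OF p] by (intro max.boundedI half C) (use le in auto)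
  qed
  have "(\<tau>, t) \<in> D" using t by (simp add: D_def)
  from zero[OF this] show "trunc_conv T (jump f g) \<tau> (\<lambda>\<xi>. X (\<tau>, \<xi>)) t = f t"
    "trunc_conv T (jump g f) \<tau> (\<lambda>\<xi>. Z (\<tau>, \<xi>)) t = g t"
    by (auto simp: R_def S_def)
qed

section \<open>Hermitian symmetry\<close>

text \<open>By Fubini, a kernel acting on rows from the right is the transpose of the same kernel
  acting on columns from the left. This moves an operator from one factor to the other when a row
  equation is known for \<open>p\<close> or a column equation for \<open>y\<close>.\<close>

lemma pairing:
  fixes p y :: "real \<Rightarrow> complex^'r^'r"
  assumes \<tau>: "0 \<le> \<tau>" and bm: "bmeas p" "bmeas y" "bmeas k"
  shows "(LINT \<eta>|leb \<tau>. (p \<eta> - (LINT \<xi>|leb \<tau>. p \<xi> ** k (\<xi> - \<eta>))) ** y \<eta>) =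
    (LINT \<xi>|leb \<tau>. p \<xi> ** (y \<xi> - (LINT \<eta>|leb \<tau>. k (\<xi> - \<eta>) ** y \<eta>)))"
proof -
  note bi = bmeas_intros bmeas_comp[OF bm(1)] bmeas_comp[OF bm(2)] bmeas_comp[OF bm(3)]
  define P where "P \<eta> = (LINT \<xi>|leb \<tau>. p \<xi> ** k (\<xi> - \<eta>))" for \<eta>
  define Q where "Q \<xi> = (LINT \<eta>|leb \<tau>. k (\<xi> - \<eta>) ** y \<eta>)" for \<xi>
  have bP: "bmeas P" unfolding P_def by (intro bi \<tau>)
  have bQ: "bmeas Q" unfolding Q_def by (intro bi \<tau>)
  note bi = bi bmeas_comp[OF bP] bmeas_comp[OF bQ]
  have "(LINT \<eta>|leb \<tau>. P \<eta> ** y \<eta>) = (LINT \<eta>|leb \<tau>. LINT \<xi>|leb \<tau>. p \<xi> ** (k (\<xi> - \<eta>) ** y \<eta>))"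
    unfolding P_def by (subst LINT_mult_right[symmetric]) (intro bi refl, simp only: matrix_mul_assoc)
  also have "\<dots> = (LINT \<xi>|leb \<tau>. LINT \<eta>|leb \<tau>. p \<xi> ** (k (\<xi> - \<eta>) ** y \<eta>))"
    by (rule bmeas_Fubini) (intro bi)
  also have "\<dots> = (LINT \<xi>|leb \<tau>. p \<xi> ** Q \<xi>)"
    unfolding Q_def by (subst LINT_mult_left) (intro bi refl)+
  finally have *: "(LINT \<eta>|leb \<tau>. P \<eta> ** y \<eta>) = (LINT \<xi>|leb \<tau>. p \<xi> ** Q \<xi>)" .
  have "(LINT \<eta>|leb \<tau>. (p \<eta> - P \<eta>) ** y \<eta>) = (LINT \<eta>|leb \<tau>. p \<eta> ** y \<eta>) - (LINT \<eta>|leb \<tau>. P \<eta> ** y \<eta>)"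
    unfolding matrix_mult_diff_left by (rule LINT_diff) (intro bi)+
  also have "\<dots> = (LINT \<xi>|leb \<tau>. p \<xi> ** (y \<xi> - Q \<xi>))"
    unfolding matrix_mult_diff_right * by (rule LINT_diff[symmetric]) (intro bi)+
  finally show ?thesis by (simp add: P_def Q_def)
qed

text \<open>The two half-interval equations determine \<open>f\<close> and \<open>g\<close> separately.  Pairing the column \<open>X\<close>
  with the adjoint of the column \<open>Z\<close> expresses \<open>d = f - g\<^sup>*\<close> at \<open>\<tau>\<close> linearly through the values
  of \<open>d\<close> on \<open>(0, \<tau>)\<close>, so \<open>d = 0\<close>.\<close>

lemma goursat_accelerant_hermitian:
  fixes X Z :: "real \<times> real \<Rightarrow> complex^'r^'r"
  assumes T: "0 \<le> T" and bm: "bmeas X" "bmeas Z" "bmeas f" "bmeas g"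
    and RX: "\<And>\<tau> t. 0 \<le> t \<Longrightarrow> t \<le> \<tau> \<Longrightarrow> \<tau> \<le> T \<Longrightarrow> trunc_conv T (jump f g) \<tau> (\<lambda>\<xi>. X (\<tau>, \<xi>)) t = f t"
    and RZ: "\<And>\<tau> t. 0 \<le> t \<Longrightarrow> t \<le> \<tau> \<Longrightarrow> \<tau> \<le> T \<Longrightarrow> trunc_conv T (jump g f) \<tau> (\<lambda>\<xi>. Z (\<tau>, \<xi>)) t = g t"
    and f: "\<And>t. 0 \<le> t \<Longrightarrow> t \<le> T \<Longrightarrow> f t = a t - (LINT u|leb T. (if u < t then f (t - u) ** X (t, u) else 0))"
    and g: "\<And>t. 0 \<le> t \<Longrightarrow> t \<le> T \<Longrightarrow>
      g t = conj_transpose (a t) - (LINT u|leb T. (if u < t then g (t - u) ** Z (t, u) else 0))"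
    and t: "0 \<le> t" "t \<le> T"
  shows "g t = conj_transpose (f t)"
proof -
  define d where "d s = f s - conj_transpose (g s)" for s
  note bi0 = bmeas_intros bmeas_comp[OF bm(1)] bmeas_comp[OF bm(2)] bmeas_comp[OF bm(3)] bmeas_comp[OF bm(4)]
  have bd: "bmeas d" unfolding d_def[abs_def] by (intro bi0 bm)
  define k where "k = jump f g"
  have bk: "bmeas k" unfolding k_def by (intro bmeas_jump bm)
  note bi = bi0 bmeas_comp[OF bd] bmeas_comp[OF bk]
  obtain C where C: "\<And>p. norm (X p) \<le> C" "\<And>p. norm (Z p) \<le> C" "0 \<le> C"
  proof -
    obtain A B where "\<And>p. norm (X p) \<le> A" "\<And>p. norm (Z p) \<le> B" "0 \<le> A"
      using bmeas_bound[OF bm(1)] bmeas_bound[OF bm(2)] by metis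
    then show ?thesis by (intro that[of "max A B"]) (auto simp: le_max_iff_disj)
  qed
  obtain D where D: "\<And>s. norm (d s) \<le> D" "0 \<le> D" using bd bmeas_bound by blast
  \<comment> \<open>If d vanished on (0, \<tau>), the kernel would be hermitian there, the adjoint
    of the reversed column Z would solve a row equation for k, and pairing it with X would make
    f(\<tau>) and the adjoint of g(\<tau>) equal. The three integrals measure the failure: the first
    comes from the asymmetry of k in the pairing, the others from replacing f by the adjoint of g in
    the two Volterra equations.\<close>
  have key: "d \<tau> = (LINT \<eta>|leb \<tau>. (LINT \<xi>|leb \<tau>. conj_transpose (Z (\<tau>, \<tau> - \<xi>)) **
        (conj_transpose (k (\<eta> - \<xi>)) - k (\<xi> - \<eta>))) ** X (\<tau>, \<eta>)) -
      (LINT s|leb \<tau>. conj_transpose (Z (\<tau>, \<tau> - s)) ** d s) - (LINT s|leb \<tau>. d (\<tau> - s) ** X (\<tau>, s))"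
    if \<tau>: "0 \<le> \<tau>" "\<tau> \<le> T" for \<tau>
  proof -
    define x where "x s = X (\<tau>, s)" for s
    define z where "z s = conj_transpose (Z (\<tau>, \<tau> - s))" for s
    have bx: "bmeas x" and bz: "bmeas z" unfolding x_def[abs_def] z_def[abs_def] by (intro bi)+
    note bi = bi bmeas_comp[OF bx] bmeas_comp[OF bz]
    define P where "P \<eta> = (LINT \<xi>|leb \<tau>. z \<xi> ** k (\<xi> - \<eta>))" for \<eta>
    define Q where "Q \<eta> = (LINT \<xi>|leb \<tau>. z \<xi> ** conj_transpose (k (\<eta> - \<xi>)))" for \<eta>
    have bP: "bmeas P" and bQ: "bmeas Q" unfolding P_def Q_def by (intro bi \<tau>)+
    note bi = bi bmeas_comp[OF bP] bmeas_comp[OF bQ]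
    have x_eq: "x s - (LINT \<eta>|leb \<tau>. k (s - \<eta>) ** x \<eta>) = f s" if "0 < s" "s < \<tau>" for s
      using RX[of s \<tau>] that \<tau> by (simp add: trunc_conv_leb x_def k_def)
    have z_eq: "conj_transpose (g (\<tau> - s)) = z s - Q s" if "0 < s" "s < \<tau>" for s
    proof -
      have "g (\<tau> - s) = trunc_conv T (jump g f) \<tau> (\<lambda>\<xi>. Z (\<tau>, \<xi>)) (\<tau> - s)"
        using that \<tau> by (intro RZ[symmetric]) auto
      also have "\<dots> = trunc_conv T k \<tau> (\<lambda>\<xi>. Z (\<tau>, \<tau> - \<xi>)) s"
        using \<tau> by (subst trunc_conv_reflect) (simp_all add: k_def jump_minus)
      also have "\<dots> = Z (\<tau>, \<tau> - s) - (LINT \<xi>|leb \<tau>. k (s - \<xi>) ** Z (\<tau>, \<tau> - \<xi>))"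
        using \<tau> by (simp add: trunc_conv_leb)
      finally show ?thesis
        unfolding z_def Q_def by (simp add: conj_transpose_diff flip: conj_transpose_mult)
          (rule LINT_conj_transpose[symmetric], intro bi)
    qed
    have f_eq: "f \<tau> = a \<tau> - (LINT s|leb \<tau>. f (\<tau> - s) ** x s)"
      using f[OF \<tau>] \<tau> by (simp add: LINT_leb_If x_def)
    have g_eq: "conj_transpose (g \<tau>) = a \<tau> - (LINT s|leb \<tau>. z s ** conj_transpose (g s))"
    proof -
      have "g \<tau> = conj_transpose (a \<tau>) - (LINT s|leb \<tau>. g (\<tau> - s) ** Z (\<tau>, s))"
        using g[OF \<tau>] \<tau> by (simp add: LINT_leb_If)
      also have "(LINT s|leb \<tau>. g (\<tau> - s) ** Z (\<tau>, s)) = (LINT s|leb \<tau>. g s ** Z (\<tau>, \<tau> - s))"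
        using LINT_leb_reflect[of \<tau> "\<lambda>s. g (\<tau> - s) ** Z (\<tau>, s)"] by simp
      finally show ?thesis
        unfolding z_def by (simp add: conj_transpose_diff flip: conj_transpose_mult)
          (rule LINT_conj_transpose[symmetric], intro bi)
    qed
    have i1: "(LINT \<eta>|leb \<tau>. (z \<eta> - P \<eta>) ** x \<eta>) = (LINT \<xi>|leb \<tau>. z \<xi> ** f \<xi>)"
      unfolding P_def pairing[OF \<tau>(1) bz bx bk] by (rule LINT_cong) (simp add: x_eq)
    have i2: "(LINT \<eta>|leb \<tau>. conj_transpose (g (\<tau> - \<eta>)) ** x \<eta>) = (LINT \<eta>|leb \<tau>. (z \<eta> - Q \<eta>) ** x \<eta>)"
      by (rule LINT_cong) (simp add: z_eq)
    have i3: "(LINT \<eta>|leb \<tau>. (z \<eta> - P \<eta>) ** x \<eta>) - (LINT \<eta>|leb \<tau>. (z \<eta> - Q \<eta>) ** x \<eta>) =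
        (LINT \<eta>|leb \<tau>. (Q \<eta> - P \<eta>) ** x \<eta>)"
      by (subst LINT_diff[symmetric], (intro bi)+, rule LINT_cong) (simp add: matrix_mult_diff_left)
    have i4: "(LINT s|leb \<tau>. z s ** d s) = (LINT s|leb \<tau>. z s ** f s) - (LINT s|leb \<tau>. z s ** conj_transpose (g s))"
      unfolding d_def matrix_mult_diff_right by (rule LINT_diff) (intro bi)+
    have i5: "(LINT s|leb \<tau>. d (\<tau> - s) ** x s) =
        (LINT s|leb \<tau>. f (\<tau> - s) ** x s) - (LINT s|leb \<tau>. conj_transpose (g (\<tau> - s)) ** x s)"
      unfolding d_def matrix_mult_diff_left by (rule LINT_diff) (intro bi)+
    have i6: "Q \<eta> - P \<eta> = (LINT \<xi>|leb \<tau>. z \<xi> ** (conj_transpose (k (\<eta> - \<xi>)) - k (\<xi> - \<eta>)))" for \<eta>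
      unfolding P_def Q_def matrix_mult_diff_right by (rule LINT_diff[symmetric]) (intro bi)+
    have i7: "d \<tau> = (LINT s|leb \<tau>. z s ** conj_transpose (g s)) - (LINT s|leb \<tau>. f (\<tau> - s) ** x s)"
      unfolding d_def by (subst f_eq, subst g_eq) simp
    have alg: "zg - fx = (zf - gx) - (zf - zg) - (fx - gx)" for zg fx zf gx :: "complex^'r^'r"
      by simp
    have "d \<tau> = (LINT \<eta>|leb \<tau>. (LINT \<xi>|leb \<tau>. z \<xi> ** (conj_transpose (k (\<eta> - \<xi>)) - k (\<xi> - \<eta>))) ** x \<eta>) -
      (LINT s|leb \<tau>. z s ** d s) - (LINT s|leb \<tau>. d (\<tau> - s) ** x s)"
      unfolding i6[symmetric] i3[symmetric] i1 i2[symmetric] i4 i5 i7 by (rule alg)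
    then show ?thesis unfolding x_def z_def .
  qed
  \<comment> \<open>The three terms of \<open>key\<close> add up to (2 C + 2 T C C) / \<mu> times
    the current bound; this choice makes the factor at most 1/2.\<close>
  define \<mu> where "\<mu> = 4 * C + 4 * T * C * C + 1"
  have \<mu>: "0 < \<mu>" using C(3) T by (simp add: \<mu>_def add_nonneg_pos)
  have "norm (d t) \<le> 0"
  proof (rule zero_by_halving[where D = "{0..T}" and e = "\<lambda>s. norm (d s)" and p = t and w = "\<lambda>s. exp (\<mu> * s)", OF _ D(2)])
    fix s assume "s \<in> {0..T}"
    then have "1 \<le> exp (\<mu> * s)" using \<mu> by auto
    then have "D * 1 \<le> D * exp (\<mu> * s)" using D by (intro mult_left_mono)
    then show "norm (d s) \<le> D * exp (\<mu> * s)" using D(1)[of s] by auto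
  next
    show "t \<in> {0..T}" using t by simp
    fix c \<tau> assume c: "0 \<le> c" and le: "\<And>s. s \<in> {0..T} \<Longrightarrow> norm (d s) \<le> c * exp (\<mu> * s)"
      and "\<tau> \<in> {0..T}"
    then have \<tau>: "0 \<le> \<tau>" "\<tau> \<le> T" by auto
    define E where "E = exp (\<mu> * \<tau>) / \<mu>"
    have E: "0 \<le> E" using \<mu> by (simp add: E_def)
    have 1: "norm (LINT s|leb \<tau>. conj_transpose (Z (\<tau>, \<tau> - s)) ** d s) \<le> C * c * exp (\<mu> * \<tau>) / \<mu>"
    proof (rule norm_LINT_exp_le[OF \<mu> _ \<tau>(1)])
      fix s assume s: "0 < s" "s < \<tau>"
      then have "norm (conj_transpose (Z (\<tau>, \<tau> - s)) ** d s) \<le> C * (c * exp (\<mu> * s))"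
        using C le[of s] \<tau> by (intro order_trans[OF norm_matrix_mult_le] mult_mono) auto
      then show "norm (conj_transpose (Z (\<tau>, \<tau> - s)) ** d s) \<le> (if s < \<tau> then C * c * exp (\<mu> * s) else 0)"
        using s by (simp add: mult_ac)
    qed (use C c in simp)
    have 2: "norm (LINT s|leb \<tau>. d (\<tau> - s) ** X (\<tau>, s)) \<le> C * c * exp (\<mu> * \<tau>) / \<mu>"
    proof (rule norm_LINT_exp_rev_le[OF \<mu> _ \<tau>(1) order_refl])
      fix s assume s: "0 < s" "s < \<tau>"
      then have "norm (d (\<tau> - s) ** X (\<tau>, s)) \<le> (c * exp (\<mu> * (\<tau> - s))) * C"
        using C c le[of "\<tau> - s"] \<tau> by (intro order_trans[OF norm_matrix_mult_le] mult_mono) auto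
      then show "norm (d (\<tau> - s) ** X (\<tau>, s)) \<le> (if s < \<tau> then C * c * exp (\<mu> * (\<tau> - s)) else 0)"
        using s by (simp add: mult_ac)
    qed (use C c in simp)
    \<comment> \<open>The sum of the two exponentials covers both sides of the diagonal by a bound
      free of \<eta>, so the outer integration contributes only the length \<tau>.\<close>
    have kd: "norm (conj_transpose (k (\<eta> - \<xi>)) - k (\<xi> - \<eta>)) \<le> c * exp (\<mu> * \<xi>) + c * exp (\<mu> * (\<tau> - \<xi>))"
      if "0 < \<eta>" "\<eta> < \<tau>" "0 < \<xi>" "\<xi> < \<tau>" for \<xi> \<eta>
    proof -
      consider "\<xi> < \<eta>" | "\<xi> = \<eta>" | "\<eta> < \<xi>" by linarith
      then show ?thesis
      proof cases
        case 1
        then have "conj_transpose (k (\<eta> - \<xi>)) - k (\<xi> - \<eta>) = conj_transpose (d (\<eta> - \<xi>))"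
          by (simp add: k_def jump_def d_def conj_transpose_diff)
        then have "norm (conj_transpose (k (\<eta> - \<xi>)) - k (\<xi> - \<eta>)) \<le> c * exp (\<mu> * (\<eta> - \<xi>))"
          using 1 that le[of "\<eta> - \<xi>"] \<tau> by simp
        also have "\<dots> \<le> c * exp (\<mu> * (\<tau> - \<xi>))" using that c \<mu> by (intro mult_left_mono) auto
        finally show ?thesis using c by (simp add: add_increasing)
      next
        case 2
        then show ?thesis using c by (simp add: k_def jump_def)
      next
        case 3
        then have "conj_transpose (k (\<eta> - \<xi>)) - k (\<xi> - \<eta>) = - d (\<xi> - \<eta>)"
          by (simp add: k_def jump_def d_def)
        then have "norm (conj_transpose (k (\<eta> - \<xi>)) - k (\<xi> - \<eta>)) \<le> c * exp (\<mu> * (\<xi> - \<eta>))"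
          using 3 that le[of "\<xi> - \<eta>"] \<tau> by simp
        also have "\<dots> \<le> c * exp (\<mu> * \<xi>)" using that c \<mu> by (intro mult_left_mono) auto
        finally show ?thesis using c by (simp add: add_increasing2)
      qed
    qed
    have inner: "norm (LINT \<xi>|leb \<tau>. conj_transpose (Z (\<tau>, \<tau> - \<xi>)) ** (conj_transpose (k (\<eta> - \<xi>)) - k (\<xi> - \<eta>))) \<le> 2 * C * c * E"
      if \<eta>: "0 < \<eta>" "\<eta> < \<tau>" for \<eta>
    proof -
      have ie: "integrable (leb \<tau>) (\<lambda>\<xi>. exp (\<mu> * \<xi>))" "integrable (leb \<tau>) (\<lambda>\<xi>. exp (\<mu> * (\<tau> - \<xi>)))"
        by (rule finite_measure.integrable_const_bound[OF finite_measure_leb, where B = "exp (\<mu> * \<tau>)"];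
            use \<mu> in \<open>auto intro!: AE_I2 measurable_restrict_space1\<close>)+
      have "norm (LINT \<xi>|leb \<tau>. conj_transpose (Z (\<tau>, \<tau> - \<xi>)) ** (conj_transpose (k (\<eta> - \<xi>)) - k (\<xi> - \<eta>)))
        \<le> (LINT \<xi>|leb \<tau>. C * c * exp (\<mu> * \<xi>) + C * c * exp (\<mu> * (\<tau> - \<xi>)))"
      proof (rule norm_LINT_le[OF \<tau>(1)])
        fix \<xi> assume "0 < \<xi>" "\<xi> < \<tau>"
        then have "norm (conj_transpose (Z (\<tau>, \<tau> - \<xi>)) ** (conj_transpose (k (\<eta> - \<xi>)) - k (\<xi> - \<eta>))) \<le>
            C * (c * exp (\<mu> * \<xi>) + c * exp (\<mu> * (\<tau> - \<xi>)))"
          using C kd[OF \<eta>] by (intro order_trans[OF norm_matrix_mult_le] mult_mono) auto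
        then show "norm (conj_transpose (Z (\<tau>, \<tau> - \<xi>)) ** (conj_transpose (k (\<eta> - \<xi>)) - k (\<xi> - \<eta>))) \<le>
            C * c * exp (\<mu> * \<xi>) + C * c * exp (\<mu> * (\<tau> - \<xi>))" by (simp add: algebra_simps)
      qed (use ie in auto)
      also have "\<dots> = C * c * (LINT \<xi>|leb \<tau>. exp (\<mu> * \<xi>)) + C * c * (LINT \<xi>|leb \<tau>. exp (\<mu> * (\<tau> - \<xi>)))"
        using ie by simp
      also have "\<dots> = C * c * (LINT \<xi>|leb \<tau>. exp (\<mu> * \<xi>)) + C * c * (LINT \<xi>|leb \<tau>. exp (\<mu> * \<xi>))"
        by (simp only: LINT_leb_reflect[of \<tau> "\<lambda>\<xi>. exp (\<mu> * \<xi>)"])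
      also have "\<dots> \<le> C * c * E + C * c * E"
        using C c LINT_exp_le[OF \<mu>, of \<tau>] by (intro add_mono mult_left_mono) (auto simp: E_def)
      finally show ?thesis by (simp add: mult_ac)
    qed
    have 3: "norm (LINT \<eta>|leb \<tau>. (LINT \<xi>|leb \<tau>. conj_transpose (Z (\<tau>, \<tau> - \<xi>)) **
        (conj_transpose (k (\<eta> - \<xi>)) - k (\<xi> - \<eta>))) ** X (\<tau>, \<eta>)) \<le> \<tau> * ((2 * C * c * E) * C)"
      using C c E by (intro norm_LINT_le_const \<tau>(1) order_trans[OF norm_matrix_mult_le] mult_mono inner) auto
    have "\<tau> * ((2 * C * c * E) * C) \<le> T * ((2 * C * c * E) * C)"
      using \<tau> C c E by (intro mult_right_mono) auto
    then have "norm (d \<tau>) \<le> T * ((2 * C * c * E) * C) + C * c * E + C * c * E"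
      using 1 2 3 unfolding key[OF \<tau>] E_def
      by (intro order_trans[OF norm_triangle_ineq4] add_mono) auto
    also have "\<dots> = (2 * C + 2 * T * C * C) / \<mu> * (c * exp (\<mu> * \<tau>))"
      by (simp add: E_def add_divide_distrib) (simp add: algebra_simps)
    also have "\<dots> \<le> 1 / 2 * (c * exp (\<mu> * \<tau>))"
      using C T c \<mu> by (intro mult_right_mono) (auto simp: \<mu>_def field_simps)
    finally show "norm (d \<tau>) \<le> c / 2 * exp (\<mu> * \<tau>)" by simp
  qed
  then show ?thesis by (simp add: d_def)
qed

section \<open>The resolvent kernel\<close>

text \<open>The kernel of \<open>(I + V)(I + V\<^sup>*) - I\<close> on \<open>(0, \<tau>)\<close>, where \<open>V\<close> is the upper triangular operator
  with kernel \<open>Z(s, s - t)\<close>.\<close>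

definition krein_kernel :: "real \<Rightarrow> (real \<times> real \<Rightarrow> complex^'r^'r) \<Rightarrow> real \<Rightarrow> real \<Rightarrow> real \<Rightarrow> complex^'r^'r" where
  "krein_kernel T Z \<tau> t s =
     (if t < s then Z (s, s - t) else if s < t then conj_transpose (Z (t, t - s)) else 0) +
     (LINT \<sigma>|leb T. (if t < \<sigma> \<and> s < \<sigma> \<and> \<sigma> < \<tau>
        then Z (\<sigma>, \<sigma> - t) ** conj_transpose (Z (\<sigma>, \<sigma> - s)) else 0))"

lemma bmeas_krein_kernel:
  assumes "bmeas Z" "0 \<le> T"
  shows "bmeas (\<lambda>p. krein_kernel T Z \<tau> (fst p) (snd p))"
  unfolding krein_kernel_def by (intro bmeas_intros bmeas_comp[OF assms(1)] assms(2))

lemma conj_transpose_krein_kernel: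
  assumes "bmeas Z"
  shows "conj_transpose (krein_kernel T Z \<tau> t s) = krein_kernel T Z \<tau> s t"
proof -
  have "conj_transpose (LINT \<sigma>|leb T. (if t < \<sigma> \<and> s < \<sigma> \<and> \<sigma> < \<tau>
        then Z (\<sigma>, \<sigma> - t) ** conj_transpose (Z (\<sigma>, \<sigma> - s)) else 0)) =
      (LINT \<sigma>|leb T. conj_transpose (if t < \<sigma> \<and> s < \<sigma> \<and> \<sigma> < \<tau>
        then Z (\<sigma>, \<sigma> - t) ** conj_transpose (Z (\<sigma>, \<sigma> - s)) else 0))"
    by (rule LINT_conj_transpose[symmetric]) (intro bmeas_intros bmeas_comp[OF assms])
  also have "\<dots> = (LINT \<sigma>|leb T. (if s < \<sigma> \<and> t < \<sigma> \<and> \<sigma> < \<tau>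
        then Z (\<sigma>, \<sigma> - s) ** conj_transpose (Z (\<sigma>, \<sigma> - t)) else 0))"
    by (rule LINT_cong) (simp add: conj_transpose_mult)
  finally show ?thesis by (simp add: krein_kernel_def conj_transpose_add)
qed

lemma norm_krein_kernel_le:
  assumes "0 \<le> T" "\<And>p. norm (Z p) \<le> C"
  shows "norm (krein_kernel T Z \<tau> t s) \<le> C + T * (C * C)"
proof -
  have C: "0 \<le> C" using assms(2)[of 0] norm_ge_zero order_trans by blast
  have "norm (LINT \<sigma>|leb T. (if t < \<sigma> \<and> s < \<sigma> \<and> \<sigma> < \<tau>
        then Z (\<sigma>, \<sigma> - t) ** conj_transpose (Z (\<sigma>, \<sigma> - s)) else 0)) \<le> T * (C * C)"
    using assms C by (intro norm_LINT_le_const)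
      (auto intro!: order_trans[OF norm_matrix_mult_le] mult_mono)
  then show ?thesis
    unfolding krein_kernel_def using assms(2) C by (intro order_trans[OF norm_triangle_ineq] add_mono) auto
qed

text \<open>By Krein's formula the residual does not depend on \<open>\<tau>\<close>.  For \<open>t < s\<close> it can therefore be
  evaluated at \<open>\<tau> = s\<close>, where it vanishes by assumption.  For \<open>t > s\<close>, pairing with the last row
  of the kernel shows that it solves a homogeneous Volterra equation in \<open>t\<close>.\<close>

lemma krein_kernel_resolvent:
  fixes k :: "real \<Rightarrow> complex^'r^'r"
  assumes T: "0 \<le> T" and Z: "bmeas Z" and k: "bmeas k"
    and herm: "\<And>u. k (- u) = conj_transpose (k u)"
    and eqn: "\<And>\<sigma> t. 0 \<le> t \<Longrightarrow> t < \<sigma> \<Longrightarrow> \<sigma> \<le> T \<Longrightarrow> trunc_conv T k \<sigma> (\<lambda>\<xi>. Z (\<sigma>, \<sigma> - \<xi>)) t = k (t - \<sigma>)"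
    and t: "0 \<le> t" "t \<le> \<tau>" and s: "0 \<le> s" "s \<le> \<tau>" and \<tau>: "\<tau> \<le> T" and neq: "t \<noteq> s"
  shows "trunc_conv T k \<tau> (\<lambda>\<xi>. krein_kernel T Z \<tau> \<xi> s) t = k (t - s)"
proof -
  have bK: "bmeas (\<lambda>\<xi>. krein_kernel T Z \<tau> \<xi> s)" for \<tau>
    using bmeas_comp[OF bmeas_krein_kernel[OF Z T, of \<tau>], of "\<lambda>\<xi>. (\<xi>, s)"] by simp
  note bi = bmeas_intros bmeas_comp[OF Z] bmeas_comp[OF k]
  have indep: "trunc_conv T k \<tau> (\<lambda>\<xi>. krein_kernel T Z \<tau> \<xi> s) t = trunc_conv T k \<rho> (\<lambda>\<xi>. krein_kernel T Z \<rho> \<xi> s) t"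
    if "0 \<le> t" "t \<le> \<rho>" "s \<le> \<rho>" "\<rho> \<le> \<tau>" "\<tau> \<le> T" for t \<rho> \<tau>
  proof -
    have "trunc_conv T k \<tau> (\<lambda>\<xi>. krein_kernel T Z \<tau> \<xi> s) t - trunc_conv T k \<rho> (\<lambda>\<xi>. krein_kernel T Z \<rho> \<xi> s) t =
      (LINT \<sigma>|leb T. (if \<rho> < \<sigma> \<and> \<sigma> < \<tau>
       then (trunc_conv T k \<sigma> (\<lambda>\<xi>. (\<lambda>p. Z (fst p, fst p - snd p)) (\<sigma>, \<xi>)) t - k (t - \<sigma>)) ** conj_transpose (Z (\<sigma>, \<sigma> - s)) else 0))"
    \<comment> \<open>The column of the kernel grows with \<tau> as Krein's formula demands, with
      boundary values \<open>b \<xi>\<close> equal to the adjoint of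
      \<open>Z (\<xi>, \<xi> - s)\<close>. The integrand then contains the residual of
      \<open>eqn\<close> as a factor and vanishes.\<close>
    proof (rule krein_formula[OF T that(4,2) k _ _ bK])
      fix \<xi>
      show "krein_kernel T Z \<tau> \<xi> s = (if \<xi> \<le> \<rho> then krein_kernel T Z \<rho> \<xi> s else conj_transpose (Z (\<xi>, \<xi> - s))) +
        (LINT \<sigma>|leb T. (if \<rho> < \<sigma> \<and> \<xi> < \<sigma> \<and> \<sigma> < \<tau>
          then (\<lambda>p. Z (fst p, fst p - snd p)) (\<sigma>, \<xi>) ** conj_transpose (Z (\<sigma>, \<sigma> - s)) else 0))"
      proof (cases "\<xi> \<le> \<rho>")
        case True
        have "(LINT \<sigma>|leb T. (if \<xi> < \<sigma> \<and> s < \<sigma> \<and> \<sigma> < \<tau>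
            then Z (\<sigma>, \<sigma> - \<xi>) ** conj_transpose (Z (\<sigma>, \<sigma> - s)) else 0)) =
          (LINT \<sigma>|leb T. (if \<xi> < \<sigma> \<and> s < \<sigma> \<and> \<sigma> < \<rho>
            then Z (\<sigma>, \<sigma> - \<xi>) ** conj_transpose (Z (\<sigma>, \<sigma> - s)) else 0) +
          (if \<rho> < \<sigma> \<and> \<xi> < \<sigma> \<and> \<sigma> < \<tau>
            then Z (\<sigma>, \<sigma> - \<xi>) ** conj_transpose (Z (\<sigma>, \<sigma> - s)) else 0))"
          by (rule LINT_cong_except[where r = \<rho>]) (((intro bi)+)[2], use that in auto)
        also have "\<dots> = (LINT \<sigma>|leb T. (if \<xi> < \<sigma> \<and> s < \<sigma> \<and> \<sigma> < \<rho>
            then Z (\<sigma>, \<sigma> - \<xi>) ** conj_transpose (Z (\<sigma>, \<sigma> - s)) else 0)) +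
          (LINT \<sigma>|leb T. (if \<rho> < \<sigma> \<and> \<xi> < \<sigma> \<and> \<sigma> < \<tau>
            then Z (\<sigma>, \<sigma> - \<xi>) ** conj_transpose (Z (\<sigma>, \<sigma> - s)) else 0))"
          by (rule LINT_add) (intro bi)+
        finally show ?thesis using True unfolding fst_conv snd_conv by (simp add: krein_kernel_def)
      next
        case False
        have "(LINT \<sigma>|leb T. (if \<xi> < \<sigma> \<and> s < \<sigma> \<and> \<sigma> < \<tau>
            then Z (\<sigma>, \<sigma> - \<xi>) ** conj_transpose (Z (\<sigma>, \<sigma> - s)) else 0)) =
          (LINT \<sigma>|leb T. (if \<rho> < \<sigma> \<and> \<xi> < \<sigma> \<and> \<sigma> < \<tau>
            then Z (\<sigma>, \<sigma> - \<xi>) ** conj_transpose (Z (\<sigma>, \<sigma> - s)) else 0))"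
          using False that by (intro LINT_cong) auto
        then show ?thesis using False that unfolding fst_conv snd_conv by (simp add: krein_kernel_def)
      qed
    qed (intro bi)+
    also have "\<dots> = (LINT \<sigma>|leb T. 0)"
      by (rule LINT_cong) (use that eqn in simp)
    finally show ?thesis by simp
  qed
  have upper: "trunc_conv T k \<tau> (\<lambda>\<xi>. krein_kernel T Z \<tau> \<xi> s) t = k (t - s)"
    if "0 \<le> t" "t < s" "s \<le> \<tau>" "\<tau> \<le> T" for t \<tau>
  proof -
    have *: "krein_kernel T Z s \<xi> s = Z (s, s - \<xi>)" if "\<xi> < s" for \<xi>
    proof -
      have "(LINT \<sigma>|leb T. (if \<xi> < \<sigma> \<and> s < \<sigma> \<and> \<sigma> < s
        then Z (\<sigma>, \<sigma> - \<xi>) ** conj_transpose (Z (\<sigma>, \<sigma> - s)) else 0)) = (LINT \<sigma>|leb T. 0)"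
        by (rule LINT_cong) auto
      then show ?thesis using that by (simp add: krein_kernel_def)
    qed
    have "trunc_conv T k \<tau> (\<lambda>\<xi>. krein_kernel T Z \<tau> \<xi> s) t = trunc_conv T k s (\<lambda>\<xi>. krein_kernel T Z s \<xi> s) t"
      using that by (intro indep) auto
    also have "\<dots> = trunc_conv T k s (\<lambda>\<xi>. Z (s, s - \<xi>)) t"
      unfolding trunc_conv_def using that(2) by (intro arg_cong2[where f = "(-)"] LINT_cong) (auto simp: *)
    also have "\<dots> = k (t - s)" using that by (intro eqn) auto
    finally show ?thesis .
  qed
  \<comment> \<open>By \<open>indep\<close> this is the residual at (t, s) for every larger \<tau>
    as well, so a function of t alone suffices for fixed s.\<close>
  define G where "G t = trunc_conv T k t (\<lambda>\<xi>. krein_kernel T Z t \<xi> s) t - k (t - s)" for t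
  obtain C where C: "\<And>p. norm (Z p) \<le> C" "0 \<le> C" using bmeas_bound[OF Z] by blast
  obtain K where K: "\<And>u. norm (k u) \<le> K" "0 \<le> K" using bmeas_bound[OF k] by blast
  define B where "B = (C + T * (C * C)) + T * (K * (C + T * (C * C))) + K"
  have B: "norm (G t) \<le> B" for t
    unfolding G_def B_def
    by (intro order_trans[OF norm_triangle_ineq4] add_mono norm_trunc_conv_le norm_krein_kernel_le T C K)
  have B0: "0 \<le> B" using B norm_ge_zero order_trans by blast
  define \<mu> where "\<mu> = 2 * (C + 1)"
  have \<mu>: "0 < \<mu>" using C by (simp add: \<mu>_def)
  have lower: "norm (G t) \<le> 0" if "s < t" "t \<le> T" for t
  proof (rule zero_by_halving[where D = "{s<..T}" and e = "\<lambda>t. norm (G t)" and p = t and w = "\<lambda>t. exp (\<mu> * t)", OF _ B0])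
    show "t \<in> {s<..T}" using that by simp
    fix t assume "t \<in> {s<..T}"
    then have "1 \<le> exp (\<mu> * t)" using \<mu> s by auto
    then have "B * 1 \<le> B * exp (\<mu> * t)" using B0 by (intro mult_left_mono)
    then show "norm (G t) \<le> B * exp (\<mu> * t)" using B[of t] by auto
  next
    fix c \<tau> assume c: "0 \<le> c" and le: "\<And>t. t \<in> {s<..T} \<Longrightarrow> norm (G t) \<le> c * exp (\<mu> * t)" and "\<tau> \<in> {s<..T}"
    then have \<tau>: "s < \<tau>" "\<tau> \<le> T" "0 \<le> \<tau>" using s by auto
    \<comment> \<open>The last row of the kernel: at t = \<tau> the integral over \<sigma> is empty,
      and only this term remains for \<xi> < \<tau>.\<close>
    define p where "p \<xi> = conj_transpose (Z (\<tau>, \<tau> - \<xi>))" for \<xi>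
    define y where "y \<xi> = krein_kernel T Z \<tau> \<xi> s" for \<xi>
    have bp: "bmeas p" unfolding p_def by (intro bi)
    have b_y: "bmeas y" unfolding y_def by (rule bK)
    note bi = bi bmeas_comp[OF bp] bmeas_comp[OF b_y]
    define W where "W \<xi> = y \<xi> - (LINT \<eta>|leb \<tau>. k (\<xi> - \<eta>) ** y \<eta>)" for \<xi>
    have bW: "bmeas W" unfolding W_def by (intro bi \<tau>)
    note bi = bi bmeas_comp[OF bW]
    have W: "W \<xi> = trunc_conv T k \<tau> (\<lambda>\<xi>. krein_kernel T Z \<tau> \<xi> s) \<xi>" for \<xi>
      using \<tau> by (simp add: W_def y_def trunc_conv_leb)
    \<comment> \<open>The adjoint of \<open>eqn\<close>; hermitian symmetry of k turns the column
      equation into a row equation.\<close>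
    have p_eq: "p \<eta> - (LINT \<xi>|leb \<tau>. p \<xi> ** k (\<xi> - \<eta>)) = k (\<tau> - \<eta>)" if "0 \<le> \<eta>" "\<eta> < \<tau>" for \<eta>
    proof -
      have "k (\<tau> - \<eta>) = conj_transpose (k (\<eta> - \<tau>))" using herm[of "\<eta> - \<tau>"] by simp
      also have "k (\<eta> - \<tau>) = Z (\<tau>, \<tau> - \<eta>) - (LINT \<xi>|leb \<tau>. k (\<eta> - \<xi>) ** Z (\<tau>, \<tau> - \<xi>))"
        using eqn[OF that \<tau>(2)] \<tau> by (simp add: trunc_conv_leb)
      also have "conj_transpose \<dots> = p \<eta> - (LINT \<xi>|leb \<tau>. conj_transpose (k (\<eta> - \<xi>) ** Z (\<tau>, \<tau> - \<xi>)))"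
        unfolding conj_transpose_diff p_def by (subst LINT_conj_transpose) (intro bi refl)+
      also have "\<dots> = p \<eta> - (LINT \<xi>|leb \<tau>. p \<xi> ** k (\<xi> - \<eta>))"
        using herm[of "\<eta> - _"] by (simp add: conj_transpose_mult p_def)
      finally show ?thesis ..
    qed
    have y\<tau>: "y \<tau> = p s"
    proof -
      have "(LINT \<sigma>|leb T. (if \<tau> < \<sigma> \<and> s < \<sigma> \<and> \<sigma> < \<tau>
        then Z (\<sigma>, \<sigma> - \<tau>) ** conj_transpose (Z (\<sigma>, \<sigma> - s)) else 0)) = (LINT \<sigma>|leb T. 0)"
        by (rule LINT_cong) auto
      then show ?thesis using \<tau> by (simp add: y_def p_def krein_kernel_def)
    qed
    have "(LINT \<eta>|leb \<tau>. k (\<tau> - \<eta>) ** y \<eta>) = (LINT \<eta>|leb \<tau>. (p \<eta> - (LINT \<xi>|leb \<tau>. p \<xi> ** k (\<xi> - \<eta>))) ** y \<eta>)"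
      by (rule LINT_cong) (simp add: p_eq)
    also have "\<dots> = (LINT \<xi>|leb \<tau>. p \<xi> ** W \<xi>)"
      unfolding W_def by (rule pairing[OF \<tau>(3) bp b_y k])
    finally have "G \<tau> = (LINT \<xi>|leb \<tau>. p \<xi> ** k (\<xi> - s)) - (LINT \<xi>|leb \<tau>. p \<xi> ** W \<xi>)"
      using p_eq[OF s(1) \<tau>(1)] y\<tau> \<tau> by (simp add: G_def trunc_conv_leb y_def[symmetric] algebra_simps)
    also have "\<dots> = (LINT \<xi>|leb \<tau>. p \<xi> ** k (\<xi> - s) - p \<xi> ** W \<xi>)"
      by (rule LINT_diff[symmetric]) (intro bi)+
    \<comment> \<open>Below s the residual of the column vanishes by \<open>upper\<close>. What is
      left is the homogeneous equation in which G(\<tau>) is minus the integral of p G over (s,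
      \<tau>).\<close>
    also have "\<dots> = (LINT \<xi>|leb \<tau>. (if s < \<xi> then - (p \<xi> ** (W \<xi> - k (\<xi> - s))) else 0))"
    proof (rule LINT_cong_except[where r = s])
      fix \<xi> assume \<xi>: "0 < \<xi>" "\<xi> < \<tau>" "\<xi> \<noteq> s"
      have "W \<xi> = k (\<xi> - s)" if "\<xi> < s"
        unfolding W using that \<xi> \<tau> by (intro upper) auto
      then show "p \<xi> ** k (\<xi> - s) - p \<xi> ** W \<xi> = (if s < \<xi> then - (p \<xi> ** (W \<xi> - k (\<xi> - s))) else 0)"
        using \<xi> by (auto simp: matrix_mult_diff_right)
    next
      have "(if s < \<xi> then - (p \<xi> ** (W \<xi> - k (\<xi> - s))) else 0) =
          (if s < \<xi> then 0 - p \<xi> ** (W \<xi> - k (\<xi> - s)) else 0)" for \<xi> by simp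
      moreover have "bmeas (\<lambda>\<xi>. if s < \<xi> then 0 - p \<xi> ** (W \<xi> - k (\<xi> - s)) else 0)" by (intro bi)
      ultimately show "bmeas (\<lambda>\<xi>. if s < \<xi> then - (p \<xi> ** (W \<xi> - k (\<xi> - s))) else 0)" by simp
    qed (intro bi)
    finally have G: "G \<tau> = \<dots>" .
    have "norm (G \<tau>) \<le> C * c * exp (\<mu> * \<tau>) / \<mu>"
      unfolding G
    proof (rule norm_LINT_exp_le[OF \<mu> _ \<tau>(3)])
      fix \<xi> assume \<xi>: "0 < \<xi>" "\<xi> < \<tau>"
      show "norm (if s < \<xi> then - (p \<xi> ** (W \<xi> - k (\<xi> - s))) else 0) \<le> (if \<xi> < \<tau> then C * c * exp (\<mu> * \<xi>) else 0)"
      proof (cases "s < \<xi>")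
        case True
        have "W \<xi> - k (\<xi> - s) = G \<xi>"
          unfolding W G_def using True \<xi> \<tau> by (subst indep[of \<xi> \<xi> \<tau>]) auto
        moreover have "norm (p \<xi> ** G \<xi>) \<le> C * (c * exp (\<mu> * \<xi>))"
          using C le[of \<xi>] True \<xi> \<tau> by (intro order_trans[OF norm_matrix_mult_le] mult_mono) (auto simp: p_def)
        ultimately show ?thesis using True \<xi> by (simp add: mult_ac)
      qed (use C c in auto)
    qed (use C c in simp)
    also have "\<dots> = C / \<mu> * (c * exp (\<mu> * \<tau>))" by simp
    also have "\<dots> \<le> 1 / 2 * (c * exp (\<mu> * \<tau>))"
      using C c by (intro mult_right_mono) (auto simp: \<mu>_def field_simps)
    finally show "norm (G \<tau>) \<le> c / 2 * exp (\<mu> * \<tau>)" by simp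
  qed
  show ?thesis
  proof (cases "t < s")
    case True
    then show ?thesis using t s \<tau> by (intro upper) auto
  next
    case False
    then have "G t = 0" using lower[of t] neq t \<tau> by simp
    moreover have "trunc_conv T k \<tau> (\<lambda>\<xi>. krein_kernel T Z \<tau> \<xi> s) t = trunc_conv T k t (\<lambda>\<xi>. krein_kernel T Z t \<xi> s) t"
      using False t s \<tau> by (intro indep) auto
    ultimately show ?thesis by (simp add: G_def)
  qed
qed

text \<open>The adjoint of the column equation, since both k and the kernel are hermitian. The
  column equation yields a right inverse of \<open>T\<^sub>\<tau>\<close>, this one a left inverse;
  uniqueness also relies on the row form.\<close>

lemma krein_kernel_resolvent_row:
  fixes k :: "real \<Rightarrow> complex^'r^'r"
  assumes T: "0 \<le> T" and Z: "bmeas Z" and k: "bmeas k"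
    and herm: "\<And>u. k (- u) = conj_transpose (k u)"
    and eqn: "\<And>\<sigma> t. 0 \<le> t \<Longrightarrow> t < \<sigma> \<Longrightarrow> \<sigma> \<le> T \<Longrightarrow> trunc_conv T k \<sigma> (\<lambda>\<xi>. Z (\<sigma>, \<sigma> - \<xi>)) t = k (t - \<sigma>)"
    and t: "0 \<le> t" "t \<le> \<tau>" and s: "0 \<le> s" "s \<le> \<tau>" and \<tau>: "\<tau> \<le> T" and neq: "t \<noteq> s"
  shows "krein_kernel T Z \<tau> t s - (LINT \<xi>|leb \<tau>. krein_kernel T Z \<tau> t \<xi> ** k (\<xi> - s)) = k (t - s)"
proof -
  have bK: "bmeas (\<lambda>\<xi>. krein_kernel T Z \<tau> \<xi> t)"
    using bmeas_comp[OF bmeas_krein_kernel[OF Z T, of \<tau>], of "\<lambda>\<xi>. (\<xi>, t)"] by simp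
  have "k (t - s) = conj_transpose (k (s - t))" using herm[of "s - t"] by simp
  also have "k (s - t) = krein_kernel T Z \<tau> s t - (LINT \<xi>|leb \<tau>. k (s - \<xi>) ** krein_kernel T Z \<tau> \<xi> t)"
    using krein_kernel_resolvent[OF T Z k herm eqn s t \<tau>] neq \<tau> by (simp add: trunc_conv_leb)
  also have "conj_transpose \<dots> = krein_kernel T Z \<tau> t s -
      (LINT \<xi>|leb \<tau>. conj_transpose (k (s - \<xi>) ** krein_kernel T Z \<tau> \<xi> t))"
    unfolding conj_transpose_diff conj_transpose_krein_kernel[OF Z]
    by (subst LINT_conj_transpose) (intro bmeas_intros bmeas_comp[OF k] bK refl)+
  also have "\<dots> = krein_kernel T Z \<tau> t s - (LINT \<xi>|leb \<tau>. krein_kernel T Z \<tau> t \<xi> ** k (\<xi> - s))"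
    using herm[of "s - _"] by (simp add: conj_transpose_mult conj_transpose_krein_kernel[OF Z])
  finally show ?thesis ..
qed

text \<open>The jump across the diagonal sits entirely in the first summand of the kernel, and each
  open triangle sees a single branch of it. The integral is continuous on the whole plane.\<close>

lemma krein_kernel_extends:
  fixes Z :: "real \<times> real \<Rightarrow> complex^'r^'r"
  assumes T: "0 \<le> T" and Z: "continuous_on UNIV Z" "bounded (range Z)"
  shows "extends_continuously_to_closure {(t, s). 0 \<le> s \<and> s < t \<and> t \<le> \<tau>} (krein_kernel T Z \<tau>)"
    and "extends_continuously_to_closure {(t, s). 0 \<le> t \<and> t < s \<and> s \<le> \<tau>} (krein_kernel T Z \<tau>)"
proof -
  note bZ = bmeas_continuous[OF Z]
  define J where "J p = (LINT \<sigma>|leb T. (if fst p < \<sigma> \<and> snd p < \<sigma> \<and> \<sigma> < \<tau>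
        then Z (\<sigma>, \<sigma> - fst p) ** conj_transpose (Z (\<sigma>, \<sigma> - snd p)) else 0))" for p
  have J_pair: "J (t, s) = (LINT \<sigma>|leb T. (if t < \<sigma> \<and> s < \<sigma> \<and> \<sigma> < \<tau>
        then Z (\<sigma>, \<sigma> - t) ** conj_transpose (Z (\<sigma>, \<sigma> - s)) else 0))" for t s
    unfolding J_def fst_conv snd_conv ..
  have conj_if: "(if P \<and> Q \<and> R then x else y) = (if P then if Q then if R then x else y else y else y)"
    for P Q R and x y :: "complex^'r^'r" by simp
  have J: "continuous_on UNIV J"
    unfolding J_def
  proof (rule continuous_LINT)
    fix p :: "real \<times> real"
    have "AE \<sigma> in lborel. \<sigma> \<noteq> fst p" "AE \<sigma> in lborel. \<sigma> \<noteq> snd p" by (rule AE_lborel_singleton)+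
    then show "AE \<sigma> in lborel. isCont (\<lambda>p. if fst p < \<sigma> \<and> snd p < \<sigma> \<and> \<sigma> < \<tau>
        then Z (\<sigma>, \<sigma> - fst p) ** conj_transpose (Z (\<sigma>, \<sigma> - snd p)) else 0) p"
    proof eventually_elim
      case (elim \<sigma>)
      have "continuous_on UNIV (\<lambda>p::real \<times> real. Z (\<sigma>, \<sigma> - fst p) ** conj_transpose (Z (\<sigma>, \<sigma> - snd p)))"
        by (intro bounded_bilinear.continuous_on[OF bounded_bilinear_matrix_mult]
            bounded_linear.continuous_on[OF bounded_linear_conj_transpose]
            continuous_on_compose2[OF Z(1)] continuous_intros) auto
      then have "isCont (\<lambda>p. Z (\<sigma>, \<sigma> - fst p) ** conj_transpose (Z (\<sigma>, \<sigma> - snd p))) p"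
        using continuous_on_eq_continuous_at[OF open_UNIV] by blast
      then have inner: "isCont (\<lambda>p. if \<sigma> < \<tau> then Z (\<sigma>, \<sigma> - fst p) ** conj_transpose (Z (\<sigma>, \<sigma> - snd p)) else 0) p"
        by (cases "\<sigma> < \<tau>") auto
      show ?case unfolding conj_if
        by (rule isCont_If_less, rule isCont_If_less, rule inner)
          (rule continuous_const continuous_fst[OF continuous_ident] continuous_snd[OF continuous_ident]
            elim(1)[symmetric] elim(2)[symmetric])+
    qed
  qed (intro bmeas_intros bmeas_comp[OF bZ])
  show "extends_continuously_to_closure {(t, s). 0 \<le> s \<and> s < t \<and> t \<le> \<tau>} (krein_kernel T Z \<tau>)"
    unfolding extends_continuously_to_closure_def
  proof (intro exI conjI)
    show "continuous_on (closure {(t, s). 0 \<le> s \<and> s < t \<and> t \<le> \<tau>})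
        (\<lambda>p. conj_transpose (Z (fst p, fst p - snd p)) + J p)"
      by (rule continuous_on_subset[OF _ subset_UNIV], intro continuous_intros J
          bounded_linear.continuous_on[OF bounded_linear_conj_transpose] continuous_on_compose2[OF Z(1)]) auto
  qed (auto simp: krein_kernel_def J_pair)
  show "extends_continuously_to_closure {(t, s). 0 \<le> t \<and> t < s \<and> s \<le> \<tau>} (krein_kernel T Z \<tau>)"
    unfolding extends_continuously_to_closure_def
  proof (intro exI conjI)
    show "continuous_on (closure {(t, s). 0 \<le> t \<and> t < s \<and> s \<le> \<tau>})
        (\<lambda>p. Z (snd p, snd p - fst p) + J p)"
      by (rule continuous_on_subset[OF _ subset_UNIV], intro continuous_intros J continuous_on_compose2[OF Z(1)]) auto
  qed (auto simp: krein_kernel_def J_pair)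
qed

section \<open>Integral operators on the space of square integrable functions\<close>

lemma Pair_borel_measurable:
  "Pair (t::'a::topological_space) \<in> borel_measurable (borel :: 'b::topological_space measure)"
  using borel_measurable_continuous_onI[OF continuous_on_Pair[OF continuous_on_const continuous_on_id]] .

text \<open>Covers both \<open>T\<^sub>\<tau>\<close>, with kernel -k, and its inverse, with kernel
  \<gamma>, so boundedness and composition are treated once.\<close>

definition kernel_operator ::
    "real \<Rightarrow> (real \<times> real \<Rightarrow> complex^'r^'r) \<Rightarrow> (real \<Rightarrow> complex^'r) \<Rightarrow> real \<Rightarrow> complex^'r" where
  "kernel_operator \<tau> \<kappa> f t = f t + (LINT s|leb \<tau>. \<kappa> (t, s) *v f s)"

lemma L2_measurable: "f \<in> L2 \<tau> \<Longrightarrow> f \<in> borel_measurable (leb \<tau>)"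
  and L2_square_integrable: "f \<in> L2 \<tau> \<Longrightarrow> integrable (leb \<tau>) (\<lambda>t. (norm (f t))\<^sup>2)"
  by (simp_all add: L2_def)

lemma L2_integrable:
  assumes "f \<in> L2 \<tau>" shows "integrable (leb \<tau>) f"
proof (rule Bochner_Integration.integrable_bound)
  show "integrable (leb \<tau>) (\<lambda>t. 1 + (norm (f t))\<^sup>2)"
    using L2_square_integrable[OF assms] bmeas_integrable[OF bmeas_const] by (intro Bochner_Integration.integrable_add)
  have "x \<le> 1 + x\<^sup>2" for x :: real
    using zero_le_power2[of "x - 1 / 2"] by (simp add: power2_eq_square algebra_simps)
  then show "AE t in leb \<tau>. norm (f t) \<le> norm (1 + (norm (f t))\<^sup>2)"
    by (intro AE_I2) (simp add: abs_of_nonneg)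
qed (rule L2_measurable[OF assms])

lemma L2_norm_square:
  assumes "f \<in> L2 \<tau>" shows "(L2_norm \<tau> f)\<^sup>2 = (LINT t|leb \<tau>. (norm (f t))\<^sup>2)"
  by (simp add: L2_norm_def)

text \<open>Cauchy-Schwarz against the constant 1, obtained from the nonnegativity of the variance
  about the mean \<open>m\<close>.\<close>

lemma L1_le_L2:
  assumes f: "f \<in> L2 \<tau>" and \<tau>: "0 < \<tau>"
  shows "(LINT t|leb \<tau>. norm (f t))\<^sup>2 \<le> \<tau> * (L2_norm \<tau> f)\<^sup>2"
proof -
  define m where "m = (LINT t|leb \<tau>. norm (f t)) / \<tau>"
  have i: "integrable (leb \<tau>) (\<lambda>t. norm (f t))" "integrable (leb \<tau>) (\<lambda>t. (norm (f t))\<^sup>2)" "integrable (leb \<tau>) (\<lambda>t. m\<^sup>2)"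
    using L2_integrable[OF f] L2_square_integrable[OF f] bmeas_integrable[OF bmeas_const] by auto
  have "0 \<le> (LINT t|leb \<tau>. (norm (f t) - m)\<^sup>2)" by simp
  also have "\<dots> = (LINT t|leb \<tau>. (norm (f t))\<^sup>2 - 2 * m * norm (f t) + m\<^sup>2)"
    by (rule LINT_cong) (simp add: power2_eq_square algebra_simps)
  also have "\<dots> = (L2_norm \<tau> f)\<^sup>2 - 2 * m * (\<tau> * m) + \<tau> * m\<^sup>2"
    using i \<tau> measure_leb[of \<tau>] unfolding L2_norm_square[OF f] by (simp add: m_def)
  finally have "\<tau> * m\<^sup>2 \<le> (L2_norm \<tau> f)\<^sup>2" by (simp add: power2_eq_square algebra_simps)
  then have "\<tau> * (\<tau> * m\<^sup>2) \<le> \<tau> * (L2_norm \<tau> f)\<^sup>2" using \<tau> by (intro mult_left_mono) auto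
  then show ?thesis using \<tau> by (simp add: m_def power2_eq_square)
qed

lemma kernel_apply_measurable:
  fixes f :: "real \<Rightarrow> complex^'r" and \<kappa> :: "real \<times> real \<Rightarrow> complex^'r^'r"
  assumes \<kappa>: "bmeas \<kappa>" and f: "f \<in> borel_measurable (leb \<tau>)"
  shows "(\<lambda>p. \<kappa> p *v f (snd p)) \<in> borel_measurable (leb \<sigma> \<Otimes>\<^sub>M leb \<tau>)"
proof -
  have "(\<lambda>p. (\<lambda>q. fst q *v snd q) (\<kappa> p, f (snd p))) \<in> borel_measurable (leb \<sigma> \<Otimes>\<^sub>M leb \<tau>)"
    by (rule borel_measurable_continuous_Pair[OF bmeas_pair_leb[OF \<kappa>] measurable_compose[OF measurable_snd f]])
      (intro bounded_bilinear.continuous_on[OF bounded_bilinear_matrix_vector_mult] continuous_intros)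
  then show ?thesis by simp
qed

lemma kernel_slice_integrable:
  fixes f :: "real \<Rightarrow> complex^'r" and \<kappa> :: "real \<times> real \<Rightarrow> complex^'r^'r"
  assumes \<kappa>: "\<And>p. norm (\<kappa> p) \<le> C" "bmeas \<kappa>" and f: "f \<in> L2 \<tau>"
  shows "integrable (leb \<tau>) (\<lambda>s. \<kappa> (t, s) *v f s)"
proof (rule Bochner_Integration.integrable_bound)
  show "integrable (leb \<tau>) (\<lambda>s. C * norm (f s))" using L2_integrable[OF f] by auto
  have "bmeas (\<lambda>s. \<kappa> (t, s))" by (rule bmeas_comp[OF \<kappa>(2) Pair_borel_measurable])
  then have "(\<lambda>s. (\<lambda>q. fst q *v snd q) (\<kappa> (t, s), f s)) \<in> borel_measurable (leb \<tau>)"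
    by (rule borel_measurable_continuous_Pair[OF bmeas_leb L2_measurable[OF f]])
      (intro bounded_bilinear.continuous_on[OF bounded_bilinear_matrix_vector_mult] continuous_intros)
  then show "(\<lambda>s. \<kappa> (t, s) *v f s) \<in> borel_measurable (leb \<tau>)" by simp
  have "norm (\<kappa> (t, s) *v f s) \<le> C * norm (f s)" for s
    by (intro order_trans[OF norm_matrix_vector_mult_le] mult_right_mono \<kappa>) auto
  then show "AE s in leb \<tau>. norm (\<kappa> (t, s) *v f s) \<le> norm (C * norm (f s))"
    unfolding real_norm_def by (intro AE_I2) (rule order_trans[OF _ abs_ge_self])
qed

lemma kernel_integral_measurable:
  fixes f :: "real \<Rightarrow> complex^'r" and \<kappa> :: "real \<times> real \<Rightarrow> complex^'r^'r"
  assumes \<kappa>: "bmeas \<kappa>" and f: "f \<in> L2 \<tau>"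
  shows "(\<lambda>t. LINT s|leb \<tau>. \<kappa> (t, s) *v f s) \<in> borel_measurable (leb \<tau>)"
  by (rule sigma_finite_measure.borel_measurable_lebesgue_integral[OF sigma_finite_leb])
    (use kernel_apply_measurable[OF \<kappa> L2_measurable[OF f], of \<tau>] in \<open>simp add: case_prod_beta'\<close>)

lemma norm_kernel_integral_le:
  fixes f :: "real \<Rightarrow> complex^'r" and \<kappa> :: "real \<times> real \<Rightarrow> complex^'r^'r"
  assumes \<kappa>: "\<And>p. norm (\<kappa> p) \<le> C" "bmeas \<kappa>" and f: "f \<in> L2 \<tau>" and \<tau>: "0 < \<tau>"
  shows "norm (LINT s|leb \<tau>. \<kappa> (t, s) *v f s) \<le> C * (LINT s|leb \<tau>. norm (f s))"
proof -
  have "norm (LINT s|leb \<tau>. \<kappa> (t, s) *v f s) \<le> (LINT s|leb \<tau>. C * norm (f s))"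
    using L2_integrable[OF f] \<kappa> \<tau>
    by (intro norm_LINT_le) (auto intro!: order_trans[OF norm_matrix_vector_mult_le] mult_right_mono)
  then show ?thesis by simp
qed

lemma L2_bounded_kernel_operator:
  fixes \<kappa> :: "real \<times> real \<Rightarrow> complex^'r^'r"
  assumes \<kappa>: "bmeas \<kappa>" and \<tau>: "0 < \<tau>"
  shows "L2_bounded_operator \<tau> (kernel_operator \<tau> \<kappa>)"
proof -
  obtain C where C: "\<And>p. norm (\<kappa> p) \<le> C" "0 \<le> C" using bmeas_bound[OF \<kappa>] by blast
  \<comment> \<open>Squares are separated by (x + y)^2 \<le> 2 x^2 + 2 y^2, and
    \<open>L1_le_L2\<close> bounds the integral part. That part is constant in t, so integrating
    gives a second factor \<tau>; hence the operator bound
    \<open>sqrt (2 + 2 * C\<^sup>2 * \<tau>\<^sup>2)\<close>.\<close>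
  have pointwise: "(norm (kernel_operator \<tau> \<kappa> f t))\<^sup>2 \<le> 2 * (norm (f t))\<^sup>2 + 2 * (C\<^sup>2 * (\<tau> * (L2_norm \<tau> f)\<^sup>2))"
    if f: "f \<in> L2 \<tau>" for f t
  proof -
    define I where "I = (LINT s|leb \<tau>. norm (f s))"
    have "norm (kernel_operator \<tau> \<kappa> f t) \<le> norm (f t) + C * I"
      unfolding kernel_operator_def I_def
      by (intro order_trans[OF norm_triangle_ineq] add_mono order_refl norm_kernel_integral_le C \<kappa> f \<tau>)
    then have "(norm (kernel_operator \<tau> \<kappa> f t))\<^sup>2 \<le> (norm (f t) + C * I)\<^sup>2" by (intro power_mono) auto
    also have "\<dots> \<le> 2 * (norm (f t))\<^sup>2 + 2 * (C\<^sup>2 * I\<^sup>2)"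
      using zero_le_power2[of "norm (f t) - C * I"] by (simp add: power2_eq_square algebra_simps)
    also have "C\<^sup>2 * I\<^sup>2 \<le> C\<^sup>2 * (\<tau> * (L2_norm \<tau> f)\<^sup>2)"
      using L1_le_L2[OF f \<tau>] by (intro mult_left_mono) (auto simp: I_def)
    finally show ?thesis by simp
  qed
  have int: "integrable (leb \<tau>) (\<lambda>t. 2 * (norm (f t))\<^sup>2 + 2 * (C\<^sup>2 * (\<tau> * (L2_norm \<tau> f)\<^sup>2)))" if f: "f \<in> L2 \<tau>" for f
    using L2_square_integrable[OF f] bmeas_integrable[OF bmeas_const] by (intro Bochner_Integration.integrable_add) auto
  have L2: "kernel_operator \<tau> \<kappa> f \<in> L2 \<tau>" if f: "f \<in> L2 \<tau>" for f
  proof -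
    have [measurable]: "kernel_operator \<tau> \<kappa> f \<in> borel_measurable (leb \<tau>)"
      unfolding kernel_operator_def[abs_def]
      by (intro borel_measurable_add L2_measurable[OF f] kernel_integral_measurable[OF \<kappa> f])
    have "integrable (leb \<tau>) (\<lambda>t. (norm (kernel_operator \<tau> \<kappa> f t))\<^sup>2)"
      by (rule Bochner_Integration.integrable_bound[OF int[OF f]])
        (measurable, intro AE_I2, use pointwise[OF f] in \<open>auto intro: order_trans[OF _ abs_ge_self]\<close>)
    then show ?thesis by (simp add: L2_def)
  qed
  moreover have "AE t in leb \<tau>. kernel_operator \<tau> \<kappa> f t = kernel_operator \<tau> \<kappa> g t"
    if f: "f \<in> L2 \<tau>" and g: "g \<in> L2 \<tau>" and eq: "AE t in leb \<tau>. f t = g t" for f g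
  proof -
    have "(LINT s|leb \<tau>. \<kappa> (t, s) *v f s) = (LINT s|leb \<tau>. \<kappa> (t, s) *v g s)" for t
      by (rule integral_cong_AE[OF borel_measurable_integrable[OF kernel_slice_integrable[OF C(1) \<kappa> f]]
            borel_measurable_integrable[OF kernel_slice_integrable[OF C(1) \<kappa> g]]])
        (use eq in eventually_elim, simp)
    then show ?thesis using eq by (auto simp: kernel_operator_def elim: eventually_mono)
  qed
  moreover have "AE t in leb \<tau>. kernel_operator \<tau> \<kappa> (\<lambda>x. c *s f x + g x) t =
      c *s kernel_operator \<tau> \<kappa> f t + kernel_operator \<tau> \<kappa> g t"
    if f: "f \<in> L2 \<tau>" and g: "g \<in> L2 \<tau>" for f g and c :: complex
  proof (rule AE_I2)
    fix t
    have bl: "bounded_linear (\<lambda>x::complex^'r. c *s x)"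
      by (rule bounded_linear_intro[where K = "norm c"])
        (auto simp: vec_eq_iff algebra_simps norm_vec_def L2_set_right_distrib norm_mult)
    have "(LINT s|leb \<tau>. \<kappa> (t, s) *v (c *s f s + g s)) = (LINT s|leb \<tau>. c *s (\<kappa> (t, s) *v f s) + \<kappa> (t, s) *v g s)"
      by (rule LINT_cong) (simp add: matrix_vector_right_distrib vector_scalar_commute)
    also have "\<dots> = (LINT s|leb \<tau>. c *s (\<kappa> (t, s) *v f s)) + (LINT s|leb \<tau>. \<kappa> (t, s) *v g s)"
      by (intro Bochner_Integration.integral_add integrable_bounded_linear[OF bl] kernel_slice_integrable[OF C(1) \<kappa>] f g)
    also have "(LINT s|leb \<tau>. c *s (\<kappa> (t, s) *v f s)) = c *s (LINT s|leb \<tau>. \<kappa> (t, s) *v f s)"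
      by (rule integral_bounded_linear[OF bl kernel_slice_integrable[OF C(1) \<kappa> f]])
    finally show "kernel_operator \<tau> \<kappa> (\<lambda>x. c *s f x + g x) t =
        c *s kernel_operator \<tau> \<kappa> f t + kernel_operator \<tau> \<kappa> g t"
      by (simp add: kernel_operator_def vector_add_ldistrib)
  qed
  moreover have "L2_norm \<tau> (kernel_operator \<tau> \<kappa> f) \<le> sqrt (2 + 2 * C\<^sup>2 * \<tau>\<^sup>2) * L2_norm \<tau> f" if f: "f \<in> L2 \<tau>" for f
  proof -
    have "(LINT t|leb \<tau>. (norm (kernel_operator \<tau> \<kappa> f t))\<^sup>2) \<le>
        (LINT t|leb \<tau>. 2 * (norm (f t))\<^sup>2 + 2 * (C\<^sup>2 * (\<tau> * (L2_norm \<tau> f)\<^sup>2)))"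
      using pointwise[OF f] by (intro integral_mono'[OF int[OF f]]) auto
    also have "\<dots> = (LINT t|leb \<tau>. 2 * (norm (f t))\<^sup>2) + (LINT t|leb \<tau>. 2 * (C\<^sup>2 * (\<tau> * (L2_norm \<tau> f)\<^sup>2)))"
      using L2_square_integrable[OF f] by (intro Bochner_Integration.integral_add bmeas_integrable[OF bmeas_const]) auto
    also have "\<dots> = 2 * (L2_norm \<tau> f)\<^sup>2 + \<tau> * (2 * (C\<^sup>2 * (\<tau> * (L2_norm \<tau> f)\<^sup>2)))"
      using \<tau> measure_leb[of \<tau>] by (simp add: L2_norm_square[OF f])
    also have "\<dots> = (2 + 2 * C\<^sup>2 * \<tau>\<^sup>2) * (L2_norm \<tau> f)\<^sup>2"
      by (simp add: power2_eq_square algebra_simps)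
    finally have "L2_norm \<tau> (kernel_operator \<tau> \<kappa> f) \<le> sqrt ((2 + 2 * C\<^sup>2 * \<tau>\<^sup>2) * (L2_norm \<tau> f)\<^sup>2)"
      unfolding L2_norm_def[of \<tau> "kernel_operator \<tau> \<kappa> f"] by (rule real_sqrt_le_mono)
    moreover have "0 \<le> L2_norm \<tau> f" by (simp add: L2_norm_def)
    ultimately show ?thesis by (simp add: real_sqrt_mult)
  qed
  ultimately show ?thesis unfolding L2_bounded_operator_def by blast
qed

text \<open>The left side of \<open>inv\<close> is the kernel of the product minus the identity. It
  is needed at one fixed t and off s = t, which suits kernels that jump on the diagonal; the
  conclusion then holds at that very t.\<close>

lemma kernel_operator_compose:
  fixes \<kappa> \<kappa>' :: "real \<times> real \<Rightarrow> complex^'r^'r"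
  assumes \<kappa>: "bmeas \<kappa>" and \<kappa>': "bmeas \<kappa>'" and \<tau>: "0 < \<tau>" and f: "f \<in> L2 \<tau>"
    and inv: "\<And>s. 0 < s \<Longrightarrow> s < \<tau> \<Longrightarrow> s \<noteq> t \<Longrightarrow> \<kappa> (t, s) + \<kappa>' (t, s) + (LINT \<xi>|leb \<tau>. \<kappa> (t, \<xi>) ** \<kappa>' (\<xi>, s)) = 0"
  shows "kernel_operator \<tau> \<kappa> (kernel_operator \<tau> \<kappa>' f) t = f t"
proof -
  obtain C where C: "\<And>p. norm (\<kappa> p) \<le> C" "0 \<le> C" using bmeas_bound[OF \<kappa>] by blast
  obtain C' where C': "\<And>p. norm (\<kappa>' p) \<le> C'" "0 \<le> C'" using bmeas_bound[OF \<kappa>'] by blast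
  define g where "g = kernel_operator \<tau> \<kappa>' f"
  have "g \<in> L2 \<tau>" using L2_bounded_kernel_operator[OF \<kappa>' \<tau>] f by (simp add: L2_bounded_operator_def g_def)
  note bi = bmeas_intros bmeas_comp[OF \<kappa>] bmeas_comp[OF \<kappa>']
  note i = kernel_slice_integrable[OF C(1) \<kappa>] kernel_slice_integrable[OF C'(1) \<kappa>']
  define L where "L s = (LINT \<xi>|leb \<tau>. \<kappa> (t, \<xi>) ** \<kappa>' (\<xi>, s))" for s
  have bL: "bmeas L" unfolding L_def using \<tau> by (intro bi) auto
  have Li: "integrable (leb \<tau>) (\<lambda>s. L s *v f s)"
  proof -
    obtain D where D: "\<And>s. norm (L s) \<le> D" using bmeas_bound[OF bL] by blast
    have "bmeas (\<lambda>p::real \<times> real. L (snd p))" by (intro bi bmeas_comp[OF bL])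
    from kernel_slice_integrable[OF _ this f, of D t] D show ?thesis by simp
  qed
  have "(LINT \<xi>|leb \<tau>. \<kappa> (t, \<xi>) *v (LINT s|leb \<tau>. \<kappa>' (\<xi>, s) *v f s)) =
      (LINT \<xi>|leb \<tau>. LINT s|leb \<tau>. (\<kappa> (t, \<xi>) ** \<kappa>' (\<xi>, s)) *v f s)"
  proof (rule LINT_cong)
    fix \<xi>
    show "\<kappa> (t, \<xi>) *v (LINT s|leb \<tau>. \<kappa>' (\<xi>, s) *v f s) = (LINT s|leb \<tau>. (\<kappa> (t, \<xi>) ** \<kappa>' (\<xi>, s)) *v f s)"
      unfolding matrix_vector_mul_assoc[symmetric]
      by (rule integral_bounded_linear[OF bounded_bilinear.bounded_linear_right[OF bounded_bilinear_matrix_vector_mult], symmetric])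
        (rule i f)+
  qed
  also have "\<dots> = (LINT s|leb \<tau>. LINT \<xi>|leb \<tau>. (\<kappa> (t, \<xi>) ** \<kappa>' (\<xi>, s)) *v f s)"
  proof (rule Fubini_leb[where h = "\<lambda>s. C * C' * norm (f s)"])
    have "bmeas (\<lambda>p. \<kappa> (t, fst p) ** \<kappa>' p)" by (intro bi \<kappa>')
    from kernel_apply_measurable[OF this L2_measurable[OF f], of \<tau>]
    show "(\<lambda>p. (\<kappa> (t, fst p) ** \<kappa>' (fst p, snd p)) *v f (snd p)) \<in> borel_measurable (leb \<tau> \<Otimes>\<^sub>M leb \<tau>)" by simp
    show "integrable (leb \<tau>) (\<lambda>s. C * C' * norm (f s))" using L2_integrable[OF f] by auto
    show "norm ((\<kappa> (t, x) ** \<kappa>' (x, y)) *v f y) \<le> C * C' * norm (f y)" for x y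
      using C C' by (intro order_trans[OF norm_matrix_vector_mult_le] mult_right_mono
          order_trans[OF norm_matrix_mult_le] mult_mono) auto
  qed
  also have "\<dots> = (LINT s|leb \<tau>. L s *v f s)"
  proof (rule LINT_cong)
    fix s
    have "bmeas (\<lambda>\<xi>. \<kappa> (t, \<xi>) ** \<kappa>' (\<xi>, s))" by (intro bi)
    then show "(LINT \<xi>|leb \<tau>. (\<kappa> (t, \<xi>) ** \<kappa>' (\<xi>, s)) *v f s) = L s *v f s"
      unfolding L_def
      by (intro integral_bounded_linear[OF bounded_bilinear.bounded_linear_left[OF bounded_bilinear_matrix_vector_mult]]
          bmeas_integrable)
  qed
  finally have double: "(LINT \<xi>|leb \<tau>. \<kappa> (t, \<xi>) *v (LINT s|leb \<tau>. \<kappa>' (\<xi>, s) *v f s)) = (LINT s|leb \<tau>. L s *v f s)" .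
  \<comment> \<open>The inner integral is g - f with both functions square integrable, which gives
    integrability without a further estimate.\<close>
  have "integrable (leb \<tau>) (\<lambda>\<xi>. \<kappa> (t, \<xi>) *v (g \<xi> - f \<xi>))"
    unfolding matrix_vector_mult_diff_distrib
    by (intro Bochner_Integration.integrable_diff i f \<open>g \<in> L2 \<tau>\<close>)
  then have int: "integrable (leb \<tau>) (\<lambda>\<xi>. \<kappa> (t, \<xi>) *v (LINT s|leb \<tau>. \<kappa>' (\<xi>, s) *v f s))"
    by (simp add: g_def kernel_operator_def)
  have "kernel_operator \<tau> \<kappa> g t = f t + (LINT s|leb \<tau>. \<kappa>' (t, s) *v f s) +
      (LINT \<xi>|leb \<tau>. \<kappa> (t, \<xi>) *v f \<xi> + \<kappa> (t, \<xi>) *v (LINT s|leb \<tau>. \<kappa>' (\<xi>, s) *v f s))"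
    by (simp add: kernel_operator_def g_def matrix_vector_right_distrib)
  also have "\<dots> = f t + ((LINT s|leb \<tau>. \<kappa>' (t, s) *v f s) + (LINT s|leb \<tau>. \<kappa> (t, s) *v f s) + (LINT s|leb \<tau>. L s *v f s))"
    by (subst Bochner_Integration.integral_add[OF i(1)[OF f] int]) (simp add: double)
  also have "\<dots> = f t + (LINT s|leb \<tau>. (\<kappa>' (t, s) *v f s + \<kappa> (t, s) *v f s) + L s *v f s)"
    by (simp only: Bochner_Integration.integral_add[OF Bochner_Integration.integrable_add[OF i(2)[OF f] i(1)[OF f]] Li]
        Bochner_Integration.integral_add[OF i(2)[OF f] i(1)[OF f]])
  also have "(LINT s|leb \<tau>. (\<kappa>' (t, s) *v f s + \<kappa> (t, s) *v f s) + L s *v f s) = (LINT s|leb \<tau>. 0)"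
  proof (rule integral_cong_AE)
    have "AE s in lborel. s \<noteq> t" by (rule AE_lborel_singleton)
    then have "AE s in leb \<tau>. s \<noteq> t" by (subst AE_restrict_space_iff) auto
    then show "AE s in leb \<tau>. (\<kappa>' (t, s) *v f s + \<kappa> (t, s) *v f s) + L s *v f s = 0"
      using AE_space
    proof eventually_elim
      case (elim s)
      then have "\<kappa> (t, s) + \<kappa>' (t, s) + L s = 0" using inv[of s] by (simp add: L_def)
      then have "(\<kappa> (t, s) + \<kappa>' (t, s) + L s) *v f s = 0" by simp
      then show ?case by (simp add: matrix_vector_mult_add_rdistrib add.commute)
    qed
  qed (use i f Li in \<open>auto intro!: borel_measurable_integrable\<close>)
  finally show ?thesis by (simp add: g_def)
qed

section \<open>Uniqueness of the accelerant\<close>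

lemma bmeas_continuous_on_extend_0:
  fixes f :: "real \<Rightarrow> 'b::{real_normed_vector,second_countable_topology}"
  assumes "continuous_on S f" "S \<in> sets borel" "\<And>x. x \<in> S \<Longrightarrow> norm (f x) \<le> C"
  shows "bmeas (\<lambda>x. if x \<in> S then f x else 0)"
proof (rule bmeasI[where C = "max C 0"])
  have "(\<lambda>x. indicator S x *\<^sub>R f x) \<in> borel_measurable borel"
    using assms by (intro borel_measurable_continuous_on_indicator)
  moreover have "(\<lambda>x. indicator S x *\<^sub>R f x) = (\<lambda>x. if x \<in> S then f x else 0)"
    by (auto simp: indicator_def)
  ultimately show "(\<lambda>x. if x \<in> S then f x else 0) \<in> borel_measurable borel" by simp
qed (use assms in \<open>auto simp: le_max_iff_disj\<close>)

lemma bounded_half_open: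
  fixes f :: "real \<Rightarrow> 'b::real_normed_vector"
  assumes cont: "continuous_on {0<..T} f" and lim: "(f \<longlongrightarrow> L) (at_right 0)"
  obtains C where "\<And>x. x \<in> {0<..T} \<Longrightarrow> norm (f x) \<le> C"
proof -
  have "eventually (\<lambda>x. dist (f x) L < 1) (at_right 0)" using lim by (rule tendstoD) simp
  then obtain b where b: "0 < b" "\<And>x. 0 < x \<Longrightarrow> x < b \<Longrightarrow> dist (f x) L < 1"
    unfolding eventually_at_right_field by blast
  have "compact (f ` {b / 2..T})"
    using b(1) by (intro compact_continuous_image continuous_on_subset[OF cont]) auto
  then have "bounded (f ` {b / 2..T})" by (rule compact_imp_bounded)
  then obtain C where C: "\<And>x. x \<in> {b / 2..T} \<Longrightarrow> norm (f x) \<le> C"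
    unfolding bounded_iff by blast
  show ?thesis
  proof (rule that[of "max C (norm L + 1)"])
    fix x assume x: "x \<in> {0<..T}"
    show "norm (f x) \<le> max C (norm L + 1)"
    proof (cases "x < b")
      case True
      then have "norm (f x - L) < 1" using b(2) x by (auto simp: dist_norm)
      then have "norm (f x) \<le> norm L + 1" using norm_triangle_sub[of "f x" L] by linarith
      then show ?thesis by simp
    next
      case False
      then show ?thesis using C[of x] x b(1) by (auto simp: le_max_iff_disj)
    qed
  qed
qed

text \<open>Values at 0 and outside [-T, T] are unconstrained and are replaced by 0. On the positive
  half the right limit at 0 and compactness give a bound; hermitian symmetry carries it to the
  negative half.\<close>

lemma bmeas_accelerant:
  fixes k :: "real \<Rightarrow> complex^'r^'r"
  assumes "hermitian_kernel T k" "continuous_with_jump_at_0 T k"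
  shows "bmeas (\<lambda>u. if \<bar>u\<bar> \<le> T \<and> u \<noteq> 0 then k u else 0)"
proof -
  obtain L where L: "continuous_on {-T..<0} k" "continuous_on {0<..T} k" "(k \<longlongrightarrow> L) (at_right 0)"
    using assms(2) by (auto simp: continuous_with_jump_at_0_def)
  obtain C where C: "\<And>x. x \<in> {0<..T} \<Longrightarrow> norm (k x) \<le> C" using bounded_half_open[OF L(2,3)] by blast
  have C': "norm (k x) \<le> C" if "x \<in> {-T..<0}" for x
  proof -
    have "k (- (- x)) = conj_transpose (k (- x))"
      using assms(1) that unfolding hermitian_kernel_def by (intro bspec[of _ _ "- x"]) auto
    then show ?thesis using C[of "- x"] that by simp
  qed
  have "bmeas (\<lambda>u. (if u \<in> {-T..<0} then k u else 0) + (if u \<in> {0<..T} then k u else 0))"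
    by (intro bmeas_add bmeas_continuous_on_extend_0[OF L(1) _ C'] bmeas_continuous_on_extend_0[OF L(2) _ C]) auto
  moreover have "(\<lambda>u. (if u \<in> {-T..<0} then k u else 0) + (if u \<in> {0<..T} then k u else 0)) =
      (\<lambda>u. if \<bar>u\<bar> \<le> T \<and> u \<noteq> 0 then k u else 0)"
    by (auto simp: fun_eq_iff)
  ultimately show ?thesis by simp
qed

text \<open>The part of (0, \<tau>) farther than a from s consists of two end pieces, each of length
  at most \<tau> - a. This is the source of smallness in the continuation argument for uniqueness,
  where the difference of two kernels vanishes at arguments of modulus at most a.\<close>

lemma norm_LINT_far_le:
  fixes F :: "real \<Rightarrow> 'b::{banach,second_countable_topology}"
  assumes "0 \<le> a" "a \<le> \<tau>" "0 \<le> s" "s \<le> \<tau>" "0 \<le> C"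
    and F: "\<And>\<xi>. 0 < \<xi> \<Longrightarrow> \<xi> < \<tau> \<Longrightarrow> norm (F \<xi>) \<le> (if \<bar>s - \<xi>\<bar> \<le> a then 0 else C)"
  shows "norm (LINT \<xi>|leb \<tau>. F \<xi>) \<le> 2 * (\<tau> - a) * C"
proof -
  define b where "b = max 0 (s - a)"
  define b' where "b' = max 0 (\<tau> - s - a)"
  have b: "0 \<le> b" "b \<le> \<tau> - a" "0 \<le> b'" "b' \<le> \<tau> - a" using assms by (auto simp: b_def b'_def)
  have bm: "bmeas (\<lambda>\<xi>. if \<xi> < b then C else 0)" "bmeas (\<lambda>\<xi>. if \<tau> - \<xi> < b' then C else 0)"
    by (intro bmeas_intros)+
  have "norm (LINT \<xi>|leb \<tau>. F \<xi>) \<le> (LINT \<xi>|leb \<tau>. (if \<xi> < b then C else 0) + (if \<tau> - \<xi> < b' then C else 0))"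
  proof (rule norm_LINT_le)
    fix \<xi> assume "0 < \<xi>" "\<xi> < \<tau>"
    from F[OF this] show "norm (F \<xi>) \<le> (if \<xi> < b then C else 0) + (if \<tau> - \<xi> < b' then C else 0)"
      using assms(5) by (auto simp: b_def b'_def abs_le_iff split: if_splits)
  qed (use assms bm in \<open>auto intro!: bmeas_integrable bmeas_add\<close>)
  also have "\<dots> = (LINT \<xi>|leb \<tau>. (if \<xi> < b then C else 0)) + (LINT \<xi>|leb \<tau>. (if \<tau> - \<xi> < b' then C else 0))"
    by (rule LINT_add[OF bm])
  also have "(LINT \<xi>|leb \<tau>. (if \<tau> - \<xi> < b' then C else 0)) = (LINT \<xi>|leb \<tau>. (if \<xi> < b' then C else 0))"
    by (rule LINT_leb_reflect[of \<tau> "\<lambda>\<xi>. if \<xi> < b' then C else 0"])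
  also have "(LINT \<xi>|leb \<tau>. (if \<xi> < b then C else 0)) = b * C"
    using b assms measure_leb[of b] by (subst LINT_leb_If) auto
  also have "(LINT \<xi>|leb \<tau>. (if \<xi> < b' then C else 0)) = b' * C"
    using b assms measure_leb[of b'] by (subst LINT_leb_If) auto
  also have "b * C + b' * C \<le> (\<tau> - a) * C + (\<tau> - a) * C"
    using b assms by (intro add_mono mult_right_mono) auto
  finally show ?thesis by (simp add: algebra_simps)
qed

text \<open>The points (t, 0) with 0 < t \<le> \<tau> lie in the lower triangle, where \<gamma> has
  a continuous extension to a compact set. This yields a bounded measurable column up to and
  including t = \<tau>, although \<gamma> itself is an arbitrary function.\<close>

lemma resolvent_first_column:
  fixes k :: "real \<Rightarrow> complex^'r^'r"
  assumes herm: "hermitian_kernel T k" and jump: "continuous_with_jump_at_0 T k"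
    and \<tau>: "0 < \<tau>" "\<tau> \<le> T" and res: "is_resolvent_kernel k \<tau> \<gamma>"
  obtains x where "bmeas x" "x \<tau> = \<gamma> \<tau> 0"
    "\<And>t. 0 < t \<Longrightarrow> t \<le> \<tau> \<Longrightarrow>
      x t - (LINT \<xi>|leb \<tau>. (if \<bar>t - \<xi>\<bar> \<le> T \<and> t - \<xi> \<noteq> 0 then k (t - \<xi>) else 0) ** x \<xi>) = k t"
proof -
  define S where "S = {(t, s). 0 \<le> s \<and> s < t \<and> t \<le> \<tau>}"
  obtain G where G: "continuous_on (closure S) G" "\<And>t s. (t, s) \<in> S \<Longrightarrow> G (t, s) = \<gamma> t s"
    using res unfolding is_resolvent_kernel_def extends_continuously_to_closure_def S_def by blast
  have "S \<subseteq> cbox (0, 0) (\<tau>, \<tau>)" by (auto simp: S_def)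
  then have "compact (closure S)" by (meson bounded_cbox bounded_subset compact_closure)
  then have "bounded (G ` closure S)" using G(1) compact_continuous_image compact_imp_bounded by blast
  then obtain C where C: "\<And>p. p \<in> closure S \<Longrightarrow> norm (G p) \<le> C" by (auto simp: bounded_iff)
  define x where "x \<xi> = (if \<xi> \<in> {0<..\<tau>} then G (\<xi>, 0) else 0)" for \<xi>
  have sub: "(\<xi>, 0) \<in> closure S" if "\<xi> \<in> {0<..\<tau>}" for \<xi>
    using that closure_subset[of S] by (auto simp: S_def)
  have x_eq: "x \<xi> = \<gamma> \<xi> 0" if "0 < \<xi>" "\<xi> \<le> \<tau>" for \<xi>
    using that G(2)[of \<xi> 0] by (simp add: x_def S_def)
  have bx: "bmeas x"
    unfolding x_def
  proof (rule bmeas_continuous_on_extend_0)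
    show "continuous_on {0<..\<tau>} (\<lambda>\<xi>. G (\<xi>, 0))"
      using sub by (intro continuous_on_compose2[OF G(1)] continuous_intros) auto
  qed (use C sub in auto)
  define k0 where "k0 u = (if \<bar>u\<bar> \<le> T \<and> u \<noteq> 0 then k u else 0)" for u
  have bk0: "bmeas k0" unfolding k0_def by (rule bmeas_accelerant[OF herm jump])
  show ?thesis
  proof (rule that[OF bx])
    show "x \<tau> = \<gamma> \<tau> 0" using \<tau> by (intro x_eq) auto
    fix t assume t: "0 < t" "t \<le> \<tau>"
    \<comment> \<open>At \<xi> = t the original integrand sees the unconstrained value
      \<open>k 0\<close>; as a one-point correction it stays measurable and drops out of the
      integral.\<close>
    have bk1: "bmeas (\<lambda>\<xi>. k0 (t - \<xi>) + (if t \<le> \<xi> \<and> \<xi> \<le> t then k 0 else 0))"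
      by (intro bmeas_intros bmeas_comp[OF bk0])
    have "(LINT \<xi>|leb \<tau>. k (t - \<xi>) ** \<gamma> \<xi> 0) =
        (LINT \<xi>|leb \<tau>. (k0 (t - \<xi>) + (if t \<le> \<xi> \<and> \<xi> \<le> t then k 0 else 0)) ** x \<xi>)"
      using t \<tau> by (intro LINT_cong) (auto simp: x_eq k0_def)
    also have "\<dots> = (LINT \<xi>|leb \<tau>. k0 (t - \<xi>) ** x \<xi>)"
      by (rule LINT_cong_except[where r = t], intro bmeas_mult bk1 bx,
          intro bmeas_mult bx bmeas_comp[OF bk0] bmeas_intros) auto
    finally have "(LINT \<xi>|leb \<tau>. k (t - \<xi>) ** \<gamma> \<xi> 0) = (LINT \<xi>|leb \<tau>. k0 (t - \<xi>) ** x \<xi>)" .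
    moreover have "\<gamma> t 0 - (LINT \<xi>|leb \<tau>. k (t - \<xi>) ** \<gamma> \<xi> 0) = k (t - 0)"
      using res t \<tau> unfolding is_resolvent_kernel_def by force
    ultimately show "x t - (LINT \<xi>|leb \<tau>. (if \<bar>t - \<xi>\<bar> \<le> T \<and> t - \<xi> \<noteq> 0 then k (t - \<xi>) else 0) ** x \<xi>) = k t"
      using t by (simp add: x_eq k0_def)
  qed
qed

text \<open>The inverse operator evaluated at a single point t, including t = \<tau>. An identity
  almost everywhere would say nothing at the end point, which is where the potential is read
  off.\<close>

lemma resolvent_row_solution:
  fixes k x \<gamma> :: "real \<Rightarrow> complex^'r^'r"
  assumes bm: "bmeas k" "bmeas x" "bmeas \<gamma>" and \<tau>: "0 \<le> \<tau>"
    and w: "\<And>s. w s = x s - (LINT \<xi>|leb \<tau>. k (s - \<xi>) ** x \<xi>)"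
    and row: "\<And>s. 0 \<le> s \<Longrightarrow> s < \<tau> \<Longrightarrow> s \<noteq> t \<Longrightarrow> \<gamma> s - (LINT \<xi>|leb \<tau>. \<gamma> \<xi> ** k (\<xi> - s)) = k (t - s)"
  shows "x t = w t + (LINT \<xi>|leb \<tau>. \<gamma> \<xi> ** w \<xi>)"
proof -
  note bi = bmeas_intros bmeas_comp[OF bm(1)] bmeas_comp[OF bm(2)] bmeas_comp[OF bm(3)]
  have b1: "bmeas (\<lambda>\<eta>. LINT \<xi>|leb \<tau>. \<gamma> \<xi> ** k (\<xi> - \<eta>))" using \<tau> by (intro bi) auto
  have "(LINT \<eta>|leb \<tau>. k (t - \<eta>) ** x \<eta>) = (LINT \<eta>|leb \<tau>. (\<gamma> \<eta> - (LINT \<xi>|leb \<tau>. \<gamma> \<xi> ** k (\<xi> - \<eta>))) ** x \<eta>)"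
    by (rule LINT_cong_except[where r = t], intro bi, intro bmeas_mult bmeas_diff bm b1) (simp add: row)
  also have "\<dots> = (LINT \<xi>|leb \<tau>. \<gamma> \<xi> ** w \<xi>)"
    unfolding w using \<tau> by (intro pairing bm) auto
  finally show ?thesis by (simp add: w)
qed

text \<open>Nothing is known a priori about how the resolvent columns \<open>x\<close> of \<open>k'\<close> depend on \<open>\<tau>\<close>.  But once
  \<open>d = k' - k\<close> vanishes on \<open>(0, a]\<close>, the operators of \<open>k\<close> and \<open>k'\<close> are close on \<open>(0, \<tau>)\<close> for
  \<open>\<tau> \<le> a + \<epsilon>\<close>, which yields the bound \<open>U\<close> for \<open>x\<close>, and then \<open>d = 0\<close> on \<open>(0, a + \<epsilon>]\<close>.  The length
  \<open>\<epsilon>\<close> does not depend on \<open>a\<close>.\<close>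

lemma accelerant_unique:
  fixes k :: "real \<Rightarrow> complex^'r^'r"
  assumes T: "0 < T" and bk: "bmeas k" and herm: "\<And>u. k (- u) = conj_transpose (k u)"
    and b\<gamma>: "\<And>\<tau> t. bmeas (\<gamma> \<tau> t)" and B: "\<And>\<tau> t s. norm (\<gamma> \<tau> t s) \<le> B"
    and row: "\<And>\<tau> t s. 0 \<le> t \<Longrightarrow> t \<le> \<tau> \<Longrightarrow> 0 \<le> s \<Longrightarrow> s \<le> \<tau> \<Longrightarrow> \<tau> \<le> T \<Longrightarrow> t \<noteq> s \<Longrightarrow>
      \<gamma> \<tau> t s - (LINT \<xi>|leb \<tau>. \<gamma> \<tau> t \<xi> ** k (\<xi> - s)) = k (t - s)"
    and v: "\<And>\<tau>. 0 < \<tau> \<Longrightarrow> \<tau> \<le> T \<Longrightarrow> v \<tau> = (\<chi> i j. - \<i> * \<gamma> \<tau> \<tau> 0 $ i $ j)"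
    and acc: "is_accelerant_of_potential T v k'" and t: "0 < t" "t \<le> T"
  shows "k' t = k t"
proof -
  have acc': "hermitian_kernel T k'" "continuous_with_jump_at_0 T k'"
    using acc by (auto simp: is_accelerant_of_potential_def)
  define k0 where "k0 u = (if \<bar>u\<bar> \<le> T \<and> u \<noteq> 0 then k' u else 0)" for u
  have bk0: "bmeas k0" unfolding k0_def by (rule bmeas_accelerant[OF acc'])
  have herm0: "k0 (- u) = conj_transpose (k0 u)" for u
    using acc'(1) by (auto simp: k0_def hermitian_kernel_def abs_le_iff)
  \<comment> \<open>Forcing the value 0 at 0 lets vanishing on (0, a] extend to all of [-a, a] by
    \<open>d_even\<close>.\<close>
  define d where "d u = (if u = 0 then 0 else k0 u - k u)" for u
  have bd: "bmeas d"
  proof -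
    have "bmeas (\<lambda>u. if u \<le> 0 \<and> 0 \<le> u then 0 else k0 u - k u)"
      by (intro bmeas_intros bk0 bk)
    moreover have "(\<lambda>u. if u \<le> 0 \<and> 0 \<le> u then 0 else k0 u - k u) = d"
      by (auto simp: d_def fun_eq_iff)
    ultimately show ?thesis by simp
  qed
  have d_even: "norm (d u) = norm (d \<bar>u\<bar>)" for u
  proof (cases "0 \<le> u")
    case False
    then have "d u = conj_transpose (d \<bar>u\<bar>)"
      using herm[of "- u"] herm0[of "- u"] by (simp add: d_def conj_transpose_diff)
    then show ?thesis by simp
  qed simp
  obtain D where D: "\<And>u. norm (d u) \<le> D" "0 \<le> D" using bmeas_bound[OF bd] by blast
  obtain M where M: "\<And>u. norm (k0 u) \<le> M" "0 \<le> M" using bmeas_bound[OF bk0] by blast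
  have B0: "0 \<le> B" using B norm_ge_zero order_trans by blast
  \<comment> \<open>Bounds the operator I + \<open>\<Gamma>\<^sub>\<tau>\<close> built from the rows
    of \<gamma> in the supremum norm, for all \<tau> at once.\<close>
  define A where "A = 1 + T * B"
  have A: "1 \<le> A" using T B0 by (simp add: A_def)
  \<comment> \<open>The solution of U = M A + U / 2, the fixed point of the estimate for the column
    \<open>x\<close> once 2 \<epsilon> D A is at most 1/2.\<close>
  define U where "U = 2 * A * M"
  have U: "0 \<le> U" using A M by (simp add: U_def)
  define S where "S = D * A + U * A + B + 1"
  have DAUB: "0 \<le> D * A" "0 \<le> U * A" using D A U by auto
  have S: "0 < S" using DAUB B0 by (simp add: S_def)
  \<comment> \<open>Serves both requirements in \<open>\<epsilon>1\<close>: the first closes the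
    bound on the column \<open>x\<close>, the second halves the bound on d. No quantity in
    \<open>S\<close> refers to the point a reached so far.\<close>
  define \<epsilon> where "\<epsilon> = 1 / (4 * S)"
  have \<epsilon>: "0 < \<epsilon>" "2 * \<epsilon> * S = 1 / 2" using S by (simp_all add: \<epsilon>_def)
  have \<epsilon>1: "2 * \<epsilon> * D * A \<le> 1 / 2" "2 * \<epsilon> * (U * A + B) \<le> 1 / 2"
  proof -
    have "2 * \<epsilon> * (D * A) \<le> 2 * \<epsilon> * S" "2 * \<epsilon> * (U * A + B) \<le> 2 * \<epsilon> * S"
      using DAUB B0 \<epsilon>(1) by (intro mult_left_mono; simp add: S_def)+
    then show "2 * \<epsilon> * D * A \<le> 1 / 2" "2 * \<epsilon> * (U * A + B) \<le> 1 / 2"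
      using \<epsilon>(2) by (simp_all only: mult.assoc)
  qed
  have step: "norm (d \<tau>) \<le> c / 2"
    if a: "0 \<le> a" "a < \<tau>" "\<tau> \<le> a + \<epsilon>" "\<tau> \<le> T" and zero: "\<And>u. 0 < u \<Longrightarrow> u \<le> a \<Longrightarrow> d u = 0"
      and c: "0 \<le> c" "\<And>u. 0 < u \<Longrightarrow> u \<le> \<tau> \<Longrightarrow> norm (d u) \<le> c" for a \<tau> c
  proof -
    have \<tau>: "0 < \<tau>" using a by simp
    obtain \<gamma>' where \<gamma>': "is_resolvent_kernel k' \<tau> \<gamma>'" "v \<tau> = (\<chi> i j. - \<i> * \<gamma>' \<tau> 0 $ i $ j)"
      using acc \<tau> a unfolding is_accelerant_of_potential_def by force
    have same: "\<gamma>' \<tau> 0 = \<gamma> \<tau> \<tau> 0"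
      using v[OF \<tau> a(4)] \<gamma>'(2) by (simp add: vec_eq_iff)
    obtain x where x: "bmeas x" "x \<tau> = \<gamma>' \<tau> 0"
      "\<And>t. 0 < t \<Longrightarrow> t \<le> \<tau> \<Longrightarrow> x t - (LINT \<xi>|leb \<tau>. k0 (t - \<xi>) ** x \<xi>) = k' t"
      using resolvent_first_column[OF acc' \<tau> a(4) \<gamma>'(1)] unfolding k0_def by blast
    note bi = bmeas_intros bmeas_comp[OF bk] bmeas_comp[OF bk0] bmeas_comp[OF bd] bmeas_comp[OF x(1)] bmeas_comp[OF b\<gamma>]
    \<comment> \<open>The perturbation term: applying the operator of k, rather than that of k', to
      the column \<open>x\<close> gives the column of k' plus \<open>e\<close>.\<close>
    define e where "e s = (LINT \<xi>|leb \<tau>. d (s - \<xi>) ** x \<xi>)" for s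
    have be: "bmeas e" unfolding e_def using \<tau> by (intro bi) auto
    note bi = bi bmeas_comp[OF be]
    define w where "w s = x s - (LINT \<xi>|leb \<tau>. k (s - \<xi>) ** x \<xi>)" for s
    have w: "w s = k0 s + e s" if "0 < s" "s \<le> \<tau>" for s
    proof -
      have "e s = (LINT \<xi>|leb \<tau>. k0 (s - \<xi>) ** x \<xi> - k (s - \<xi>) ** x \<xi>)"
        unfolding e_def by (rule LINT_cong_except[where r = s], (intro bi)+) (simp add: d_def matrix_mult_diff_left)
      also have "\<dots> = (LINT \<xi>|leb \<tau>. k0 (s - \<xi>) ** x \<xi>) - (LINT \<xi>|leb \<tau>. k (s - \<xi>) ** x \<xi>)"
        by (rule LINT_diff) (intro bi)+
      finally show ?thesis using x(3)[OF that] that a by (simp add: w_def k0_def algebra_simps)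
    qed
    have x_repr: "x s = w s + (LINT \<xi>|leb \<tau>. \<gamma> \<tau> s \<xi> ** w \<xi>)" if "0 < s" "s \<le> \<tau>" for s
      using that a by (intro resolvent_row_solution[OF bk x(1) b\<gamma> _ w_def] row) auto
    have e_le: "norm (e s) \<le> 2 * \<epsilon> * (c * V)" if c: "0 \<le> c" "\<And>u. 0 < u \<Longrightarrow> u \<le> \<tau> \<Longrightarrow> norm (d u) \<le> c"
      and V: "\<And>\<xi>. \<xi> \<in> {0<..\<tau>} \<Longrightarrow> norm (x \<xi>) \<le> V" and s: "0 < s" "s \<le> \<tau>" for c V s
    proof -
      have V0: "0 \<le> V" using V[of \<tau>] \<tau> norm_ge_zero[of "x \<tau>"] by (simp del: norm_ge_zero)
      have "norm (e s) \<le> 2 * (\<tau> - a) * (c * V)"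
        unfolding e_def
      proof (rule norm_LINT_far_le)
        fix \<xi> assume \<xi>: "0 < \<xi>" "\<xi> < \<tau>"
        have "norm (d (s - \<xi>)) \<le> (if \<bar>s - \<xi>\<bar> \<le> a then 0 else c)"
          using zero[of "\<bar>s - \<xi>\<bar>"] c(2)[of "\<bar>s - \<xi>\<bar>"] s \<xi> a d_even[of "s - \<xi>"]
          by (cases "s = \<xi>") (auto simp: d_def)
        then have "norm (d (s - \<xi>)) * norm (x \<xi>) \<le> (if \<bar>s - \<xi>\<bar> \<le> a then 0 else c) * V"
          using V[of \<xi>] \<xi> c by (intro mult_mono) auto
        also have "\<dots> = (if \<bar>s - \<xi>\<bar> \<le> a then 0 else c * V)" by simp
        finally show "norm (d (s - \<xi>) ** x \<xi>) \<le> (if \<bar>s - \<xi>\<bar> \<le> a then 0 else c * V)"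
          by (rule order_trans[OF norm_matrix_mult_le])
      qed (use a s c V0 in auto)
      also have "\<dots> \<le> 2 * \<epsilon> * (c * V)" using a c V0 by (intro mult_right_mono) auto
      finally show ?thesis .
    qed
    have row_le: "norm (LINT \<xi>|leb \<tau>. \<gamma> \<tau> s \<xi> ** h \<xi>) \<le> T * B * H"
      if "\<And>\<xi>. 0 < \<xi> \<Longrightarrow> \<xi> \<le> \<tau> \<Longrightarrow> norm (h \<xi>) \<le> H" "0 \<le> H" for h s H
    proof -
      have "norm (LINT \<xi>|leb \<tau>. \<gamma> \<tau> s \<xi> ** h \<xi>) \<le> \<tau> * (B * H)"
        using that \<tau> B B0 by (intro norm_LINT_le_const order_trans[OF norm_matrix_mult_le] mult_mono) auto
      also have "\<dots> \<le> T * (B * H)" using a B0 that(2) by (intro mult_right_mono) auto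
      finally show ?thesis by (simp add: mult_ac)
    qed
    have w_le: "norm (w s) \<le> M + 2 * \<epsilon> * (D * V)"
      if "\<And>\<xi>. \<xi> \<in> {0<..\<tau>} \<Longrightarrow> norm (x \<xi>) \<le> V" "0 < s" "s \<le> \<tau>" for V s
      unfolding w[OF that(2,3)] by (intro order_trans[OF norm_triangle_ineq add_mono] M(1) e_le D that)
    have x_le: "norm (x s) \<le> (M + 2 * \<epsilon> * (D * V)) * A"
      if V: "0 \<le> V" "\<And>\<xi>. \<xi> \<in> {0<..\<tau>} \<Longrightarrow> norm (x \<xi>) \<le> V" and s: "0 < s" "s \<le> \<tau>" for V s
    proof -
      have "0 \<le> M + 2 * \<epsilon> * (D * V)" using M \<epsilon> D V by auto
      then have "norm (LINT \<xi>|leb \<tau>. \<gamma> \<tau> s \<xi> ** w \<xi>) \<le> T * B * (M + 2 * \<epsilon> * (D * V))"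
        by (intro row_le w_le V(2)) auto
      moreover have "norm (w s) \<le> M + 2 * \<epsilon> * (D * V)" by (intro w_le V(2) s)
      ultimately have "norm (x s) \<le> (M + 2 * \<epsilon> * (D * V)) + T * B * (M + 2 * \<epsilon> * (D * V))"
        unfolding x_repr[OF s] by (rule order_trans[OF norm_triangle_ineq add_mono, rotated])
      then show ?thesis by (simp add: A_def algebra_simps)
    qed
    obtain X0 where X0: "\<And>s. norm (x s) \<le> X0" "0 \<le> X0" using bmeas_bound[OF x(1)] by blast
    have x_le_U: "norm (x s) \<le> U" if s: "s \<in> {0<..\<tau>}" for s
    proof -
      \<comment> \<open>Halving is applied to the excess over U, started from some bound
        \<open>X0\<close> that may depend on \<tau>; the result U does not.\<close>
      have "norm (x s) - U \<le> 0"
      proof (rule zero_by_halving[where D = "{0<..\<tau>}" and e = "\<lambda>s. norm (x s) - U" and w = "\<lambda>_. 1" and C = X0])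
        show "norm (x p) - U \<le> X0 * 1" for p using X0(1)[of p] U by simp
        fix c' p assume c': "0 \<le> c'" and le: "\<And>p. p \<in> {0<..\<tau>} \<Longrightarrow> norm (x p) - U \<le> c' * 1"
          and p: "p \<in> {0<..\<tau>}"
        have "norm (x p) \<le> (M + 2 * \<epsilon> * (D * (U + c'))) * A"
          using le c' U p by (intro x_le) (auto simp: algebra_simps)
        also have "\<dots> = M * A + (2 * \<epsilon> * D * A) * (U + c')" by (simp add: algebra_simps)
        also have "\<dots> \<le> M * A + 1 / 2 * (U + c')"
          using \<epsilon>1(1) U c' by (intro add_left_mono mult_right_mono) auto
        also have "\<dots> = U + c' / 2" by (simp add: U_def algebra_simps)
        finally show "norm (x p) - U \<le> c' / 2 * 1" by simp
      qed (use X0 s in auto)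
      then show ?thesis by simp
    qed
    have e_le_U: "norm (e s) \<le> 2 * \<epsilon> * (c * U)" if "0 < s" "s \<le> \<tau>" for s
      by (intro e_le c x_le_U that)
    \<comment> \<open>Here the common potential enters: \<open>\<gamma> \<tau> \<tau> 0\<close> is
      expressed once through k by the row equation and once through \<open>x \<tau>\<close>, the
      corresponding value for k'.\<close>
    have d_eq: "d \<tau> = - (e \<tau>) - (LINT \<xi>|leb \<tau>. \<gamma> \<tau> \<tau> \<xi> ** d \<xi>) - (LINT \<xi>|leb \<tau>. \<gamma> \<tau> \<tau> \<xi> ** e \<xi>)"
    proof -
      have "(LINT \<xi>|leb \<tau>. \<gamma> \<tau> \<tau> \<xi> ** w \<xi>) =
          (LINT \<xi>|leb \<tau>. (\<gamma> \<tau> \<tau> \<xi> ** k \<xi> + \<gamma> \<tau> \<tau> \<xi> ** d \<xi>) + \<gamma> \<tau> \<tau> \<xi> ** e \<xi>)"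
        by (rule LINT_cong) (simp add: w d_def matrix_add_ldistrib[symmetric])
      also have "\<dots> = (LINT \<xi>|leb \<tau>. \<gamma> \<tau> \<tau> \<xi> ** k \<xi>) + (LINT \<xi>|leb \<tau>. \<gamma> \<tau> \<tau> \<xi> ** d \<xi>) +
          (LINT \<xi>|leb \<tau>. \<gamma> \<tau> \<tau> \<xi> ** e \<xi>)"
        by (subst LINT_add, intro bmeas_add bmeas_mult bk bd b\<gamma>, intro bmeas_mult be b\<gamma>, subst LINT_add)
          (intro bmeas_mult bk bd b\<gamma> refl)+
      finally have *: "(LINT \<xi>|leb \<tau>. \<gamma> \<tau> \<tau> \<xi> ** w \<xi>) = \<dots>" .
      have k\<tau>: "k \<tau> = \<gamma> \<tau> \<tau> 0 - (LINT \<xi>|leb \<tau>. \<gamma> \<tau> \<tau> \<xi> ** k \<xi>)"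
        using row[of \<tau> \<tau> 0] \<tau> a by simp
      have \<gamma>0: "\<gamma> \<tau> \<tau> 0 = w \<tau> + (LINT \<xi>|leb \<tau>. \<gamma> \<tau> \<tau> \<xi> ** w \<xi>)"
        using x_repr[of \<tau>] \<tau> x(2) same by simp
      have "d \<tau> = w \<tau> - k \<tau> - e \<tau>" using w[of \<tau>] \<tau> by (simp add: d_def)
      also have "\<dots> = - (e \<tau>) - (LINT \<xi>|leb \<tau>. \<gamma> \<tau> \<tau> \<xi> ** d \<xi>) - (LINT \<xi>|leb \<tau>. \<gamma> \<tau> \<tau> \<xi> ** e \<xi>)"
        unfolding k\<tau> \<gamma>0 * by (simp add: algebra_simps)
      finally show ?thesis .
    qed
    have "norm (LINT \<xi>|leb \<tau>. \<gamma> \<tau> \<tau> \<xi> ** d \<xi>) \<le> 2 * (\<tau> - a) * (B * c)"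
    proof (rule norm_LINT_far_le[where s = 0])
      fix \<xi> assume \<xi>: "0 < \<xi>" "\<xi> < \<tau>"
      have "norm (\<gamma> \<tau> \<tau> \<xi>) * norm (d \<xi>) \<le> B * (if \<bar>0 - \<xi>\<bar> \<le> a then 0 else c)"
        using zero[of \<xi>] c(2)[of \<xi>] \<xi> B B0 by (intro mult_mono) auto
      also have "\<dots> = (if \<bar>0 - \<xi>\<bar> \<le> a then 0 else B * c)" by simp
      finally show "norm (\<gamma> \<tau> \<tau> \<xi> ** d \<xi>) \<le> (if \<bar>0 - \<xi>\<bar> \<le> a then 0 else B * c)"
        by (rule order_trans[OF norm_matrix_mult_le])
    qed (use a \<tau> B0 c in auto)
    also have "\<dots> \<le> 2 * \<epsilon> * (B * c)" using a c B0 by (intro mult_right_mono) auto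
    finally have 1: "norm (LINT \<xi>|leb \<tau>. \<gamma> \<tau> \<tau> \<xi> ** d \<xi>) \<le> 2 * \<epsilon> * (B * c)" .
    have 2: "norm (LINT \<xi>|leb \<tau>. \<gamma> \<tau> \<tau> \<xi> ** e \<xi>) \<le> T * B * (2 * \<epsilon> * (c * U))"
      using \<epsilon> c U by (intro row_le e_le_U) auto
    have "norm (d \<tau>) \<le> 2 * \<epsilon> * (c * U) + 2 * \<epsilon> * (B * c) + T * B * (2 * \<epsilon> * (c * U))"
      unfolding d_eq using e_le_U[OF \<tau> order_refl] 1 2
      by (intro order_trans[OF norm_triangle_ineq4] add_mono) auto
    also have "\<dots> = 2 * \<epsilon> * (U * A + B) * c" by (simp add: A_def algebra_simps)
    also have "\<dots> \<le> 1 / 2 * c" using \<epsilon>1(2) c by (intro mult_right_mono) auto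
    finally show ?thesis by simp
  qed
  have zero: "\<forall>u. 0 < u \<longrightarrow> u \<le> real n * \<epsilon> \<longrightarrow> u \<le> T \<longrightarrow> d u = 0" for n
  proof (induction n)
    case (Suc n)
    define a where "a = real n * \<epsilon>"
    have a: "0 \<le> a" using \<epsilon> by (simp add: a_def)
    show ?case
    proof (intro allI impI)
      fix u assume u: "0 < u" "u \<le> real (Suc n) * \<epsilon>" "u \<le> T"
      show "d u = 0"
      proof (cases "u \<le> a")
        case True
        then show ?thesis using Suc u by (simp add: a_def)
      next
        case False
        have "norm (d u) \<le> 0"
        proof (rule zero_by_halving[where D = "{a<..u}" and e = "\<lambda>u. norm (d u)" and w = "\<lambda>_. 1" and C = D])
          fix c \<tau> assume c: "0 \<le> c" and le: "\<And>p. p \<in> {a<..u} \<Longrightarrow> norm (d p) \<le> c * 1" and \<tau>: "\<tau> \<in> {a<..u}"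
          have "norm (d \<tau>) \<le> c / 2"
          proof (rule step[of a])
            show "\<tau> \<le> a + \<epsilon>" using \<tau> u by (simp add: a_def algebra_simps)
            show z: "d p = 0" if "0 < p" "p \<le> a" for p
              using Suc that \<tau> u by (auto simp: a_def)
            show "norm (d p) \<le> c" if "0 < p" "p \<le> \<tau>" for p
              using le[of p] z[of p] that \<tau> c by (cases "p \<le> a") auto
          qed (use a c \<tau> u in auto)
          then show "norm (d \<tau>) \<le> c / 2 * 1" by simp
        qed (use D False in auto)
        then show ?thesis by simp
      qed
    qed
  qed (use \<epsilon> in auto)
  obtain n where "T / \<epsilon> \<le> real n" using real_arch_simple by blast
  then have "t \<le> real n * \<epsilon>" using t \<epsilon> by (simp add: field_simps)
  then have "d t = 0" using zero[of n] t by blast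
  then show ?thesis using t by (simp add: d_def k0_def)
qed

section \<open>Existence of the accelerant\<close>

lemma continuous_with_jump_at_0_jump:
  fixes f g :: "real \<Rightarrow> complex^'r^'r"
  assumes f: "continuous_on UNIV f" and g: "continuous_on UNIV g"
  shows "continuous_with_jump_at_0 T (jump f g)"
proof -
  have g': "continuous_on UNIV (\<lambda>u. g (- u))"
    by (intro continuous_on_compose2[OF g] continuous_intros) auto
  have "continuous_on {-T..<0} (jump f g)"
    using continuous_on_subset[OF g'] by (subst continuous_on_cong[OF refl, of _ _ "\<lambda>u. g (- u)"]) (auto simp: jump_def)
  moreover have "continuous_on {0<..T} (jump f g)"
    using continuous_on_subset[OF f] by (subst continuous_on_cong[OF refl, of _ _ f]) (auto simp: jump_def)
  moreover have "(jump f g \<longlongrightarrow> g (- 0)) (at_left 0)"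
  proof (rule Lim_transform_eventually)
    show "((\<lambda>u. g (- u)) \<longlongrightarrow> g (- 0)) (at_left 0)"
      by (rule tendsto_mono[OF at_le[OF subset_UNIV]])
        (use continuous_on_eq_continuous_at[THEN iffD1, THEN bspec, OF open_UNIV g', of 0] in \<open>simp add: isCont_def\<close>)
    show "eventually (\<lambda>u. g (- u) = jump f g u) (at_left 0)"
      by (auto simp: eventually_at_filter jump_def)
  qed
  moreover have "(jump f g \<longlongrightarrow> f 0) (at_right 0)"
  proof (rule Lim_transform_eventually)
    show "(f \<longlongrightarrow> f 0) (at_right 0)"
      by (rule tendsto_mono[OF at_le[OF subset_UNIV]])
        (use continuous_on_eq_continuous_at[THEN iffD1, THEN bspec, OF open_UNIV f, of 0] in \<open>simp add: isCont_def\<close>)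
    show "eventually (\<lambda>u. f u = jump f g u) (at_right 0)"
      by (auto simp: eventually_at_filter jump_def)
  qed
  ultimately show ?thesis unfolding continuous_with_jump_at_0_def by blast
qed

text \<open>\<open>Z\<close> alone determines all the resolvent kernels, and \<open>f\<close>
  determines k; the auxiliary \<open>X\<close> and \<open>g\<close> serve to show that the two fit
  together.\<close>

lemma goursat_accelerant:
  fixes a :: "real \<Rightarrow> complex^'r^'r"
  assumes T: "0 < T" and a: "continuous_on UNIV a" "bounded (range a)"
  obtains Z f where "continuous_on UNIV Z" "bounded (range Z)" "continuous_on UNIV f" "bounded (range f)"
    "\<And>t. Z (t, t) = conj_transpose (a t)"
    "\<And>\<sigma> t. 0 \<le> t \<Longrightarrow> t < \<sigma> \<Longrightarrow> \<sigma> \<le> T \<Longrightarrow>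
      trunc_conv T (jump f (\<lambda>u. conj_transpose (f u))) \<sigma> (\<lambda>\<xi>. Z (\<sigma>, \<sigma> - \<xi>)) t =
      jump f (\<lambda>u. conj_transpose (f u)) (t - \<sigma>)"
proof -
  have T0: "0 \<le> T" using T by simp
  define b where "b t = conj_transpose (a t)" for t
  have b: "continuous_on UNIV b" "bounded (range b)"
    using a(2) bounded_linear.continuous_on[OF bounded_linear_conj_transpose a(1)]
    by (auto simp: b_def[abs_def] bounded_iff)
  obtain X Z where XZ: "continuous_on UNIV X" "bounded (range X)" "continuous_on UNIV Z" "bounded (range Z)"
    and X: "\<And>\<tau> t. X (\<tau>, t) = a t + goursat_integral T Z a \<tau> t"
    and Z: "\<And>\<tau> t. Z (\<tau>, t) = b t + goursat_integral T X b \<tau> t"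
    by (rule goursat_solution[OF T0 a b], rule that)
  obtain f where fcb: "continuous_on UNIV f" "bounded (range f)"
    and f: "\<And>t. 0 \<le> t \<Longrightarrow> t \<le> T \<Longrightarrow> f t = a t - (LINT u|leb T. (if u < t then f (t - u) ** X (t, u) else 0))"
    by (rule volterra_solution[OF T0 a XZ(1,2)], rule that)
  obtain g where gcb: "continuous_on UNIV g" "bounded (range g)"
    and g: "\<And>t. 0 \<le> t \<Longrightarrow> t \<le> T \<Longrightarrow> g t = b t - (LINT u|leb T. (if u < t then g (t - u) ** Z (t, u) else 0))"
    by (rule volterra_solution[OF T0 b XZ(3,4)], rule that)
  note bm = bmeas_continuous[OF XZ(1,2)] bmeas_continuous[OF XZ(3,4)] bmeas_continuous[OF fcb] bmeas_continuous[OF gcb]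
    bmeas_continuous[OF a] bmeas_continuous[OF b]
  note res = goursat_residuals_zero[OF T0 bm X Z f g]
  have gf: "g t = conj_transpose (f t)" if "0 \<le> t" "t \<le> T" for t
    using goursat_accelerant_hermitian[OF T0 bm(1-4) res(1) res(2) f g[unfolded b_def] that] by simp
  \<comment> \<open>\<open>g\<close> is the adjoint of \<open>f\<close> only on [0, T]. Building k
    from \<open>f\<close> alone makes it hermitian on the whole line, and it agrees with
    \<open>jump f g\<close> at all arguments that occur.\<close>
  define k where "k = jump f (\<lambda>u. conj_transpose (f u))"
  have k: "k u = jump f g u" if "- T \<le> u" for u
    using that by (simp add: k_def jump_def gf)
  show ?thesis
  proof (rule that[OF XZ(3,4) fcb])
    show "Z (t, t) = conj_transpose (a t)" for t
    proof -
      have "goursat_integral T X b t t = (LINT \<sigma>|leb T. 0)"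
        unfolding goursat_integral_def by (rule LINT_cong) auto
      then show ?thesis by (simp add: Z b_def)
    qed
    fix \<sigma> t :: real assume t: "0 \<le> t" "t < \<sigma>" "\<sigma> \<le> T"
    have "trunc_conv T k \<sigma> (\<lambda>\<xi>. Z (\<sigma>, \<sigma> - \<xi>)) t = trunc_conv T (jump f g) \<sigma> (\<lambda>\<xi>. Z (\<sigma>, \<sigma> - \<xi>)) t"
      unfolding trunc_conv_def using t by (intro arg_cong2[where f = "(-)"] refl LINT_cong) (auto simp: k)
    also have "\<dots> = trunc_conv T (jump g f) \<sigma> (\<lambda>\<xi>. Z (\<sigma>, \<xi>)) (\<sigma> - t)"
      using t by (subst trunc_conv_reflect[OF t(3)]) (simp add: jump_minus)
    also have "\<dots> = g (\<sigma> - t)" using t by (intro res(2)) auto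
    also have "\<dots> = k (t - \<sigma>)" using t by (simp add: k) (simp add: jump_def)
    finally show "trunc_conv T (jump f (\<lambda>u. conj_transpose (f u))) \<sigma> (\<lambda>\<xi>. Z (\<sigma>, \<sigma> - \<xi>)) t =
      jump f (\<lambda>u. conj_transpose (f u)) (t - \<sigma>)" by (simp only: k_def)
  qed
qed

lemma conv_operator_kernel_operator:
  "conv_operator k \<tau> = kernel_operator \<tau> (\<lambda>p. - k (fst p - snd p))"
proof (intro ext)
  fix f :: "real \<Rightarrow> complex^'a" and t
  have "(- A) *v x = - (A *v x)" for A :: "complex^'a^'a" and x
    using bounded_bilinear.minus_left[OF bounded_bilinear_matrix_vector_mult] .
  then show "conv_operator k \<tau> f t = kernel_operator \<tau> (\<lambda>p. - k (fst p - snd p)) f t"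
    by (simp add: conv_operator_def kernel_operator_def)
qed

text \<open>In terms of composed kernels, \<open>col\<close> says that I plus the operator with
  kernel \<gamma> is a right inverse, and \<open>row\<close> that it is a left inverse.\<close>

lemma L2_invertible_conv_operator:
  fixes k :: "real \<Rightarrow> complex^'r^'r"
  assumes \<tau>: "0 < \<tau>" and k: "bmeas k" and \<gamma>: "bmeas (\<lambda>p. \<gamma> (fst p) (snd p))"
    and col: "\<And>t s. 0 < t \<Longrightarrow> t < \<tau> \<Longrightarrow> 0 < s \<Longrightarrow> s < \<tau> \<Longrightarrow> t \<noteq> s \<Longrightarrow>
      \<gamma> t s - (LINT \<xi>|leb \<tau>. k (t - \<xi>) ** \<gamma> \<xi> s) = k (t - s)"
    and row: "\<And>t s. 0 < t \<Longrightarrow> t < \<tau> \<Longrightarrow> 0 < s \<Longrightarrow> s < \<tau> \<Longrightarrow> t \<noteq> s \<Longrightarrow>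
      \<gamma> t s - (LINT \<xi>|leb \<tau>. \<gamma> t \<xi> ** k (\<xi> - s)) = k (t - s)"
  shows "L2_invertible \<tau> (conv_operator k \<tau>)"
proof -
  define \<kappa> where "\<kappa> p = - k (fst p - snd p)" for p
  define \<kappa>' where "\<kappa>' p = \<gamma> (fst p) (snd p)" for p
  have "bmeas (\<lambda>p::real \<times> real. 0 - k (fst p - snd p))" by (intro bmeas_intros bmeas_comp[OF k])
  then have b\<kappa>: "bmeas \<kappa>" by (simp add: \<kappa>_def[abs_def])
  have b\<kappa>': "bmeas \<kappa>'" using \<gamma> by (simp add: \<kappa>'_def[abs_def])
  have minus: "(- A) ** B = - (A ** B)" "A ** (- B) = - (A ** B)" for A B :: "complex^'r^'r"
    using bounded_bilinear.minus_left[OF bounded_bilinear_matrix_mult]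
      bounded_bilinear.minus_right[OF bounded_bilinear_matrix_mult] by blast+
  have 1: "kernel_operator \<tau> \<kappa> (kernel_operator \<tau> \<kappa>' f) t = f t" if "f \<in> L2 \<tau>" "0 < t" "t < \<tau>" for f t
  proof (rule kernel_operator_compose[OF b\<kappa> b\<kappa>' \<tau> that(1)])
    fix s assume "0 < s" "s < \<tau>" "s \<noteq> t"
    then show "\<kappa> (t, s) + \<kappa>' (t, s) + (LINT \<xi>|leb \<tau>. \<kappa> (t, \<xi>) ** \<kappa>' (\<xi>, s)) = 0"
      using col[OF that(2,3), of s] by (simp add: \<kappa>_def \<kappa>'_def minus algebra_simps)
  qed
  have 2: "kernel_operator \<tau> \<kappa>' (kernel_operator \<tau> \<kappa> f) t = f t" if "f \<in> L2 \<tau>" "0 < t" "t < \<tau>" for f t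
  proof (rule kernel_operator_compose[OF b\<kappa>' b\<kappa> \<tau> that(1)])
    fix s assume "0 < s" "s < \<tau>" "s \<noteq> t"
    then show "\<kappa>' (t, s) + \<kappa> (t, s) + (LINT \<xi>|leb \<tau>. \<kappa>' (t, \<xi>) ** \<kappa> (\<xi>, s)) = 0"
      using row[OF that(2,3), of s] by (simp add: \<kappa>_def \<kappa>'_def minus algebra_simps)
  qed
  show ?thesis
    unfolding L2_invertible_def conv_operator_kernel_operator \<kappa>_def[abs_def, symmetric]
    by (intro conjI exI[of _ "kernel_operator \<tau> \<kappa>'"] ballI AE_I2 L2_bounded_kernel_operator b\<kappa> b\<kappa>' \<tau> 1 2) auto
qed

theorem theorem1p2:
  fixes T :: real and v :: "real \<Rightarrow> complex^'r^'r"
  assumes "T > 0" and "continuous_on {0..T} v"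
  shows "\<exists>k. is_accelerant_of_potential T v k \<and>
           (\<forall>k'. is_accelerant_of_potential T v k' \<longrightarrow> (\<forall>t\<in>{-T..T} - {0}. k' t = k t))"
proof -
  have T: "0 < T" "0 \<le> T" using assms(1) by auto
  \<comment> \<open>The function \<alpha> = i v, extended by its end values to a bounded continuous
    function on the line.\<close>
  define a :: "real \<Rightarrow> complex^'r^'r" where "a t = (\<chi> i j. \<i> * v (max 0 (min T t)) $ i $ j)" for t
  have vc: "continuous_on UNIV (\<lambda>t. v (max 0 (min T t)))"
    using T by (intro continuous_on_compose2[OF assms(2)] continuous_intros) auto
  have a_cont: "continuous_on UNIV a"
    unfolding a_def[abs_def] by (intro continuous_intros vc)
  have "bounded (range a)"
  proof -
    have "range a \<subseteq> a ` {0..T}"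
    proof
      fix y assume "y \<in> range a"
      then obtain t where "y = a t" by blast
      then have "y = a (max 0 (min T t))" using T by (simp add: a_def)
      then show "y \<in> a ` {0..T}" using T by auto
    qed
    moreover have "compact (a ` {0..T})"
      by (intro compact_continuous_image continuous_on_subset[OF a_cont]) auto
    ultimately show ?thesis using bounded_subset compact_imp_bounded by blast
  qed
  from goursat_accelerant[OF T(1) a_cont this] obtain Z f where Zcb: "continuous_on UNIV Z" "bounded (range Z)"
    and fcb: "continuous_on UNIV f" "bounded (range f)"
    and Z_diag: "\<And>t. Z (t, t) = conj_transpose (a t)"
    and Z_eq: "\<And>\<sigma> t. 0 \<le> t \<Longrightarrow> t < \<sigma> \<Longrightarrow> \<sigma> \<le> T \<Longrightarrow>
      trunc_conv T (jump f (\<lambda>u. conj_transpose (f u))) \<sigma> (\<lambda>\<xi>. Z (\<sigma>, \<sigma> - \<xi>)) t =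
      jump f (\<lambda>u. conj_transpose (f u)) (t - \<sigma>)"
    by metis
  define k where "k = jump f (\<lambda>u. conj_transpose (f u))"
  note bZ = bmeas_continuous[OF Zcb]
  have bk: "bmeas k"
    unfolding k_def by (intro bmeas_jump bmeas_conj_transpose bmeas_continuous fcb)
  have herm: "k (- u) = conj_transpose (k u)" for u by (simp add: k_def jump_def)
  note eqn = Z_eq[folded k_def]
  define \<gamma> where "\<gamma> = krein_kernel T Z"
  have col: "\<gamma> \<tau> t s - (LINT \<xi>|leb \<tau>. k (t - \<xi>) ** \<gamma> \<tau> \<xi> s) = k (t - s)"
    if "0 \<le> t" "t \<le> \<tau>" "0 \<le> s" "s \<le> \<tau>" "\<tau> \<le> T" "t \<noteq> s" for \<tau> t s
    using krein_kernel_resolvent[OF T(2) bZ bk herm eqn that] that by (simp add: trunc_conv_leb \<gamma>_def)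
  have row: "\<gamma> \<tau> t s - (LINT \<xi>|leb \<tau>. \<gamma> \<tau> t \<xi> ** k (\<xi> - s)) = k (t - s)"
    if "0 \<le> t" "t \<le> \<tau>" "0 \<le> s" "s \<le> \<tau>" "\<tau> \<le> T" "t \<noteq> s" for \<tau> t s
    unfolding \<gamma>_def by (rule krein_kernel_resolvent_row[OF T(2) bZ bk herm eqn that])
  \<comment> \<open>At the corner (\<tau>, 0) the integral in the kernel is empty; the remaining
    term is the adjoint of the diagonal value \<open>Z (\<tau>, \<tau>)\<close>, which is
    \<open>a \<tau>\<close>.\<close>
  have v: "v \<tau> = (\<chi> i j. - \<i> * \<gamma> \<tau> \<tau> 0 $ i $ j)" if "0 < \<tau>" "\<tau> \<le> T" for \<tau>
  proof -
    have "(LINT \<sigma>|leb T. (if \<tau> < \<sigma> \<and> 0 < \<sigma> \<and> \<sigma> < \<tau>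
        then Z (\<sigma>, \<sigma> - \<tau>) ** conj_transpose (Z (\<sigma>, \<sigma> - 0)) else 0)) = (LINT \<sigma>|leb T. 0)"
      by (rule LINT_cong) auto
    then have "\<gamma> \<tau> \<tau> 0 = a \<tau>" using that by (simp add: \<gamma>_def krein_kernel_def Z_diag)
    then show ?thesis using that by (simp add: a_def vec_eq_iff)
  qed
  have "is_accelerant_of_potential T v k"
    unfolding is_accelerant_of_potential_def
  proof (intro conjI ballI)
    show "hermitian_kernel T k" by (simp add: hermitian_kernel_def herm)
    show "continuous_with_jump_at_0 T k"
      unfolding k_def by (intro continuous_with_jump_at_0_jump fcb bounded_linear.continuous_on[OF bounded_linear_conj_transpose])
    fix \<tau> assume "\<tau> \<in> {0<..T}"
    then have \<tau>: "0 < \<tau>" "\<tau> \<le> T" by auto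
    show "L2_invertible \<tau> (conv_operator k \<tau>)"
    proof (rule L2_invertible_conv_operator[OF \<tau>(1) bk])
      show "bmeas (\<lambda>p. \<gamma> \<tau> (fst p) (snd p))" unfolding \<gamma>_def by (rule bmeas_krein_kernel[OF bZ T(2)])
    qed (use col row \<tau> in auto)
    have "is_resolvent_kernel k \<tau> (\<gamma> \<tau>)"
      unfolding is_resolvent_kernel_def using col \<tau> krein_kernel_extends[OF T(2) Zcb] by (auto simp: \<gamma>_def)
    then show "\<exists>\<gamma>. is_resolvent_kernel k \<tau> \<gamma> \<and> v \<tau> = (\<chi> i j. - \<i> * \<gamma> \<tau> 0 $ i $ j)"
      using v[OF \<tau>] by blast
  qed
  moreover have "k' t = k t" if acc: "is_accelerant_of_potential T v k'" and t: "t \<in> {-T..T} - {0}" for k' t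
  proof -
    obtain C where C: "\<And>p. norm (Z p) \<le> C" using bmeas_bound[OF bZ] by blast
    have b\<gamma>: "bmeas (\<gamma> \<tau> t)" for \<tau> t
      using bmeas_comp[OF bmeas_krein_kernel[OF bZ T(2), of \<tau>] Pair_borel_measurable[of t]] by (simp add: \<gamma>_def)
    \<comment> \<open>The bound on \<gamma> is uniform in \<tau>, t and s, as the fixed step length
      in \<open>accelerant_unique\<close> requires.\<close>
    have pos: "k' s = k s" if "0 < s" "s \<le> T" for s
      by (rule accelerant_unique[OF T(1) bk herm b\<gamma> _ row v acc that])
        (auto simp: \<gamma>_def intro: norm_krein_kernel_le[OF T(2) C])
    show ?thesis
    proof (cases "0 < t")
      case False
      have "hermitian_kernel T k'" using acc by (simp add: is_accelerant_of_potential_def)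
      then have "k' (- (- t)) = conj_transpose (k' (- t))"
        using t unfolding hermitian_kernel_def by (intro bspec[of _ _ "- t"]) auto
      also have "\<dots> = k t" using pos[of "- t"] False t herm[of "- t"] by simp
      finally show ?thesis by simp
    qed (use t in \<open>auto intro: pos\<close>)
  qed
  ultimately show ?thesis by blast
qed

end
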